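(* Let $\Omega$ be a closed simply connected, possibly multi-sheeted, planar domain bounded by a smooth closed curve $\Gamma=\partial\Omega$ of length $2\pi$, let $\mathbb{S}=\{e^{is}\mid s\in\mathbb{R}\}$ be the unit circle, and let $\gamma:\mathbb{S}\to\Gamma$ be a diffeomorphism preserving arc-length and orientation. Fix $s_0\in(0,\pi)$, let $\Phi:\mathbb{D}\to\Omega$ be the unique biholomorphism of the closed unit disk $\mathbb{D}$ onto $\Omega$ whose boundary restriction $\varphi=\Phi|_{\mathbb{S}}:\mathbb{S}\to\Gamma$ satisfies $$\varphi(1)=\gamma(1),\quad\varphi(e^{is_0})=\gamma(e^{is_0}),\quad\varphi(e^{-is_0})=\gamma(e^{-is_0}),$$ and let $\Theta:\mathbb{R}\to\mathbb{R}$ be the inverse function of $S(\theta)=\int_0^\theta|\Phi'(e^{it})|\,dt$, so that $\gamma(e^{is})=\varphi(e^{i\Theta(s)})$ for $s\in\mathbb{R}$. Let $\mathcal{H}_\gamma:C^\infty(\mathbb{S})\to C^\infty(\mathbb{S})$ be the Hilbert transform of $\Gamma$ in the natural parametrization. Then for every function $u\in C^\infty(\mathbb{S})$ there exists a constant $C=C(u)$ (independent of $s$) such that, for all $s\in\mathbb{R}$, $$(\mathcal{H}_\gamma u)(e^{is})=\frac{1}{2\pi i}\int_0^{2\pi}\Theta'(\sigma)\,\cot\frac{\Theta(\sigma)-\Theta(s)}{2}\,u(e^{i\sigma})\,d\sigma+C,$$ where the integral is understood in the sense of the principal value at $\sigma=s$.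
   Context: A closed simply connected, possibly multi-sheeted, planar domain $\Omega$ bounded by a smooth closed curve $\Gamma$ is a compact simply connected smooth surface with non-empty boundary $\Gamma=\partial\Omega$ together with a smooth immersion into $\mathbb{C}=\mathbb{R}^2$; it carries the Euclidean metric, orientation and complex structure pulled back by the immersion (an ordinary domain in $\mathbb{C}$ is the case of an embedding). Functions on $\Omega$ and $\Gamma$ are functions on the surface and on its boundary, so they may take different values at different copies of a multiple point of the image. All functions are complex-valued unless said otherwise and $C^\infty(\cdot)$ denotes smooth functions. The curve $\Gamma$ has the anticlockwise (boundary) orientation, $s$ is the arc-length, and $\mathbb{S}$ is oriented anticlockwise. The Dirichlet-to-Neumann map $\Lambda_\Omega:C^\infty(\Gamma)\to C^\infty(\Gamma)$ is $\Lambda_\Omega f=\frac{\partial u}{\partial\nu}\big|_\Gamma$, where $\nu$ is the unit outer normal and $u$ is the unique solution of $\Delta u=0$ in $\Omega$, $u|_\Gamma=f$. Its range is $C_0^\infty(\Gamma)=\{f\in C^\infty(\Gamma)\mid\int_\Gamma f\,ds=0\}$. $D=-i\frac{d}{ds}$ is differentiation with respect to arc-length in the positive direction; its restriction $D:C_0^\infty(\Gamma)\to C_0^\infty(\Gamma)$ is an isomorphism with inverse denoted $D^{-1}:C_0^\infty(\Gamma)\to C_0^\infty(\Gamma)$. For a smooth map $\varphi$, $\varphi^*u=u\circ\varphi$. The Hilbert transform on $\Gamma$ is $\mathcal{H}_\Gamma=D^{-1}\Lambda_\Omega:C^\infty(\Gamma)\to C^\infty(\Gamma)$, and the Hilbert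 transform of $\Gamma$ in the natural parametrization is $\mathcal{H}_\gamma=\gamma^*\mathcal{H}_\Gamma\gamma^{*-1}:C^\infty(\mathbb{S})\to C^\infty(\mathbb{S})$. $\mathbb{D}=\{z\in\mathbb{C}\mid|z|\le1\}$. A biholomorphism $\Phi:\mathbb{D}\to\Omega$ is a diffeomorphism of surfaces with boundary (smooth up to the boundary) that is holomorphic in $\mathbb{D}\setminus\mathbb{S}$; regarded as a map to $\mathbb{C}$ via the immersion, its complex derivative $\Phi'$ does not vanish in $\mathbb{D}$. Its boundary restriction $\varphi:\mathbb{S}\to\Gamma$ is an orientation preserving diffeomorphism. The function $S$ is real, smooth, with $S'>0$ and $S(\theta+2k\pi)=S(\theta)+2k\pi$ for $k\in\mathbb{Z}$; its inverse $\Theta$ is smooth with $\Theta'>0$, $\Theta(s+2k\pi)=\Theta(s)+2k\pi$ for $k\in\mathbb{Z}$, $\Theta(0)=0$ and $\Theta(\pm s_0)=\pm s_0$. The integrand in the claim is $2\pi$-periodic in $\sigma$, and the principal value is taken on the circle $\mathbb{R}/2\pi\mathbb{Z}$ at the single singular point $\sigma\equiv s$. *)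

theory Defs
  imports "HOL-Analysis.Analysis"
begin

section \<open>Smooth functions on subsets of Euclidean spaces\<close>

text \<open>
  \<open>Ck_on k A f\<close>: derivatives of \<open>f\<close> up to order \<open>k\<close> exist relative to \<open>A\<close> and are
  continuous on \<open>A\<close>. It is only used for sets \<open>A\<close> that are open in \<open>\<real>\<close>, relatively open in
  the closed upper half-plane or relatively open in the closed unit disk. On these the derivative
  relative to \<open>A\<close> is unique, and \<open>smooth_on\<close> is smoothness up to the boundary.
\<close>

primrec Ck_on :: "nat \<Rightarrow> 'a::euclidean_space set \<Rightarrow> ('a \<Rightarrow> 'b::real_normed_vector) \<Rightarrow> bool" where
  "Ck_on 0 A f \<longleftrightarrow> continuous_on A f"
| "Ck_on (Suc k) A f \<longleftrightarrow>
     (\<exists>f'. (\<forall>x\<in>A. (f has_derivative f' x) (at x within A)) \<and> (\<forall>h. Ck_on k A (\<lambda>x. f' x h)))"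

definition smooth_on :: "'a::euclidean_space set \<Rightarrow> ('a \<Rightarrow> 'b::real_normed_vector) \<Rightarrow> bool" where
  "smooth_on A f \<longleftrightarrow> (\<forall>k. Ck_on k A f)"

text \<open>A function on the unit circle is represented by its values on \<open>sphere 0 1\<close>.\<close>

definition smooth_circle_fun :: "(complex \<Rightarrow> complex) \<Rightarrow> bool" where
  "smooth_circle_fun u \<longleftrightarrow> smooth_on UNIV (\<lambda>t::real. u (cis t))"

section \<open>Multi-sheeted planar domains\<close>

text \<open>
  A surface with boundary is a set \<open>pts\<close> in a Hausdorff space with an atlas \<open>charts\<close> of pairs
  \<open>(U, c)\<close>, where \<open>c\<close> maps \<open>U\<close> into the closed upper half-plane; \<open>imm\<close> is the immersion
  into the complex plane. No chart is required to preserve an orientation: metric, orientation and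
  complex structure always come from \<open>imm\<close>.
\<close>

record 'a immersed_surface =
  pts :: "'a set"
  charts :: "('a set \<times> ('a \<Rightarrow> complex)) set"
  imm :: "'a \<Rightarrow> complex"

definition upper_halfplane :: "complex set" where
  "upper_halfplane = {z. 0 \<le> Im z}"

definition is_chart :: "'a::t2_space set \<Rightarrow> 'a set \<Rightarrow> ('a \<Rightarrow> complex) \<Rightarrow> bool" where
  "is_chart X U c \<longleftrightarrow>
     openin (top_of_set X) U \<and> openin (top_of_set upper_halfplane) (c ` U) \<and>
     homeomorphism U (c ` U) c (inv_into U c)"

definition smooth_surface :: "'a::t2_space immersed_surface \<Rightarrow> bool" where
  "smooth_surface M \<longleftrightarrow>
     (\<forall>(U, c) \<in> charts M. is_chart (pts M) U c) \<and>
     pts M = (\<Union>(U, c) \<in> charts M. U) \<and>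
     (\<forall>(U, c) \<in> charts M. \<forall>(V, d) \<in> charts M. smooth_on (c ` (U \<inter> V)) (d \<circ> inv_into U c))"

definition bdry :: "'a::t2_space immersed_surface \<Rightarrow> 'a set" where
  "bdry M = {p. \<exists>(U, c) \<in> charts M. p \<in> U \<and> Im (c p) = 0}"

definition smooth_fun :: "'a::t2_space immersed_surface \<Rightarrow> ('a \<Rightarrow> complex) \<Rightarrow> bool" where
  "smooth_fun M u \<longleftrightarrow> (\<forall>(U, c) \<in> charts M. smooth_on (c ` U) (u \<circ> inv_into U c))"

definition smooth_immersion :: "'a::t2_space immersed_surface \<Rightarrow> bool" where
  "smooth_immersion M \<longleftrightarrow> smooth_fun M (imm M) \<and>
     (\<forall>(U, c) \<in> charts M. \<forall>p\<in>U. \<forall>A.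
        (imm M \<circ> inv_into U c has_derivative A) (at (c p) within c ` U) \<longrightarrow> inj A)"

definition multisheeted_domain :: "'a::t2_space immersed_surface \<Rightarrow> bool" where
  "multisheeted_domain M \<longleftrightarrow>
     smooth_surface M \<and> compact (pts M) \<and> simply_connected (pts M) \<and> bdry M \<noteq> {} \<and>
     smooth_immersion M"

text \<open>Smooth maps from a subset of a Euclidean space into the surface.\<close>

definition smooth_into ::
    "'a::t2_space immersed_surface \<Rightarrow> 'b::euclidean_space set \<Rightarrow> ('b \<Rightarrow> 'a) \<Rightarrow> bool" where
  "smooth_into M A F \<longleftrightarrow>
     continuous_on A F \<and> F ` A \<subseteq> pts M \<and>
     (\<forall>(U, c) \<in> charts M. smooth_on {x\<in>A. F x \<in> U} (c \<circ> F))"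

section \<open>Calculus in the pulled-back Euclidean structure\<close>

text \<open>
  The differential of \<open>u\<close> at \<open>p\<close>, transported to the plane by the isomorphism
  \<open>d imm\<close>: the real-linear \<open>L\<close> with \<open>du = L \<circ> d imm\<close> at \<open>p\<close>.
\<close>

definition planar_differential ::
    "'a::t2_space immersed_surface \<Rightarrow> ('a \<Rightarrow> complex) \<Rightarrow> 'a \<Rightarrow> complex \<Rightarrow> complex" where
  "planar_differential M u p =
     (THE L. \<exists>(U, c) \<in> charts M. p \<in> U \<and>
        (\<exists>A. (imm M \<circ> inv_into U c has_derivative A) (at (c p) within c ` U) \<and>
             (u \<circ> inv_into U c has_derivative L \<circ> A) (at (c p) within c ` U)))"

text \<open>The two summands are the second derivatives along the pulled-back coordinate vector fields.\<close>

definition laplacian ::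
    "'a::t2_space immersed_surface \<Rightarrow> ('a \<Rightarrow> complex) \<Rightarrow> 'a \<Rightarrow> complex" where
  "laplacian M u p =
     planar_differential M (\<lambda>q. planar_differential M u q 1) p 1 +
     planar_differential M (\<lambda>q. planar_differential M u q \<i>) p \<i>"

text \<open>
  Unit outer normal at a boundary point, as a vector of the plane: orthogonal to the image of the
  boundary direction \<open>1\<close> of the half-plane, and at an obtuse angle to the image of the inward
  direction \<open>\<i>\<close>.
\<close>

definition outer_normal :: "'a::t2_space immersed_surface \<Rightarrow> 'a \<Rightarrow> complex" where
  "outer_normal M p =
     (THE n. cmod n = 1 \<and>
        (\<exists>(U, c) \<in> charts M. p \<in> U \<and>
           (\<exists>A. (imm M \<circ> inv_into U c has_derivative A) (at (c p) within c ` U) \<and>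
                n \<bullet> A 1 = 0 \<and> n \<bullet> A \<i> < 0)))"

text \<open>Unit tangent of the boundary in its anticlockwise orientation.\<close>

definition bdry_tangent :: "'a::t2_space immersed_surface \<Rightarrow> 'a \<Rightarrow> complex" where
  "bdry_tangent M p = \<i> * outer_normal M p"

section \<open>Functions on the boundary curve\<close>

definition smooth_bdry_fun :: "'a::t2_space immersed_surface \<Rightarrow> ('a \<Rightarrow> complex) \<Rightarrow> bool" where
  "smooth_bdry_fun M f \<longleftrightarrow>
     (\<forall>(U, c) \<in> charts M.
        smooth_on {t::real. of_real t \<in> c ` U} (\<lambda>t. f (inv_into U c (of_real t))))"

text \<open>
  The derivative \<open>df/ds\<close> with respect to arc length in the positive direction. The factor \<open>k\<close>
  is \<open>ds/dt\<close> for the local parameter \<open>t\<close> of a boundary chart; it is negative if the chart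
  reverses orientation.
\<close>

definition arc_deriv ::
    "'a::t2_space immersed_surface \<Rightarrow> ('a \<Rightarrow> complex) \<Rightarrow> 'a \<Rightarrow> complex" where
  "arc_deriv M f p =
     (THE v. \<exists>(U, c) \<in> charts M. p \<in> U \<and>
        (\<exists>k::real.
           ((\<lambda>t. imm M (inv_into U c (of_real t))) has_vector_derivative
              k *\<^sub>R bdry_tangent M p) (at (Re (c p))) \<and>
           ((\<lambda>t. f (inv_into U c (of_real t))) has_vector_derivative k *\<^sub>R v) (at (Re (c p)))))"

definition bdry_D ::
    "'a::t2_space immersed_surface \<Rightarrow> ('a \<Rightarrow> complex) \<Rightarrow> 'a \<Rightarrow> complex" where
  "bdry_D M f p = - \<i> * arc_deriv M f p"

definition arclength_param ::
    "'a::t2_space immersed_surface \<Rightarrow> (real \<Rightarrow> 'a) \<Rightarrow> real \<Rightarrow> bool" where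
  "arclength_param M g L \<longleftrightarrow>
     0 < L \<and> smooth_into M UNIV g \<and> range g = bdry M \<and>
     (\<forall>t. g (t + L) = g t) \<and> inj_on g {0..<L} \<and>
     (\<forall>t. (imm M \<circ> g has_vector_derivative bdry_tangent M (g t)) (at t))"

text \<open>The integral with respect to arc length; it does not depend on the parametrization.\<close>

definition bdry_integral ::
    "'a::t2_space immersed_surface \<Rightarrow> ('a \<Rightarrow> complex) \<Rightarrow> complex" where
  "bdry_integral M f =
     (THE I. \<exists>g L. arclength_param M g L \<and> I = integral {0..L} (f \<circ> g))"

definition bdry_length :: "'a::t2_space immersed_surface \<Rightarrow> real" where
  "bdry_length M = Re (bdry_integral M (\<lambda>_. 1))"

definition mean_zero_bdry_fun :: "'a::t2_space immersed_surface \<Rightarrow> ('a \<Rightarrow> complex) \<Rightarrow> bool" where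
  "mean_zero_bdry_fun M f \<longleftrightarrow> smooth_bdry_fun M f \<and> bdry_integral M f = 0"

text \<open>
  Functions on the surface or its boundary are total functions in HOL; \<open>extensional\<close> fixes their
  irrelevant values so that the objects below are unique.
\<close>

definition bdry_D_inv ::
    "'a::t2_space immersed_surface \<Rightarrow> ('a \<Rightarrow> complex) \<Rightarrow> 'a \<Rightarrow> complex" where
  "bdry_D_inv M f =
     (THE g. g \<in> extensional (bdry M) \<and> mean_zero_bdry_fun M g \<and>
             (\<forall>p\<in>bdry M. bdry_D M g p = f p))"

section \<open>The Dirichlet-to-Neumann map and the Hilbert transform\<close>

definition dirichlet_solution ::
    "'a::t2_space immersed_surface \<Rightarrow> ('a \<Rightarrow> complex) \<Rightarrow> 'a \<Rightarrow> complex" where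
  "dirichlet_solution M f =
     (THE u. u \<in> extensional (pts M) \<and> smooth_fun M u \<and>
             (\<forall>p \<in> pts M - bdry M. laplacian M u p = 0) \<and>
             (\<forall>p \<in> bdry M. u p = f p))"

definition DN_map ::
    "'a::t2_space immersed_surface \<Rightarrow> ('a \<Rightarrow> complex) \<Rightarrow> 'a \<Rightarrow> complex" where
  "DN_map M f p = planar_differential M (dirichlet_solution M f) p (outer_normal M p)"

definition hilbert_bdry ::
    "'a::t2_space immersed_surface \<Rightarrow> ('a \<Rightarrow> complex) \<Rightarrow> 'a \<Rightarrow> complex" where
  "hilbert_bdry M f = bdry_D_inv M (DN_map M f)"

text \<open>
  The diffeomorphisms from the unit circle onto the boundary that preserve arc length and orientation:
  the last conjunct says that the unit positive tangent is mapped to the unit positive tangent.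
\<close>

definition arclength_diffeo ::
    "'a::t2_space immersed_surface \<Rightarrow> (complex \<Rightarrow> 'a) \<Rightarrow> bool" where
  "arclength_diffeo M \<gamma> \<longleftrightarrow>
     bij_betw \<gamma> (sphere 0 1) (bdry M) \<and>
     smooth_into M UNIV (\<lambda>t::real. \<gamma> (cis t)) \<and>
     smooth_bdry_fun M (inv_into (sphere 0 1) \<gamma>) \<and>
     (\<forall>t. ((\<lambda>t. imm M (\<gamma> (cis t))) has_vector_derivative bdry_tangent M (\<gamma> (cis t))) (at t))"

definition hilbert_natural ::
    "'a::t2_space immersed_surface \<Rightarrow> (complex \<Rightarrow> 'a) \<Rightarrow> (complex \<Rightarrow> complex) \<Rightarrow> complex \<Rightarrow> complex"
  where
  "hilbert_natural M \<gamma> u = hilbert_bdry M (u \<circ> inv_into (sphere 0 1) \<gamma>) \<circ> \<gamma>"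

section \<open>Biholomorphisms from the disk\<close>

definition disk_biholomorphism ::
    "'a::t2_space immersed_surface \<Rightarrow> (complex \<Rightarrow> 'a) \<Rightarrow> bool" where
  "disk_biholomorphism M \<Phi> \<longleftrightarrow>
     bij_betw \<Phi> (cball 0 1) (pts M) \<and>
     smooth_into M (cball 0 1) \<Phi> \<and>
     smooth_fun M (inv_into (cball 0 1) \<Phi>) \<and>
     (imm M \<circ> \<Phi>) holomorphic_on ball 0 1"

section \<open>Principal values on the circle\<close>

text \<open>
  \<open>h\<close> is a \<open>2\<pi>\<close>-periodic integrand whose only singularity on the circle is \<open>s\<close>. The arc of
  radius \<open>\<epsilon>\<close> around \<open>s\<close> is removed modulo \<open>2\<pi>\<close>, so \<open>s\<close> need not lie inside
  \<open>(0, 2\<pi>)\<close>.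
\<close>

definition has_circle_pv :: "(real \<Rightarrow> complex) \<Rightarrow> real \<Rightarrow> complex \<Rightarrow> bool" where
  "has_circle_pv h s I \<longleftrightarrow>
     (let A = (\<lambda>\<epsilon>. {\<sigma> \<in> {0..2 * pi}. \<forall>k::int. \<epsilon> \<le> \<bar>\<sigma> - s - 2 * pi * of_int k\<bar>})
      in (\<forall>\<epsilon>>0. h integrable_on A \<epsilon>) \<and>
         ((\<lambda>\<epsilon>. integral (A \<epsilon>) h) \<longlongrightarrow> I) (at_right 0))"

end

theory Submission
  imports Defs "HOL-Complex_Analysis.Cauchy_Integral_Formula"
begin

text \<open>
  Write \<open>w t = u (cis (S t))\<close> for the boundary function in the angular parameter of the disk. Both sides of
  the claim are expressed by the Fourier series of \<open>w\<close>.

  The conformal map \<open>\<Phi>\<close> carries the Dirichlet problem to the disk, where the solution is the Poisson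
  extension \<open>\<alpha> + cnj \<beta>\<close> of \<open>w\<close>: \<open>\<alpha>\<close> collects the Fourier modes \<open>n \<ge> 0\<close> and \<open>cnj \<beta>\<close> the modes
  \<open>n < 0\<close>. Since \<open>w\<close> is smooth its coefficients decrease rapidly, so \<open>\<alpha>\<close> and \<open>\<beta>\<close> are smooth on the
  closed disk and the extension is an admissible solution (\<open>smooth_on_pseries\<close>,
  \<open>dirichlet_solution_eq\<close>); it is the only one by the maximum principle (\<open>dirichlet_unique\<close>). On the
  boundary the outer normal is \<open>z \<Phi>' z / \<bar>\<Phi>' z\<bar>\<close> and arc length is \<open>\<bar>\<Phi>'\<bar>\<close> times the angle, so by
  the Cauchy-Riemann equations the normal derivative of \<open>\<alpha> + cnj \<beta>\<close> is \<open>D\<close> of \<open>\<alpha> - cnj \<beta>\<close>. Hence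
  the Hilbert transform is \<open>\<alpha> - cnj \<beta>\<close> up to a constant (\<open>hilbert_bdry_eq\<close>).

  It remains to write \<open>\<alpha> - cnj \<beta>\<close> as a singular integral. With the chord quotient
  \<open>h t = (w t - w \<theta>) / (cis (t - \<theta>) - 1)\<close>, which is continuous, the Fourier series of \<open>w - w \<theta>\<close> at
  \<open>\<theta>\<close> telescopes. This gives at once the pointwise convergence \<open>\<alpha> + cnj \<beta> = w\<close> and
  \<open>\<alpha> - cnj \<beta> = (1 / 2 \<pi>) \<integral> (cis (t - \<theta>) + 1) h t dt + const\<close> (\<open>fourier_halves\<close>). Because
  \<open>\<i> (cis x + 1) / (cis x - 1) = cot (x / 2)\<close>, this integral is the principal value of the cotangent
  kernel, also after the change of variables \<open>t = \<Theta> \<sigma>\<close> (\<open>has_circle_pv_cot\<close>).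

  Finally, \<open>\<gamma> (cis s) = \<Phi> (cis (\<Theta> s))\<close> because a curve that runs along the boundary with unit speed in
  the positive direction is determined by its initial point (\<open>unit_speed_curve_rotation\<close>). The same fact
  shows that integration over the boundary and \<open>D\<^sup>-\<^sup>1\<close> are well defined.
\<close>

section \<open>Calculus of \<open>C\<^sup>k\<close> functions on subsets\<close>

lemma Ck_on_SucE:
  assumes "Ck_on (Suc k) A f"
  obtains f' where "\<And>x. x \<in> A \<Longrightarrow> (f has_derivative f' x) (at x within A)"
    and "\<And>h. Ck_on k A (\<lambda>x. f' x h)"
  using assms by auto

lemma Ck_on_SucI:
  assumes "\<And>x. x \<in> A \<Longrightarrow> (f has_derivative f' x) (at x within A)"
    and "\<And>h. Ck_on k A (\<lambda>x. f' x h)"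
  shows "Ck_on (Suc k) A f"
  using assms by auto

lemma Ck_on_cong:
  assumes "Ck_on k A f" and "\<And>x. x \<in> A \<Longrightarrow> f x = g x"
  shows "Ck_on k A g"
proof (cases k)
  case 0
  then show ?thesis using assms by (metis Ck_on.simps(1) continuous_on_cong)
next
  case (Suc m)
  then obtain f' where f': "\<And>x. x \<in> A \<Longrightarrow> (f has_derivative f' x) (at x within A)"
      "\<And>h. Ck_on m A (\<lambda>x. f' x h)"
    using assms(1) by auto
  have "(g has_derivative f' x) (at x within A)" if "x \<in> A" for x
    by (rule has_derivative_transform[OF that _ f'(1)[OF that]]) (simp add: assms(2))
  then show ?thesis using f'(2) Suc by auto
qed

lemma Ck_on_subset: "Ck_on k A f \<Longrightarrow> B \<subseteq> A \<Longrightarrow> Ck_on k B f"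
proof (induction k arbitrary: f)
  case 0
  then show ?case using continuous_on_subset by auto
next
  case (Suc k)
  obtain f' where f': "\<And>x. x \<in> A \<Longrightarrow> (f has_derivative f' x) (at x within A)"
      "\<And>h. Ck_on k A (\<lambda>x. f' x h)"
    by (rule Ck_on_SucE[OF Suc.prems(1)]) (rule that, blast+)
  show ?case
    using f'(1) Suc.prems(2) Suc.IH[OF f'(2)]
    by (intro Ck_on_SucI[where f' = f']) (auto intro: has_derivative_subset)
qed

lemma Ck_on_Suc_imp_continuous: "Ck_on (Suc k) A f \<Longrightarrow> continuous_on A f"
  by (erule Ck_on_SucE) (rule has_derivative_continuous_on)

lemma Ck_on_Suc_imp: "Ck_on (Suc k) A f \<Longrightarrow> Ck_on k A f"
proof (induction k arbitrary: f)
  case 0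
  then show ?case using Ck_on_Suc_imp_continuous[of 0 A f] by simp
next
  case (Suc k)
  then show ?case by (metis Ck_on.simps(2))
qed

lemma Ck_on_continuous: "Ck_on k A f \<Longrightarrow> continuous_on A f"
  by (cases k) (auto simp del: Ck_on.simps(2) intro: Ck_on_Suc_imp_continuous)

lemma Ck_on_const: "Ck_on k A (\<lambda>x. c)"
proof (induction k arbitrary: c)
  case (Suc k)
  then show ?case by (auto intro!: exI[of _ "\<lambda>x h. 0"])
qed simp

lemma Ck_on_bounded_linear:
  assumes "bounded_linear L"
  shows "Ck_on k A f \<Longrightarrow> Ck_on k A (\<lambda>x. L (f x))"
proof (induction k arbitrary: f)
  case 0
  then show ?case using bounded_linear.continuous_on[OF assms] by simp
next
  case (Suc k)
  obtain f' where f': "\<And>x. x \<in> A \<Longrightarrow> (f has_derivative f' x) (at x within A)"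
      "\<And>h. Ck_on k A (\<lambda>x. f' x h)"
    by (rule Ck_on_SucE[OF Suc.prems(1)]) (rule that, blast+)
  then show ?case using Suc.IH
    by (auto intro!: exI[of _ "\<lambda>x h. L (f' x h)"] bounded_linear.has_derivative[OF assms])
qed

lemma Ck_on_id: "Ck_on k A (\<lambda>x. x)"
proof (cases k)
  case (Suc m)
  then show ?thesis by (auto intro!: exI[of _ "\<lambda>x h. h"] Ck_on_const)
qed simp

lemma Ck_on_linear_map: "bounded_linear L \<Longrightarrow> Ck_on k A L"
  using Ck_on_bounded_linear[OF _ Ck_on_id] by blast

lemma Ck_on_add: "Ck_on k A f \<Longrightarrow> Ck_on k A g \<Longrightarrow> Ck_on k A (\<lambda>x. f x + g x)"
proof (induction k arbitrary: f g)
  case 0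
  then show ?case by (simp add: continuous_on_add)
next
  case (Suc k)
  obtain f' where f': "\<And>x. x \<in> A \<Longrightarrow> (f has_derivative f' x) (at x within A)"
      "\<And>h. Ck_on k A (\<lambda>x. f' x h)"
    by (rule Ck_on_SucE[OF Suc.prems(1)]) (rule that, blast+)
  obtain g' where g': "\<And>x. x \<in> A \<Longrightarrow> (g has_derivative g' x) (at x within A)"
      "\<And>h. Ck_on k A (\<lambda>x. g' x h)"
    by (rule Ck_on_SucE[OF Suc.prems(2)]) (rule that, blast+)
  show ?case using f' g' Suc.IH
    by (auto intro!: exI[of _ "\<lambda>x h. f' x h + g' x h"] has_derivative_add)
qed

lemma Ck_on_bounded_bilinear:
  assumes "bounded_bilinear B"
  shows "Ck_on k A f \<Longrightarrow> Ck_on k A g \<Longrightarrow> Ck_on k A (\<lambda>x. B (f x) (g x))"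
proof (induction k arbitrary: f g)
  case 0
  then show ?case using bounded_bilinear.continuous_on[OF assms] by simp
next
  case (Suc k)
  obtain f' where f': "\<And>x. x \<in> A \<Longrightarrow> (f has_derivative f' x) (at x within A)"
      "\<And>h. Ck_on k A (\<lambda>x. f' x h)"
    by (rule Ck_on_SucE[OF Suc.prems(1)]) (rule that, blast+)
  obtain g' where g': "\<And>x. x \<in> A \<Longrightarrow> (g has_derivative g' x) (at x within A)"
      "\<And>h. Ck_on k A (\<lambda>x. g' x h)"
    by (rule Ck_on_SucE[OF Suc.prems(2)]) (rule that, blast+)
  have "Ck_on k A f" "Ck_on k A g" using Suc.prems Ck_on_Suc_imp by blast+
  then have "Ck_on k A (\<lambda>x. B (f x) (g' x h) + B (f' x h) (g x))" for h
    using f'(2) g'(2) by (intro Ck_on_add Suc.IH)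
  moreover have "((\<lambda>x. B (f x) (g x)) has_derivative (\<lambda>h. B (f x) (g' x h) + B (f' x h) (g x)))
      (at x within A)" if "x \<in> A" for x
    using bounded_bilinear.FDERIV[OF assms f'(1) g'(1)] that by blast
  ultimately show ?case
    unfolding Ck_on.simps by (intro exI[of _ "\<lambda>x h. B (f x) (g' x h) + B (f' x h) (g x)"]) auto
qed

lemmas Ck_on_mult = Ck_on_bounded_bilinear[OF bounded_bilinear_mult]
lemmas Ck_on_scaleR = Ck_on_bounded_bilinear[OF bounded_bilinear_scaleR]

lemma Ck_on_sum:
  "finite I \<Longrightarrow> (\<And>i. i \<in> I \<Longrightarrow> Ck_on k A (f i)) \<Longrightarrow> Ck_on k A (\<lambda>x. \<Sum>i\<in>I. f i x)"
  by (induction I rule: finite_induct) (auto intro: Ck_on_const Ck_on_add)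

text \<open>
  The chain rule gives the derivative \<open>f' (g x) (g' x h)\<close>. Since \<open>g' x h\<close> varies with \<open>x\<close>, it has to be
  expanded in a basis before the induction hypothesis applies to the partial derivatives of \<open>f\<close>.
\<close>

lemma Ck_on_compose:
  fixes f :: "'b::euclidean_space \<Rightarrow> 'c::real_normed_vector" and g :: "'a::euclidean_space \<Rightarrow> 'b"
  shows "Ck_on k B f \<Longrightarrow> Ck_on k A g \<Longrightarrow> g ` A \<subseteq> B \<Longrightarrow> Ck_on k A (\<lambda>x. f (g x))"
proof (induction k arbitrary: f)
  case 0
  then show ?case by (auto intro: continuous_on_compose2)
next
  case (Suc k)
  obtain f' where f': "\<And>x. x \<in> B \<Longrightarrow> (f has_derivative f' x) (at x within B)"
      "\<And>h. Ck_on k B (\<lambda>x. f' x h)"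
    by (rule Ck_on_SucE[OF Suc.prems(1)]) (rule that, blast+)
  obtain g' where g': "\<And>x. x \<in> A \<Longrightarrow> (g has_derivative g' x) (at x within A)"
      "\<And>h. Ck_on k A (\<lambda>x. g' x h)"
    by (rule Ck_on_SucE[OF Suc.prems(2)]) (rule that, blast+)
  have der: "((\<lambda>x. f (g x)) has_derivative (\<lambda>h. f' (g x) (g' x h))) (at x within A)" if "x \<in> A" for x
  proof -
    have "(f has_derivative f' (g x)) (at (g x) within g ` A)"
      using f'(1) that Suc.prems(3) has_derivative_subset by blast
    then show ?thesis using has_derivative_in_compose[OF g'(1)[OF that]] by blast
  qed
  have eq: "f' (g x) (g' x h) = (\<Sum>b\<in>Basis. (g' x h \<bullet> b) *\<^sub>R f' (g x) b)" if "x \<in> A" for x h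
  proof -
    have lin: "linear (f' (g x))"
      using f'(1)[of "g x"] that Suc.prems(3) has_derivative_linear by blast
    have "f' (g x) (g' x h) = f' (g x) (\<Sum>b\<in>Basis. (g' x h \<bullet> b) *\<^sub>R b)"
      by (simp add: euclidean_representation)
    also have "\<dots> = (\<Sum>b\<in>Basis. (g' x h \<bullet> b) *\<^sub>R f' (g x) b)"
      using lin by (simp add: linear_sum linear_scale)
    finally show ?thesis .
  qed
  have "Ck_on k A (\<lambda>x. f' (g x) (g' x h))" for h
  proof (rule Ck_on_cong)
    show "Ck_on k A (\<lambda>x. \<Sum>b\<in>Basis. (g' x h \<bullet> b) *\<^sub>R f' (g x) b)"
    proof (intro Ck_on_sum Ck_on_scaleR)
      fix b :: 'b
      show "Ck_on k A (\<lambda>x. g' x h \<bullet> b)"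
        by (intro Ck_on_bounded_linear[OF bounded_linear_inner_left] g')
      show "Ck_on k A (\<lambda>x. f' (g x) b)"
        using Suc.IH[OF f'(2)] Ck_on_Suc_imp[OF Suc.prems(2)] Suc.prems(3) by blast
    qed simp
  qed (simp add: eq)
  then show ?case using der by (auto intro!: exI[of _ "\<lambda>x h. f' (g x) (g' x h)"])
qed

text \<open>
  On an open set the derivative is unique, so that the derivatives chosen on different neighbourhoods agree
  and can be glued.
\<close>

lemma Ck_on_open_local:
  fixes f :: "'a::euclidean_space \<Rightarrow> 'b::real_normed_vector"
  shows "(\<And>x. x \<in> A \<Longrightarrow> \<exists>N. open N \<and> x \<in> N \<and> Ck_on k N f) \<Longrightarrow> Ck_on k A f"
proof (induction k arbitrary: f)
  case 0
  have "continuous (at x within A) f" if "x \<in> A" for x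
    using 0[OF that] continuous_on_eq_continuous_at continuous_at_imp_continuous_at_within
    by (metis Ck_on.simps(1))
  then show ?case by (simp add: continuous_on_eq_continuous_within)
next
  case (Suc k)
  have loc: "\<exists>N f'. open N \<and> x \<in> N \<and> (\<forall>y\<in>N. (f has_derivative f' y) (at y)) \<and>
      (\<forall>h. Ck_on k N (\<lambda>y. f' y h))" if "x \<in> A" for x
  proof -
    obtain N where N: "open N" "x \<in> N" "Ck_on (Suc k) N f" using Suc.prems[OF \<open>x \<in> A\<close>] by blast
    then obtain f' where "\<forall>y\<in>N. (f has_derivative f' y) (at y within N)" "\<forall>h. Ck_on k N (\<lambda>y. f' y h)"
      by auto
    then show ?thesis using N at_within_open[of _ N] by metis
  qed
  define D where "D = (\<lambda>x. frechet_derivative f (at x))"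
  have loc': "\<exists>N. open N \<and> x \<in> N \<and> (\<forall>y\<in>N. (f has_derivative D y) (at y)) \<and>
      (\<forall>h. Ck_on k N (\<lambda>y. D y h))" if "x \<in> A" for x
  proof -
    obtain N f' where N: "open N" "x \<in> N" "\<And>y. y \<in> N \<Longrightarrow> (f has_derivative f' y) (at y)"
        "\<And>h. Ck_on k N (\<lambda>y. f' y h)"
      using loc[OF \<open>x \<in> A\<close>] by blast
    have "D y = f' y" if "y \<in> N" for y
      using N(3)[OF that] frechet_derivative_at unfolding D_def by metis
    then show ?thesis
      using N Ck_on_cong[OF N(4)] by (intro exI[of _ N]) auto
  qed
  have "(f has_derivative D x) (at x within A)" if "x \<in> A" for x
    using loc'[OF that] has_derivative_at_withinI by blast
  moreover have "Ck_on k A (\<lambda>x. D x h)" for h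
    using loc' by (intro Suc.IH) blast
  ultimately show ?case by auto
qed

text \<open>
  All exponents have to be treated together, because differentiation lowers the exponent. The exponent
  \<open>1/2\<close> makes the norm smooth away from zero.
\<close>

lemma Ck_on_powr: "Ck_on k {0<..} (\<lambda>x::real. x powr a)"
proof (induction k arbitrary: a)
  case 0
  then show ?case by (auto intro!: continuous_intros)
next
  case (Suc k)
  have "((\<lambda>x::real. x powr a) has_derivative (\<lambda>h. h * (a * x powr (a - 1)))) (at x within {0<..})"
    if "x > 0" for x
    using that by (auto intro!: derivative_eq_intros simp: field_simps powr_diff)
  moreover have "Ck_on k {0<..} (\<lambda>x::real. h * (a * x powr (a - 1)))" for h
    by (intro Ck_on_mult Ck_on_const Suc)
  ultimately show ?case by (auto intro!: exI[of _ "\<lambda>x h. h * (a * x powr (a - 1))"])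
qed

lemma Ck_on_norm_nonzero:
  fixes f :: "'a::euclidean_space \<Rightarrow> 'b::real_inner"
  assumes "Ck_on k A f" and "\<And>x. x \<in> A \<Longrightarrow> f x \<noteq> 0"
  shows "Ck_on k A (\<lambda>x. norm (f x))"
proof (rule Ck_on_cong)
  show "Ck_on k A (\<lambda>x. (f x \<bullet> f x) powr (1/2))"
    using assms
    by (intro Ck_on_compose[OF Ck_on_powr] Ck_on_bounded_bilinear[OF bounded_bilinear_inner]) auto
qed (simp add: powr_half_sqrt norm_eq_sqrt_inner)

lemma smooth_on_compose:
  fixes f :: "'b::euclidean_space \<Rightarrow> 'c::real_normed_vector" and g :: "'a::euclidean_space \<Rightarrow> 'b"
  shows "smooth_on B f \<Longrightarrow> smooth_on A g \<Longrightarrow> g ` A \<subseteq> B \<Longrightarrow> smooth_on A (\<lambda>x. f (g x))"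
  unfolding smooth_on_def using Ck_on_compose by blast

lemma smooth_on_cong: "smooth_on A f \<Longrightarrow> (\<And>x. x \<in> A \<Longrightarrow> f x = g x) \<Longrightarrow> smooth_on A g"
  unfolding smooth_on_def using Ck_on_cong by blast

lemma smooth_on_subset: "smooth_on A f \<Longrightarrow> B \<subseteq> A \<Longrightarrow> smooth_on B f"
  unfolding smooth_on_def using Ck_on_subset by blast

lemma smooth_on_bounded_linear: "bounded_linear L \<Longrightarrow> smooth_on A L"
  unfolding smooth_on_def using Ck_on_linear_map by blast

lemma smooth_on_add: "smooth_on A f \<Longrightarrow> smooth_on A g \<Longrightarrow> smooth_on A (\<lambda>x. f x + g x)"
  unfolding smooth_on_def using Ck_on_add by blast

lemma smooth_on_const: "smooth_on A (\<lambda>x. c)"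
  unfolding smooth_on_def using Ck_on_const by blast

lemma smooth_on_open_local:
  fixes f :: "'a::euclidean_space \<Rightarrow> 'b::real_normed_vector"
  assumes "\<And>x. x \<in> A \<Longrightarrow> \<exists>N. open N \<and> x \<in> N \<and> smooth_on N f"
  shows "smooth_on A f"
  using assms Ck_on_open_local[of A _ f] unfolding smooth_on_def by meson

lemma smooth_on_has_derivative:
  assumes "smooth_on A f" and "x \<in> A"
  obtains D where "(f has_derivative D) (at x within A)"
proof -
  have "Ck_on (Suc 0) A f" using assms(1) by (simp only: smooth_on_def)
  then show ?thesis using assms(2) that by (auto simp only: Ck_on.simps(2))
qed

lemma smooth_on_continuous: "smooth_on A f \<Longrightarrow> continuous_on A f"
  unfolding smooth_on_def using Ck_on_continuous by blast

text \<open>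
  Each order \<open>k\<close> comes with its own derivative. In one real variable all of these are the vector
  derivative, which is therefore \<open>C\<^sup>k\<close> for every \<open>k\<close>.
\<close>

lemma smooth_on_real_deriv:
  fixes f :: "real \<Rightarrow> 'b::real_normed_vector"
  assumes "smooth_on UNIV f"
  obtains f' where "\<And>t. (f has_vector_derivative f' t) (at t)" and "smooth_on UNIV f'"
proof
  let ?f' = "\<lambda>t. vector_derivative f (at t)"
  have ex: "\<exists>D. (\<forall>t. (f has_derivative D t) (at t)) \<and> (\<forall>h. Ck_on k UNIV (\<lambda>x. D x h))" for k
  proof -
    have "Ck_on (Suc k) UNIV f" using assms by (simp only: smooth_on_def)
    then show ?thesis by (simp only: Ck_on.simps(2)) blast
  qed
  have eq: "D h = h *\<^sub>R ?f' t" if "(f has_derivative D) (at t)" for D t h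
  proof -
    have lin: "linear D" using that has_derivative_linear by blast
    have D1: "D = (\<lambda>h. h *\<^sub>R D 1)"
    proof
      fix h show "D h = h *\<^sub>R D 1" using linear_scale[OF lin, of h 1] by simp
    qed
    then have "(f has_vector_derivative D 1) (at t)" using that unfolding has_vector_derivative_def by metis
    then have "?f' t = D 1" by (rule vector_derivative_at)
    then show ?thesis using D1 by metis
  qed
  show "(f has_vector_derivative ?f' t) (at t)" for t
  proof -
    obtain D where D: "(f has_derivative D) (at t)" using ex by blast
    then have "D = (\<lambda>h. h *\<^sub>R ?f' t)" using eq[OF D] by blast
    then show ?thesis using D by (simp add: has_vector_derivative_def)
  qed
  have "Ck_on k UNIV ?f'" for k
  proof -
    obtain D where D: "\<And>t. (f has_derivative D t) (at t)" "\<And>h. Ck_on k UNIV (\<lambda>x. D x h)"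
      using ex by blast
    show ?thesis using Ck_on_cong[OF D(2)[of 1]] eq[OF D(1), of _ 1] by simp
  qed
  then show "smooth_on UNIV ?f'" by (simp add: smooth_on_def)
qed

lemma smooth_on_real_antideriv:
  fixes f :: "real \<Rightarrow> 'b::real_normed_vector"
  assumes "\<And>t. (f has_vector_derivative f' t) (at t)" and "smooth_on UNIV f'"
  shows "smooth_on UNIV f"
proof -
  have d: "(f has_derivative (\<lambda>h. h *\<^sub>R f' t)) (at t)" for t
    using assms(1) unfolding has_vector_derivative_def by blast
  have "Ck_on (Suc k) UNIV f" for k
    using d assms(2) unfolding smooth_on_def
    by (auto intro!: exI[of _ "\<lambda>x h. h *\<^sub>R f' x"] Ck_on_scaleR Ck_on_const)
  then show ?thesis unfolding smooth_on_def using Ck_on_Suc_imp by blast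
qed

lemma at_within_openin:
  assumes "openin (top_of_set S) N" and "x \<in> N"
  shows "at x within N = at x within S"
proof -
  obtain T where T: "open T" "N = S \<inter> T" using assms(1) by (auto simp: openin_open)
  show ?thesis
    using assms(2) T by (metis IntD2 at_within_nhd inf.right_idem inf_commute)
qed

text \<open>
  Two derivatives agree in the directions \<open>y - x\<close> with \<open>y \<in> S\<close>, because the segment from \<open>x\<close> to \<open>y\<close>
  lies in \<open>S\<close>; these directions contain a nonempty open set. The cases needed are the closed half-plane
  and the closed disk at their boundary points.
\<close>

lemma has_derivative_unique_convex:
  fixes f :: "'a::euclidean_space \<Rightarrow> 'b::real_normed_vector"
  assumes "convex S" and "interior S \<noteq> {}" and "x \<in> S"
    and "(f has_derivative D1) (at x within S)" and "(f has_derivative D2) (at x within S)"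
  shows "D1 = D2"
proof -
  have lin1: "linear D1" and lin2: "linear D2" using assms has_derivative_linear by blast+
  have eq: "D1 (y - x) = D2 (y - x)" if y: "y \<in> S" for y
  proof -
    let ?p = "\<lambda>t::real. x + t *\<^sub>R (y - x)"
    have sub: "?p ` {0..1} \<subseteq> S"
    proof clarify
      fix t :: real assume "t \<in> {0..1}"
      then have "(1 - t) *\<^sub>R x + t *\<^sub>R y \<in> S"
        using convexD_alt[OF assms(1,3) y] by auto
      then show "?p t \<in> S" by (simp add: algebra_simps)
    qed
    have p: "(?p has_derivative (\<lambda>h. h *\<^sub>R (y - x))) (at 0 within {0..1})"
      by (auto intro!: derivative_eq_intros)
    have *: "((\<lambda>t. f (?p t)) has_vector_derivative D (y - x)) (at 0 within {0..1})"
      if D: "(f has_derivative D) (at x within S)" for D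
    proof -
      have "(f has_derivative D) (at (?p 0) within ?p ` {0..1})"
        using D sub has_derivative_subset by auto
      then have "((\<lambda>t. f (?p t)) has_derivative (\<lambda>h. D (h *\<^sub>R (y - x)))) (at 0 within {0..1})"
        using has_derivative_in_compose[OF p, of f D] by simp
      moreover have "linear D" using D has_derivative_linear by blast
      ultimately show ?thesis by (simp add: has_vector_derivative_def linear_scale)
    qed
    have "at (0::real) within {0..1} \<noteq> bot" by (simp add: at_within_Icc_at_right)
    then show ?thesis
      using *[OF assms(4)] *[OF assms(5)] vector_derivative_unique_within by blast
  qed
  obtain y0 e where e: "e > 0" "ball y0 e \<subseteq> S"
    using assms(2) by (meson all_not_in_conv mem_interior)
  show ?thesis
  proof
    fix h
    show "D1 h = D2 h"
    proof (cases "h = 0")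
      case True
      then show ?thesis using lin1 lin2 by (simp add: linear_0)
    next
      case False
      define r where "r = e / (2 * norm h)"
      have r: "r > 0" using False e by (simp add: r_def)
      have "y0 \<in> S" "y0 + r *\<^sub>R h \<in> S"
        using e False by (auto intro!: subsetD[OF e(2)] simp: dist_norm r_def)
      then have "D1 (y0 + r *\<^sub>R h - x) - D1 (y0 - x) = D2 (y0 + r *\<^sub>R h - x) - D2 (y0 - x)"
        using eq by simp
      then have "D1 (r *\<^sub>R h) = D2 (r *\<^sub>R h)"
        using lin1 lin2 by (simp flip: linear_diff)
      then show ?thesis using lin1 lin2 r by (simp add: linear_scale)
    qed
  qed
qed

section \<open>Power series smooth up to the boundary of the disk\<close>

text \<open>
  Equivalently, all termwise derivatives of the power series converge absolutely on the closed disk.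
\<close>

definition rapidly_decreasing :: "(nat \<Rightarrow> complex) \<Rightarrow> bool" where
  "rapidly_decreasing a \<longleftrightarrow> (\<forall>k. \<exists>B. \<forall>n. real n ^ k * cmod (a n) \<le> B)"

definition pseries :: "(nat \<Rightarrow> complex) \<Rightarrow> complex \<Rightarrow> complex" where
  "pseries a z = (\<Sum>n. a n * z ^ n)"

definition derived_coeffs :: "(nat \<Rightarrow> complex) \<Rightarrow> nat \<Rightarrow> complex" where
  "derived_coeffs a n = of_nat (Suc n) * a (Suc n)"

lemma rapidly_decreasing_summable:
  assumes "rapidly_decreasing a"
  shows "summable (\<lambda>n. real n ^ k * cmod (a n))"
proof -
  obtain B where B: "\<And>n. real n ^ (k + 2) * cmod (a n) \<le> B"
    using assms unfolding rapidly_decreasing_def by blast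
  have "summable (\<lambda>n. B * inverse (real n ^ 2))"
    by (intro summable_mult inverse_power_summable) simp
  then show ?thesis
  proof (rule summable_comparison_test'[where N = 1])
    fix n :: nat assume n: "n \<ge> 1"
    have "real n ^ k * cmod (a n) = real n ^ (k + 2) * cmod (a n) * inverse (real n ^ 2)"
      using n by (simp add: power_add field_simps power2_eq_square)
    also have "\<dots> \<le> B * inverse (real n ^ 2)"
      by (intro mult_right_mono B) simp
    finally show "norm (real n ^ k * cmod (a n)) \<le> B * inverse (real n ^ 2)" by simp
  qed
qed

lemma rapidly_decreasing_derived_coeffs:
  assumes "rapidly_decreasing a"
  shows "rapidly_decreasing (derived_coeffs a)"
  unfolding rapidly_decreasing_def
proof
  fix k
  obtain B where B: "\<And>n. real n ^ (k + 1) * cmod (a n) \<le> B"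
    using assms unfolding rapidly_decreasing_def by blast
  have "real n ^ k * cmod (derived_coeffs a n) \<le> B" for n
  proof -
    have "real n ^ k * cmod (derived_coeffs a n) = real n ^ k * (real (Suc n) * cmod (a (Suc n)))"
      by (simp add: derived_coeffs_def norm_mult del: of_nat_Suc)
    also have "\<dots> \<le> real (Suc n) ^ k * (real (Suc n) * cmod (a (Suc n)))"
      by (intro mult_right_mono power_mono) auto
    also have "\<dots> \<le> B" using B[of "Suc n"] by (simp add: mult_ac)
    finally show ?thesis .
  qed
  then show "\<exists>B. \<forall>n. real n ^ k * cmod (derived_coeffs a n) \<le> B" by blast
qed

lemma pseries_sums:
  assumes "rapidly_decreasing a" and "z \<in> cball 0 1"
  shows "(\<lambda>n. a n * z ^ n) sums pseries a z"
proof -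
  have "summable (\<lambda>n. a n * z ^ n)"
  proof (rule summable_comparison_test'[where N = 0])
    show "summable (\<lambda>n. cmod (a n))" using rapidly_decreasing_summable[OF assms(1), of 0] by simp
    fix n show "norm (a n * z ^ n) \<le> cmod (a n)"
      using assms(2) by (simp add: norm_mult norm_power mult_left_le power_le_one)
  qed
  then show ?thesis by (simp add: pseries_def summable_sums)
qed

lemma pseries_has_field_derivative:
  assumes a: "rapidly_decreasing a" and z: "z \<in> cball 0 1"
  shows "(pseries a has_field_derivative pseries (derived_coeffs a) z) (at z within cball 0 1)"
proof -
  let ?f' = "\<lambda>n z. a n * (of_nat n * z ^ (n - 1))"
  have "uniform_limit (cball 0 1) (\<lambda>n z. \<Sum>i<n. ?f' i z) (\<lambda>z. \<Sum>i. ?f' i z) sequentially"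
  proof (rule Weierstrass_m_test)
    show "summable (\<lambda>n. real n ^ 1 * cmod (a n))" by (rule rapidly_decreasing_summable[OF a])
    fix n and z :: complex assume "z \<in> cball 0 1"
    then have "cmod z ^ (n - 1) \<le> 1" by (simp add: power_le_one)
    then have "cmod (a n) * real n * cmod z ^ (n - 1) \<le> cmod (a n) * real n * 1"
      by (intro mult_left_mono) auto
    then show "norm (?f' n z) \<le> real n ^ 1 * cmod (a n)"
      by (simp add: norm_mult norm_power mult_ac)
  qed
  then obtain g where g: "\<And>x. x \<in> cball 0 1 \<Longrightarrow> (\<lambda>n. a n * x ^ n) sums g x"
      "\<And>x. x \<in> cball 0 1 \<Longrightarrow> (g has_field_derivative (\<Sum>i. ?f' i x)) (at x within cball 0 1)"
    using has_field_derivative_series[of "cball 0 1" "\<lambda>n z. a n * z ^ n" ?f' "\<lambda>z. \<Sum>i. ?f' i z" 0]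
      sums_summable[OF pseries_sums[OF a, of 0]]
    by (force intro!: derivative_eq_intros)
  have "g x = pseries a x" if "x \<in> cball 0 1" for x
    using sums_unique2[OF g(1)[OF that] pseries_sums[OF a that]] .
  then have "(pseries a has_field_derivative (\<Sum>i. ?f' i z)) (at z within cball 0 1)"
    using has_field_derivative_transform_within[OF g(2)[OF z], of 1 "pseries a"] z by auto
  moreover have "(\<Sum>i. ?f' i z) = pseries (derived_coeffs a) z"
  proof -
    have "(\<lambda>n. ?f' (Suc n) z) sums pseries (derived_coeffs a) z"
      using pseries_sums[OF rapidly_decreasing_derived_coeffs[OF a] z]
      by (simp add: derived_coeffs_def mult_ac)
    then have "(\<lambda>n. ?f' n z) sums pseries (derived_coeffs a) z"
      by (subst (asm) sums_Suc_iff) simp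
    then show ?thesis by (rule sums_unique[symmetric])
  qed
  ultimately show ?thesis by simp
qed

lemma smooth_on_pseries:
  assumes "rapidly_decreasing a"
  shows "smooth_on (cball 0 1) (pseries a)"
proof -
  have "Ck_on k (cball 0 1) (pseries a)" for k
    using assms
  proof (induction k arbitrary: a)
    case 0
    then show ?case
      using DERIV_continuous_on[OF pseries_has_field_derivative] by simp
  next
    case (Suc k)
    show ?case
    proof (rule Ck_on_SucI)
      show "(pseries a has_derivative (\<lambda>h. pseries (derived_coeffs a) z * h)) (at z within cball 0 1)"
        if "z \<in> cball 0 1" for z
        using pseries_has_field_derivative[OF Suc.prems that] by (simp add: has_field_derivative_def)
      show "Ck_on k (cball 0 1) (\<lambda>z. pseries (derived_coeffs a) z * h)" for h
        by (intro Ck_on_mult Ck_on_const Suc.IH rapidly_decreasing_derived_coeffs Suc.prems)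
    qed
  qed
  then show ?thesis by (simp add: smooth_on_def)
qed

section \<open>Fourier series of smooth periodic functions\<close>

lemma cis_has_vector_derivative:
  "((\<lambda>t. cis (a * t + b)) has_vector_derivative of_real a * \<i> * cis (a * t + b)) (at t within A)"
  unfolding has_vector_derivative_def
  by (auto intro!: derivative_eq_intros simp: scaleR_conv_of_real)

lemma cis_vector_derivative: "(cis has_vector_derivative \<i> * cis t) (at t)"
  using cis_has_vector_derivative[of 1 0 t UNIV] by simp

lemma cis_compose_vector_derivative:
  assumes "(\<Theta> has_real_derivative d) (at s)"
  shows "((\<lambda>s. cis (\<Theta> s)) has_vector_derivative d *\<^sub>R (\<i> * cis (\<Theta> s))) (at s)"
  using vector_diff_chain_at[OF assms[unfolded has_real_derivative_iff_has_vector_derivative]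
      cis_vector_derivative[of "\<Theta> s"]] by (simp add: comp_def)

definition fourier_coeff :: "(real \<Rightarrow> complex) \<Rightarrow> int \<Rightarrow> complex" where
  "fourier_coeff w n = integral {0..2 * pi} (\<lambda>t. w t * cis (- (of_int n * t))) / (2 * of_real pi)"

lemma fourier_coeff_deriv:
  assumes w: "\<And>t. (w has_vector_derivative w' t) (at t)"
    and w': "continuous_on UNIV w'" and per: "w (2 * pi) = w 0"
  shows "fourier_coeff w' n = \<i> * of_int n * fourier_coeff w n"
proof -
  let ?e = "\<lambda>t. cis (- (of_int n * t))"
  have e: "(?e has_vector_derivative (- of_int n * \<i> * ?e t)) (at t within A)" for t A
    using cis_has_vector_derivative[of "- of_int n" 0 t A] by simp
  have cw: "continuous_on A w" for A
    using w by (meson continuous_at_imp_continuous_on has_vector_derivative_continuous)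
  have I: "((\<lambda>t. w t * (- of_int n * \<i> * ?e t) + w' t * ?e t) has_integral
      (w (2 * pi) * ?e (2 * pi) - w 0 * ?e 0)) {0..2 * pi}"
  proof (rule fundamental_theorem_of_calculus)
    show "((\<lambda>t. w t * ?e t) has_vector_derivative (w t * (- of_int n * \<i> * ?e t) + w' t * ?e t))
        (at t within {0..2 * pi})" for t
      by (rule has_vector_derivative_mult[OF has_vector_derivative_at_within[OF w] e])
  qed simp
  have "?e (2 * pi) = 1"
    using cis_multiple_2pi[of "- of_int n"] by (simp add: mult_ac)
  then have "integral {0..2 * pi} (\<lambda>t. w t * (- of_int n * \<i> * ?e t) + w' t * ?e t) = 0"
    using per integral_unique[OF I] by simp
  moreover have "integral {0..2 * pi} (\<lambda>t. w t * (- of_int n * \<i> * ?e t) + w' t * ?e t)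
    = integral {0..2 * pi} (\<lambda>t. (- of_int n * \<i>) * (w t * ?e t)) + integral {0..2 * pi} (\<lambda>t. w' t * ?e t)"
  proof -
    have "integral {0..2 * pi} (\<lambda>t. w t * (- of_int n * \<i> * ?e t) + w' t * ?e t)
      = integral {0..2 * pi} (\<lambda>t. (- of_int n * \<i>) * (w t * ?e t) + w' t * ?e t)"
      by (intro integral_cong) (simp add: algebra_simps)
    also have "\<dots> = integral {0..2 * pi} (\<lambda>t. (- of_int n * \<i>) * (w t * ?e t)) +
        integral {0..2 * pi} (\<lambda>t. w' t * ?e t)"
      by (intro integral_add integrable_continuous_interval continuous_intros cw
          continuous_on_subset[OF w']) auto
    finally show ?thesis .
  qed
  ultimately have "integral {0..2 * pi} (\<lambda>t. w' t * ?e t) = \<i> * of_int n * integral {0..2 * pi} (\<lambda>t. w t * ?e t)"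
    by (simp add: algebra_simps add_eq_0_iff)
  then show ?thesis unfolding fourier_coeff_def by simp
qed

lemma fourier_coeff_const:
  assumes "n \<noteq> 0"
  shows "fourier_coeff (\<lambda>t. c) n = 0"
proof -
  have "fourier_coeff (\<lambda>t. 0) n = \<i> * of_int n * fourier_coeff (\<lambda>t. c) n"
    by (rule fourier_coeff_deriv) auto
  then show ?thesis using assms by (simp add: fourier_coeff_def)
qed

lemma cmod_fourier_coeff_le:
  assumes "continuous_on {0..2 * pi} w" and "\<And>t. t \<in> {0..2 * pi} \<Longrightarrow> cmod (w t) \<le> B"
  shows "cmod (fourier_coeff w n) \<le> B"
proof -
  have "norm (integral {0..2 * pi} (\<lambda>t. w t * cis (- (of_int n * t)))) \<le> B * (2 * pi - 0)"
    by (rule integral_bound) (auto intro!: continuous_intros assms simp: norm_mult)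
  then show ?thesis by (simp add: fourier_coeff_def norm_divide norm_mult field_simps)
qed

lemma has_vector_derivative_periodic:
  fixes w :: "real \<Rightarrow> 'b::real_normed_vector"
  assumes w: "\<And>t. (w has_vector_derivative w' t) (at t)" and per: "\<And>t. w (t + p) = w t"
  shows "w' (t + p) = w' t"
proof -
  have "((\<lambda>t. t + p) has_vector_derivative 1) (at t)"
    by (auto intro!: derivative_eq_intros)
  from vector_diff_chain_at[OF this w[of "t + p"]]
  have "(w has_vector_derivative w' (t + p)) (at t)" by (simp add: comp_def per)
  then show ?thesis using w vector_derivative_unique_at by blast
qed

text \<open>
  Each derivative of \<open>w\<close> multiplies the \<open>n\<close>-th coefficient by \<open>\<i> n\<close>, and the coefficients of every
  derivative are bounded.
\<close>

lemma fourier_coeff_rapidly_decreasing: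
  assumes "smooth_on UNIV w" and "\<And>t. w (t + 2 * pi) = w t"
  shows "\<exists>B. \<forall>n. \<bar>of_int n\<bar> ^ k * cmod (fourier_coeff w n) \<le> B"
  using assms
proof (induction k arbitrary: w)
  case 0
  have c: "continuous_on {0..2 * pi} w"
    using smooth_on_continuous[OF 0(1)] continuous_on_subset by blast
  then have "bounded (w ` {0..2 * pi})"
    by (intro compact_imp_bounded compact_continuous_image) auto
  then obtain B where "\<And>t. t \<in> {0..2 * pi} \<Longrightarrow> cmod (w t) \<le> B"
    unfolding bounded_iff by blast
  then show ?case using cmod_fourier_coeff_le[OF c] by auto
next
  case (Suc k)
  obtain w' where w': "\<And>t. (w has_vector_derivative w' t) (at t)" "smooth_on UNIV w'"
    using smooth_on_real_deriv[OF Suc.prems(1)] by blast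
  note per = has_vector_derivative_periodic[OF w'(1) Suc.prems(2)]
  obtain B where B: "\<And>n. \<bar>of_int n\<bar> ^ k * cmod (fourier_coeff w' n) \<le> B"
    using Suc.IH[OF w'(2) per] by blast
  have "fourier_coeff w' n = \<i> * of_int n * fourier_coeff w n" for n
    using Suc.prems(2)[of 0] by (intro fourier_coeff_deriv w' smooth_on_continuous) auto
  then have "\<bar>of_int n\<bar> ^ Suc k * cmod (fourier_coeff w n) \<le> B" for n
    using B[of n] by (simp add: norm_mult mult_ac)
  then show ?case by blast
qed

lemma Cesaro_mean_tendsto:
  fixes x :: "nat \<Rightarrow> complex"
  assumes "x \<longlonglongrightarrow> L"
  shows "(\<lambda>N. (\<Sum>n<N. x n) / of_nat N) \<longlonglongrightarrow> L"
proof (rule LIMSEQ_I)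
  fix e :: real assume e: "e > 0"
  obtain N0 where N0: "\<And>n. n \<ge> N0 \<Longrightarrow> norm (x n - L) < e / 2"
    using LIMSEQ_D[OF assms, of "e / 2"] e by auto
  define C where "C = (\<Sum>n<N0. norm (x n - L))"
  obtain N1 :: nat where N1: "real N1 > 2 * C / e" using reals_Archimedean2 by blast
  have "norm ((\<Sum>n<N. x n) / of_nat N - L) < e" if N: "N \<ge> max (Suc N0) (Suc N1)" for N
  proof -
    have "(\<Sum>n<N. x n) / of_nat N - L = (\<Sum>n<N. x n - L) / of_nat N"
      using N by (simp add: sum_subtractf field_simps)
    also have "norm \<dots> \<le> (\<Sum>n<N. norm (x n - L)) / N"
      by (simp add: norm_divide divide_right_mono norm_sum)
    also have "(\<Sum>n<N. norm (x n - L)) = C + (\<Sum>n\<in>{N0..<N}. norm (x n - L))"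
      using N unfolding C_def by (subst sum.union_disjoint[symmetric]) (auto intro!: sum.cong)
    also have "(\<Sum>n\<in>{N0..<N}. norm (x n - L)) \<le> (\<Sum>n\<in>{N0..<N}. e / 2)"
      using N0 by (intro sum_mono less_imp_le) auto
    also have "\<dots> \<le> N * (e / 2)" using e by simp
    finally have "norm ((\<Sum>n<N. x n) / of_nat N - L) \<le> (C + N * (e / 2)) / N"
      using N by (simp add: divide_right_mono)
    also have "\<dots> = C / N + e / 2" using N by (simp add: field_simps)
    also have "\<dots> < e"
    proof -
      have "real N1 < real N" using N by simp
      then have "2 * C / e < N" using N1 by linarith
      then show ?thesis using e N by (simp add: field_simps)
    qed
    finally show ?thesis .
  qed
  then show "\<exists>no. \<forall>n\<ge>no. norm ((\<Sum>n<n. x n) / of_nat n - L) < e" by blast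
qed

lemma cis_eq_1_iff: "cis x = 1 \<longleftrightarrow> (\<exists>k::int. x = 2 * pi * of_int k)"
  unfolding cis_conv_exp exp_eq_1 by (simp add: mult_ac)

text \<open>
  A special case of the Riemann-Lebesgue lemma. The means of the exponentials \<open>cis (n (t - \<theta>))\<close> are
  bounded and tend to zero away from the points with \<open>cis (t - \<theta>) = 1\<close>, so the limit, once it
  exists, is zero by dominated convergence.
\<close>

lemma fourier_integrals_limit_zero:
  fixes h :: "real \<Rightarrow> complex" and \<epsilon> :: real
  assumes h: "continuous_on {a..b} h" and \<epsilon>: "\<epsilon> \<noteq> 0"
    and lim: "(\<lambda>n. integral {a..b} (\<lambda>t. h t * cis (\<epsilon> * real n * (t - \<theta>)))) \<longlonglongrightarrow> L"
  shows "L = 0"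
proof -
  define K where "K = (\<lambda>N t. (\<Sum>n<N. cis (\<epsilon> * real n * (t - \<theta>))) / of_nat N)"
  define Z where "Z = {t\<in>{a..b}. cis (\<epsilon> * (t - \<theta>)) = 1}"
  have powr: "cis (\<epsilon> * real n * (t - \<theta>)) = cis (\<epsilon> * (t - \<theta>)) ^ n" for n t
    by (simp only: Complex.DeMoivre) (simp only: mult_ac)
  have finZ: "finite Z"
  proof -
    have "Z \<subseteq> (\<lambda>k. \<theta> + 2 * pi * of_int k / \<epsilon>) ` {k::int. \<bar>of_int k\<bar> \<le> \<bar>\<epsilon>\<bar> * (\<bar>a\<bar> + \<bar>b\<bar> + \<bar>\<theta>\<bar>)}"
    proof
      fix t assume t: "t \<in> Z"
      then obtain k :: int where k: "\<epsilon> * (t - \<theta>) = 2 * pi * of_int k"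
        by (auto simp: Z_def cis_eq_1_iff)
      have "\<bar>t - \<theta>\<bar> \<le> \<bar>a\<bar> + \<bar>b\<bar> + \<bar>\<theta>\<bar>" using t by (auto simp: Z_def)
      then have "\<bar>\<epsilon> * (t - \<theta>)\<bar> \<le> \<bar>\<epsilon>\<bar> * (\<bar>a\<bar> + \<bar>b\<bar> + \<bar>\<theta>\<bar>)"
        by (simp add: abs_mult mult_left_mono)
      moreover have "\<bar>of_int k\<bar> \<le> \<bar>2 * pi * of_int k\<bar>"
        using pi_gt3 by (simp add: abs_mult mult_le_cancel_right1)
      ultimately have "\<bar>of_int k\<bar> \<le> \<bar>\<epsilon>\<bar> * (\<bar>a\<bar> + \<bar>b\<bar> + \<bar>\<theta>\<bar>)" using k by linarith
      moreover have "t = \<theta> + 2 * pi * of_int k / \<epsilon>" using k \<epsilon> by (simp add: field_simps)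
      ultimately show "t \<in> (\<lambda>k. \<theta> + 2 * pi * of_int k / \<epsilon>) ` {k::int. \<bar>of_int k\<bar> \<le> \<bar>\<epsilon>\<bar> * (\<bar>a\<bar> + \<bar>b\<bar> + \<bar>\<theta>\<bar>)}"
        by blast
    qed
    moreover have "finite {k::int. \<bar>of_int k\<bar> \<le> X}" for X :: real
    proof (rule finite_subset)
      show "{k::int. \<bar>of_int k\<bar> \<le> X} \<subseteq> {- \<lceil>X\<rceil>..\<lceil>X\<rceil>}"
        by (auto simp: abs_le_iff) linarith+
    qed simp
    ultimately show ?thesis using finite_imageI finite_subset by metis
  qed
  have int: "integral {a..b} (\<lambda>t. h t * K N t) =
      (\<Sum>n<N. integral {a..b} (\<lambda>t. h t * cis (\<epsilon> * real n * (t - \<theta>)))) / of_nat N" for N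
  proof -
    have "integral {a..b} (\<lambda>t. h t * K N t) =
        integral {a..b} (\<lambda>t. (\<Sum>n<N. h t * cis (\<epsilon> * real n * (t - \<theta>))) / of_nat N)"
      by (simp add: K_def sum_distrib_left)
    also have "\<dots> = integral {a..b} (\<lambda>t. \<Sum>n<N. h t * cis (\<epsilon> * real n * (t - \<theta>))) / of_nat N"
      by (rule integral_divide)
    also have "integral {a..b} (\<lambda>t. \<Sum>n<N. h t * cis (\<epsilon> * real n * (t - \<theta>))) =
        (\<Sum>n<N. integral {a..b} (\<lambda>t. h t * cis (\<epsilon> * real n * (t - \<theta>))))"
      by (intro integral_sum integrable_continuous_interval continuous_intros h) auto
    finally show ?thesis .
  qed
  have lim1: "(\<lambda>N. integral {a..b} (\<lambda>t. h t * K N t)) \<longlonglongrightarrow> L"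
    unfolding int by (rule Cesaro_mean_tendsto[OF lim])
  have contK: "continuous_on {a..b} (\<lambda>t. h t * K N t)" for N
    unfolding K_def by (cases "N = 0") (auto intro!: continuous_intros h)
  have K1: "cmod (K N t) \<le> 1" for N t
  proof -
    have "cmod (\<Sum>n<N. cis (\<epsilon> * real n * (t - \<theta>))) \<le> (\<Sum>n<N. 1)" by (rule sum_norm_le) simp
    then show ?thesis by (cases "N = 0") (auto simp: K_def norm_divide)
  qed
  have K0: "(\<lambda>N. K N t) \<longlonglongrightarrow> 0" if "cis (\<epsilon> * (t - \<theta>)) \<noteq> 1" for t
  proof -
    let ?z = "cis (\<epsilon> * (t - \<theta>))"
    have "cmod (K N t) \<le> (2 / cmod (?z - 1)) * inverse (real N)" for N
    proof -
      have "(\<Sum>n<N. cis (\<epsilon> * real n * (t - \<theta>))) = (?z ^ N - 1) / (?z - 1)"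
        unfolding powr using that by (simp add: geometric_sum)
      moreover have "cmod (?z ^ N - 1) \<le> 2"
        using norm_triangle_ineq4[of "?z ^ N" 1] by (simp add: norm_power)
      ultimately show ?thesis
        by (simp add: K_def norm_divide norm_mult divide_right_mono flip: divide_inverse)
    qed
    moreover have "(\<lambda>N. (2 / cmod (?z - 1)) * inverse (real N)) \<longlonglongrightarrow> 0"
      by (intro tendsto_mult_right_zero lim_inverse_n)
    ultimately show ?thesis by (intro Lim_null_comparison[OF _ \<open>_ \<longlonglongrightarrow> 0\<close>]) auto
  qed
  have ae: "(\<lambda>N. h t * K N t) \<longlonglongrightarrow> 0" if "t \<in> {a..b} - Z" for t
    using that K0[of t] tendsto_mult_right_zero by (auto simp: Z_def)
  have neg: "integral ({a..b} - Z) f = integral {a..b} f" for f :: "real \<Rightarrow> complex"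
    by (intro integral_subset_negligible) (auto intro: negligible_subset[OF negligible_finite[OF finZ]])
  have neg': "f integrable_on ({a..b} - Z)" if "continuous_on {a..b} f" for f :: "real \<Rightarrow> 'z::banach"
    by (rule integrable_spike_set[OF integrable_continuous_interval[OF that]])
      (auto intro: negligible_subset[OF negligible_finite[OF finZ]])
  have "(\<lambda>N. integral ({a..b} - Z) (\<lambda>t. h t * K N t)) \<longlonglongrightarrow> integral ({a..b} - Z) (\<lambda>t. 0)"
  proof (rule dominated_convergence(2)[where h = "\<lambda>t. cmod (h t)"])
    show "(\<lambda>t. h t * K N t) integrable_on {a..b} - Z" for N by (rule neg'[OF contK])
    show "(\<lambda>t. cmod (h t)) integrable_on {a..b} - Z"
      by (intro neg' continuous_intros h)
    show "norm (h t * K N t) \<le> cmod (h t)" for N t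
      using K1[of N t] by (simp add: norm_mult mult_left_le)
  qed (use ae in auto)
  then have "(\<lambda>N. integral {a..b} (\<lambda>t. h t * K N t)) \<longlonglongrightarrow> 0"
    unfolding neg by simp
  then show ?thesis using lim1 LIMSEQ_unique by blast
qed


lemma periodic_int_shift:
  fixes f :: "real \<Rightarrow> 'b"
  assumes per: "\<And>t. f (t + p) = f t"
  shows "f (t + p * of_int k) = f t"
proof -
  have nat: "f (t + p * real n) = f t" for t n
  proof (induction n)
    case (Suc n)
    have "f (t + p * real (Suc n)) = f (t + p * real n + p)" by (simp add: algebra_simps)
    then show ?case using per Suc by simp
  qed simp
  show ?thesis
  proof (cases "k \<ge> 0")
    case True
    then show ?thesis using nat[of t "nat k"] by simp
  next
    case False
    then show ?thesis using nat[of "t + p * of_int k" "nat (- k)"] by simp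
  qed
qed

lemma integral_periodic_shift:
  fixes f :: "real \<Rightarrow> 'b::euclidean_space"
  assumes p: "p > 0" and per: "\<And>t. f (t + p) = f t" and f: "(f has_integral I) {a..a + p}"
  shows "(f has_integral I) {b..b + p}"
proof -
  define k where "k = \<lfloor>(b - a) / p\<rfloor>"
  define c where "c = b - p * of_int k"
  have c: "a \<le> c" "c \<le> a + p"
  proof -
    have "of_int k \<le> (b - a) / p" "(b - a) / p < of_int k + 1"
      unfolding k_def by linarith+
    then show "a \<le> c" "c \<le> a + p" using p by (auto simp: c_def field_simps)
  qed
  have shift: "(f has_integral J) {x + p * of_int j..y + p * of_int j}" if "(f has_integral J) {x..y}" for J x y j
    using has_integral_shift_real_ivl[OF that, of "- (p * of_int j)"] periodic_int_shift[of f p _ "- j", OF per] by simp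
  have int: "f integrable_on {a..a + p}" using f by blast
  then have 1: "f integrable_on {a..c}" and 2: "f integrable_on {c..a + p}"
    using c by (auto intro: integrable_on_subinterval)
  have "I = integral {a..c} f + integral {c..a + p} f"
    using Henstock_Kurzweil_Integration.integral_combine[OF c int] integral_unique[OF f] by simp
  moreover have "(f has_integral (integral {c..a + p} f + integral {a..c} f)) {c..c + p}"
    using c shift[OF integrable_integral[OF 1], of 1] integrable_integral[OF 2]
    by (intro has_integral_combine[where c = "a + p"]) auto
  ultimately have "(f has_integral I) {c..c + p}" by (simp add: add.commute)
  from shift[OF this, of k] show ?thesis by (simp add: c_def algebra_simps)
qed

section \<open>The conjugate function\<close>

text \<open>
  If \<open>w'\<close> is the derivative of \<open>w\<close>, the value at the singular points is the limit of the quotient, as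
  \<open>cis\<close> has derivative \<open>\<i>\<close> at \<open>0\<close>.
\<close>

definition chord_quotient :: "(real \<Rightarrow> complex) \<Rightarrow> (real \<Rightarrow> complex) \<Rightarrow> real \<Rightarrow> real \<Rightarrow> complex" where
  "chord_quotient w w' \<theta> t =
     (if cis (t - \<theta>) = 1 then w' t / \<i> else (w t - w \<theta>) / (cis (t - \<theta>) - 1))"

lemma has_vector_derivative_quotient_tendsto:
  fixes f :: "real \<Rightarrow> complex"
  assumes "(f has_vector_derivative d) (at x)"
  shows "((\<lambda>t. (f t - f x) / of_real (t - x)) \<longlongrightarrow> d) (at x)"
proof -
  have "((\<lambda>t. norm (f t - f x - (t - x) *\<^sub>R d) / norm (t - x)) \<longlongrightarrow> 0) (at x)"
    using assms unfolding has_vector_derivative_def has_derivative_iff_norm by simp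
  moreover have "\<forall>\<^sub>F t in at x. norm (f t - f x - (t - x) *\<^sub>R d) / norm (t - x) =
      norm ((f t - f x) / of_real (t - x) - d)"
  proof (rule eventually_at_filter[THEN iffD2], rule always_eventually, intro allI impI)
    fix t assume "t \<noteq> x"
    then have "(f t - f x) / of_real (t - x) - d = (f t - f x - (t - x) *\<^sub>R d) / of_real (t - x)"
      by (simp add: field_simps scaleR_conv_of_real)
    then show "norm (f t - f x - (t - x) *\<^sub>R d) / norm (t - x) = norm ((f t - f x) / of_real (t - x) - d)"
      by (simp add: norm_divide del: of_real_diff)
  qed
  ultimately have "((\<lambda>t. norm ((f t - f x) / of_real (t - x) - d)) \<longlongrightarrow> 0) (at x)"
    using tendsto_cong by force
  then show ?thesis using LIM_zero_cancel tendsto_norm_zero_iff by blast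
qed

lemma periodic_cis_eq:
  fixes w :: "real \<Rightarrow> 'b"
  assumes per: "\<And>t. w (t + 2 * pi) = w t" and "cis x = cis y"
  shows "w x = w y"
proof -
  have "cis (x - y) = 1" using assms(2) by (simp flip: cis_divide)
  then obtain k :: int where k: "x = y + 2 * pi * of_int k"
    by (metis add.commute cis_eq_1_iff diff_add_cancel)
  show ?thesis unfolding k by (rule periodic_int_shift[of w "2 * pi", OF per])
qed

text \<open>
  Near a singular point \<open>t0\<close> the chord quotient is the quotient of the difference quotients of \<open>w\<close> and of
  \<open>cis (t - \<theta>)\<close> at \<open>t0\<close>, whose limits are \<open>w' t0\<close> and \<open>\<i>\<close>.
\<close>

lemma continuous_chord_quotient:
  assumes w: "\<And>t. (w has_vector_derivative w' t) (at t)" and per: "\<And>t. w (t + 2 * pi) = w t"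
  shows "continuous_on UNIV (chord_quotient w w' \<theta>)"
proof (rule continuous_at_imp_continuous_on, rule ballI)
  fix t0
  have contw: "continuous (at t) w" for t using w has_vector_derivative_continuous by blast
  have contc: "isCont (\<lambda>t. cis (t - \<theta>)) t" for t
    using continuous_on_cis[of UNIV "\<lambda>t. t - \<theta>"]
    by (simp add: continuous_on_eq_continuous_at continuous_on_diff)
  show "isCont (chord_quotient w w' \<theta>) t0"
  proof (cases "cis (t0 - \<theta>) = 1")
    case False
    have ev: "\<forall>\<^sub>F t in nhds t0. cis (t - \<theta>) \<noteq> 1"
    proof -
      have "open {t. cis (t - \<theta>) \<noteq> 1}"
        by (intro open_Collect_neq continuous_intros)
      then show ?thesis using False eventually_nhds by blast
    qed
    have "isCont (\<lambda>t. (w t - w \<theta>) / (cis (t - \<theta>) - 1)) t0"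
      using False by (intro continuous_intros contw contc) auto
    moreover have "\<forall>\<^sub>F t in nhds t0. chord_quotient w w' \<theta> t = (w t - w \<theta>) / (cis (t - \<theta>) - 1)"
      using ev by eventually_elim (simp add: chord_quotient_def)
    ultimately show ?thesis by (simp add: isCont_cong)
  next
    case True
    have wt0: "w t0 = w \<theta>"
      using periodic_cis_eq[of w t0 \<theta>, OF per] True by (simp flip: cis_divide)
    have d: "((\<lambda>t. cis (t - \<theta>)) has_vector_derivative \<i>) (at t0)"
      using cis_has_vector_derivative[of 1 "- \<theta>" t0 UNIV] True by simp
    have lim1: "((\<lambda>t. (cis (t - \<theta>) - 1) / of_real (t - t0)) \<longlongrightarrow> \<i>) (at t0)"
      using has_vector_derivative_quotient_tendsto[OF d] True by simp
    have lim2: "((\<lambda>t. (w t - w \<theta>) / of_real (t - t0)) \<longlongrightarrow> w' t0) (at t0)"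
      using has_vector_derivative_quotient_tendsto[OF w[of t0]] wt0 by simp
    have ev: "\<forall>\<^sub>F t in at t0. (cis (t - \<theta>) - 1) / of_real (t - t0) \<noteq> 0"
      by (rule tendsto_imp_eventually_ne[OF lim1]) simp
    have "((\<lambda>t. ((w t - w \<theta>) / of_real (t - t0)) / ((cis (t - \<theta>) - 1) / of_real (t - t0)))
        \<longlongrightarrow> w' t0 / \<i>) (at t0)"
      by (intro tendsto_divide lim1 lim2) simp
    moreover have evq: "\<forall>\<^sub>F t in at t0. ((w t - w \<theta>) / of_real (t - t0)) / ((cis (t - \<theta>) - 1) / of_real (t - t0))
        = chord_quotient w w' \<theta> t"
      using ev by eventually_elim (auto simp: chord_quotient_def divide_simps)
    ultimately have "(chord_quotient w w' \<theta> \<longlongrightarrow> w' t0 / \<i>) (at t0)"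
      by (simp only: tendsto_cong[OF evq])
    then show ?thesis using True by (simp add: isCont_def chord_quotient_def)
  qed
qed

definition analytic_coeffs :: "(real \<Rightarrow> complex) \<Rightarrow> nat \<Rightarrow> complex" where
  "analytic_coeffs w n = fourier_coeff w (int n)"

text \<open>
  The coefficients are conjugated so that the modes \<open>n < 0\<close> sum to the conjugate of a power series; the
  constant mode belongs to \<open>analytic_coeffs\<close>.
\<close>

definition antianalytic_coeffs :: "(real \<Rightarrow> complex) \<Rightarrow> nat \<Rightarrow> complex" where
  "antianalytic_coeffs w n = (if n = 0 then 0 else cnj (fourier_coeff w (- int n)))"

lemma rapidly_decreasing_analytic_coeffs:
  assumes "smooth_on UNIV w" and "\<And>t. w (t + 2 * pi) = w t"
  shows "rapidly_decreasing (analytic_coeffs w)" and "rapidly_decreasing (antianalytic_coeffs w)"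
proof -
  have 1: "\<exists>B. \<forall>n. real n ^ k * cmod (analytic_coeffs w n) \<le> B" for k
    using fourier_coeff_rapidly_decreasing[OF assms, of k] unfolding analytic_coeffs_def
    by (metis abs_of_nat of_int_of_nat_eq)
  show "rapidly_decreasing (analytic_coeffs w)" using 1 unfolding rapidly_decreasing_def by blast
  have "\<exists>B. \<forall>n. real n ^ k * cmod (antianalytic_coeffs w n) \<le> B" for k
  proof -
    obtain B where B: "\<And>n. \<bar>of_int n\<bar> ^ k * cmod (fourier_coeff w n) \<le> B"
      using fourier_coeff_rapidly_decreasing[OF assms, of k] by blast
    have "B \<ge> 0" using order_trans[OF _ B[of 0]] by simp
    then have "real n ^ k * cmod (antianalytic_coeffs w n) \<le> B" for n
      using B[of "- int n"] by (simp add: antianalytic_coeffs_def)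
    then show ?thesis by blast
  qed
  then show "rapidly_decreasing (antianalytic_coeffs w)" unfolding rapidly_decreasing_def by blast
qed

text \<open>
  With \<open>H n\<close> the \<open>n\<close>-th Fourier coefficient (centred at \<open>\<theta>\<close>) of the chord quotient, the \<open>n\<close>-th term of the
  Fourier series of \<open>w - w \<theta>\<close> at \<open>\<theta>\<close> is \<open>H (n - 1) - H n\<close>. Both halves of the series telescope: the
  analytic half to \<open>H (- 1)\<close>, the antianalytic half to \<open>- H (- 1)\<close>. Hence the sum of the halves is
  \<open>w \<theta>\<close>, and their difference is an integral over the chord quotient.
\<close>

lemma fourier_halves:
  fixes w w' :: "real \<Rightarrow> complex" and \<theta> :: real
  assumes w: "\<And>t. (w has_vector_derivative w' t) (at t)" and smooth: "smooth_on UNIV w"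
    and per: "\<And>t. w (t + 2 * pi) = w t"
  defines "A \<equiv> pseries (analytic_coeffs w) (cis \<theta>)"
    and "B \<equiv> cnj (pseries (antianalytic_coeffs w) (cis \<theta>))"
  shows "A + B = w \<theta>"
    and "A - B = integral {0..2 * pi} (\<lambda>t. (cis (t - \<theta>) + 1) * chord_quotient w w' \<theta> t) / (2 * of_real pi)
           + fourier_coeff w 0"
proof -
  let ?h = "chord_quotient w w' \<theta>"
  define H where "H = (\<lambda>n::int. integral {0..2 * pi} (\<lambda>t. ?h t * cis (- (of_int n * (t - \<theta>)))) / (2 * of_real pi))"
  have h: "continuous_on S ?h" for S
    using continuous_chord_quotient[OF w per] continuous_on_subset by blast
  have cw: "continuous_on S w" for S
    using w by (meson continuous_at_imp_continuous_on has_vector_derivative_continuous)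
  have hw: "?h t * (cis (t - \<theta>) - 1) = w t - w \<theta>" for t
    using periodic_cis_eq[of w t \<theta>, OF per] by (auto simp: chord_quotient_def simp flip: cis_divide)
  let ?q = "\<lambda>n t. w t * cis (- (of_int n * t)) - w \<theta> * cis (- (of_int n * t))"
  have coeff: "fourier_coeff w n * cis (of_int n * \<theta>) - (if n = 0 then w \<theta> else 0) = H (n - 1) - H n" for n
  proof -
    have "fourier_coeff w n * cis (of_int n * \<theta>) - (if n = 0 then w \<theta> else 0)
        = (fourier_coeff w n - fourier_coeff (\<lambda>t. w \<theta>) n) * cis (of_int n * \<theta>)"
    proof -
      have "fourier_coeff (\<lambda>t. w \<theta>) n = (if n = 0 then w \<theta> else 0)"
        using fourier_coeff_const[of n "w \<theta>"] by (simp add: fourier_coeff_def scaleR_conv_of_real)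
      then show ?thesis by (simp add: left_diff_distrib)
    qed
    also have "fourier_coeff w n - fourier_coeff (\<lambda>t. w \<theta>) n =
        integral {0..2 * pi} (?q n) / (2 * of_real pi)"
      unfolding fourier_coeff_def diff_divide_distrib[symmetric]
      by (subst integral_diff) (auto intro!: integrable_continuous_interval continuous_intros cw)
    also have "\<dots> * cis (of_int n * \<theta>) =
        integral {0..2 * pi} (\<lambda>t. ?q n t * cis (of_int n * \<theta>))
          / (2 * of_real pi)"
      by simp
    also have "(\<lambda>t. ?q n t * cis (of_int n * \<theta>))
      = (\<lambda>t. ?h t * cis (- (of_int (n - 1) * (t - \<theta>))) - ?h t * cis (- (of_int n * (t - \<theta>))))"
    proof
      fix t
      have "?q n t * cis (of_int n * \<theta>)
          = (w t - w \<theta>) * (cis (- (of_int n * t)) * cis (of_int n * \<theta>))" by (simp add: algebra_simps)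
      also have "cis (- (of_int n * t)) * cis (of_int n * \<theta>) = cis (- (of_int n * (t - \<theta>)))"
        by (simp add: cis_mult algebra_simps)
      also have "(w t - w \<theta>) * \<dots> = ?h t * (cis (t - \<theta>) * cis (- (of_int n * (t - \<theta>))) - cis (- (of_int n * (t - \<theta>))))"
        by (simp add: algebra_simps flip: hw)
      also have "cis (t - \<theta>) * cis (- (of_int n * (t - \<theta>))) = cis (- (of_int (n - 1) * (t - \<theta>)))"
        by (simp add: cis_mult algebra_simps)
      finally show "?q n t * cis (of_int n * \<theta>)
        = ?h t * cis (- (of_int (n - 1) * (t - \<theta>))) - ?h t * cis (- (of_int n * (t - \<theta>)))"
        by (simp add: algebra_simps)
    qed
    also have "integral {0..2 * pi} \<dots> / (2 * of_real pi) = H (n - 1) - H n"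
      unfolding H_def diff_divide_distrib[symmetric]
      by (subst integral_diff) (auto intro!: integrable_continuous_interval continuous_intros h)
    finally show ?thesis .
  qed
  have cis_pow: "cis \<theta> ^ n = cis (of_int (int n) * \<theta>)" for n by (simp add: Complex.DeMoivre)
  have z: "cis \<theta> \<in> cball 0 1" by simp
  note rd = rapidly_decreasing_analytic_coeffs[OF smooth per]

  \<comment> \<open>The partial sums show that \<open>H N\<close> converges, and then its limit is zero.\<close>
  have sA: "(\<lambda>N. \<Sum>n<N. analytic_coeffs w n * cis \<theta> ^ n) \<longlonglongrightarrow> A"
    using pseries_sums[OF rd(1) z] by (simp add: sums_def A_def)
  have partA: "(\<Sum>n<Suc N. analytic_coeffs w n * cis \<theta> ^ n) = w \<theta> + H (- 1) - H (int N)" for N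
  proof (induction N)
    case 0
    show ?case using coeff[of 0] by (simp add: analytic_coeffs_def algebra_simps)
  next
    case (Suc N)
    have "analytic_coeffs w (Suc N) * cis \<theta> ^ Suc N = H (int N) - H (int (Suc N))"
      using coeff[of "int (Suc N)"] unfolding cis_pow by (simp add: analytic_coeffs_def)
    then show ?case using Suc by simp
  qed
  have "(\<lambda>N. w \<theta> + H (- 1) - (\<Sum>n<Suc N. analytic_coeffs w n * cis \<theta> ^ n)) \<longlonglongrightarrow> w \<theta> + H (- 1) - A"
    by (intro tendsto_intros LIMSEQ_Suc sA)
  then have "(\<lambda>N. H (int N)) \<longlonglongrightarrow> w \<theta> + H (- 1) - A" by (simp only: partA) simp
  then have "(\<lambda>N. H (int N) * (2 * of_real pi)) \<longlonglongrightarrow> (w \<theta> + H (- 1) - A) * (2 * of_real pi)"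
    by (intro tendsto_intros)
  then have "(w \<theta> + H (- 1) - A) * (2 * of_real pi) = 0"
    by (intro fourier_integrals_limit_zero[where a = 0 and b = "2 * pi" and \<epsilon> = "- 1" and h = ?h and \<theta> = \<theta>])
      (auto simp: H_def h)
  then have "w \<theta> + H (- 1) - A = 0" by simp
  then have A: "A = w \<theta> + H (- 1)" by simp

  \<comment> \<open>The same argument for \<open>H (- N - 1)\<close>.\<close>
  have "(\<lambda>N. cnj (\<Sum>n<N. antianalytic_coeffs w n * cis \<theta> ^ n)) \<longlonglongrightarrow> B"
    unfolding B_def using pseries_sums[OF rd(2) z] by (intro tendsto_cnj) (simp add: sums_def)
  then have sB: "(\<lambda>N. cnj (\<Sum>n<Suc N. antianalytic_coeffs w n * cis \<theta> ^ n)) \<longlonglongrightarrow> B"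
    by (rule LIMSEQ_Suc)
  have partB: "cnj (\<Sum>n<Suc N. antianalytic_coeffs w n * cis \<theta> ^ n) = H (- int N - 1) - H (- 1)" for N
  proof (induction N)
    case 0
    show ?case by (simp add: antianalytic_coeffs_def)
  next
    case (Suc N)
    have "cnj (antianalytic_coeffs w (Suc N) * cis \<theta> ^ Suc N) =
        fourier_coeff w (- int (Suc N)) * cis (of_int (- int (Suc N)) * \<theta>)"
    proof -
      have "cnj (cis \<theta> ^ Suc N) = cis (of_int (- int (Suc N)) * \<theta>)"
        unfolding cis_pow cis_cnj by (rule arg_cong[of _ _ cis]) (simp add: algebra_simps)
      then show ?thesis unfolding complex_cnj_mult by (simp add: antianalytic_coeffs_def)
    qed
    also have "\<dots> = H (- int (Suc N) - 1) - H (- int (Suc N))"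
      using coeff[of "- int (Suc N)"] by simp
    also have "H (- int (Suc N)) = H (- int N - 1)" by (rule arg_cong[of _ _ H]) simp
    finally show ?case using Suc by simp
  qed
  have "(\<lambda>N. cnj (\<Sum>n<Suc N. antianalytic_coeffs w n * cis \<theta> ^ n) + H (- 1)) \<longlonglongrightarrow> B + H (- 1)"
    by (intro tendsto_intros sB)
  then have "(\<lambda>N. H (- int N - 1)) \<longlonglongrightarrow> B + H (- 1)" by (simp only: partB) simp
  then have "(\<lambda>N. H (- int N - 1) * (2 * of_real pi)) \<longlonglongrightarrow> (B + H (- 1)) * (2 * of_real pi)"
    by (intro tendsto_intros)
  moreover have "H (- int N - 1) * (2 * of_real pi)
      = integral {0..2 * pi} (\<lambda>t. (?h t * cis (t - \<theta>)) * cis (1 * real N * (t - \<theta>)))" for N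
    by (simp add: H_def mult.assoc cis_mult) (simp add: algebra_simps)
  ultimately have "(B + H (- 1)) * (2 * of_real pi) = 0"
    by (intro fourier_integrals_limit_zero[where a = 0 and b = "2 * pi" and \<epsilon> = 1 and \<theta> = \<theta>
          and h = "\<lambda>t. ?h t * cis (t - \<theta>)"])
      (auto intro!: continuous_intros h)
  then have B: "B = - H (- 1)" by (simp add: add_eq_0_iff)

  show "A + B = w \<theta>" using A B by simp
  have "A - B = (H (- 1) + H 0) + fourier_coeff w 0"
    using A B coeff[of 0] by (simp add: algebra_simps)
  also have "H (- 1) + H 0 = integral {0..2 * pi} (\<lambda>t. (cis (t - \<theta>) + 1) * ?h t) / (2 * of_real pi)"
    unfolding H_def add_divide_distrib[symmetric]
    by (subst integral_add[symmetric])
      (auto intro!: integrable_continuous_interval continuous_intros h simp: algebra_simps)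
  finally show "A - B = integral {0..2 * pi} (\<lambda>t. (cis (t - \<theta>) + 1) * ?h t) / (2 * of_real pi)
           + fourier_coeff w 0" .
qed

section \<open>The maximum principle in the disk\<close>

lemma second_derivative_at_local_max:
  fixes \<phi> :: "real \<Rightarrow> real"
  assumes r: "r > 0" and d1: "\<And>t. \<bar>t\<bar> < r \<Longrightarrow> (\<phi> has_real_derivative \<phi>' t) (at t)"
    and d2: "(\<phi>' has_real_derivative c) (at 0)" and mx: "\<And>t. \<bar>t\<bar> < r \<Longrightarrow> \<phi> t \<le> \<phi> 0"
  shows "c \<le> 0"
proof (rule ccontr)
  assume "\<not> c \<le> 0"
  then have "c > 0" by simp
  have "\<phi>' 0 = 0"
    using DERIV_local_max[OF d1[of 0] r] r mx by auto
  obtain d where d: "d > 0" "\<And>h. 0 < h \<Longrightarrow> h < d \<Longrightarrow> \<phi>' 0 < \<phi>' (0 + h)"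
    using DERIV_pos_inc_right[OF d2 \<open>c > 0\<close>] by auto
  define h where "h = min d r / 2"
  have h: "0 < h" "h < d" "h < r" using d r by (auto simp: h_def min_def)
  obtain x where x: "0 < x" "x < h" "\<phi> h - \<phi> 0 = (h - 0) * \<phi>' x"
    using MVT2[of 0 h \<phi> \<phi>'] d1 h by (smt (verit))
  have "\<phi>' x > 0" using d(2)[of x] x h \<open>\<phi>' 0 = 0\<close> by simp
  then have "h * \<phi>' x > 0" using h by simp
  then have "\<phi> h > \<phi> 0" using x(3) by simp
  moreover have "\<phi> h \<le> \<phi> 0" using mx[of h] h by simp
  ultimately show False by simp
qed

text \<open>
  If \<open>f' x\<close> is the differential of a function at \<open>x\<close>, this is Laplace's equation at \<open>z\<close>.
\<close>

definition zero_divergence_at :: "(complex \<Rightarrow> complex \<Rightarrow> 'b::real_normed_vector) \<Rightarrow> complex \<Rightarrow> bool" where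
  "zero_divergence_at f' z \<longleftrightarrow> (\<exists>Dx Dy. ((\<lambda>x. f' x 1) has_derivative Dx) (at z) \<and>
        ((\<lambda>x. f' x \<i>) has_derivative Dy) (at z) \<and> Dx 1 + Dy \<i> = 0)"

text \<open>
  The subharmonic perturbation \<open>v + \<epsilon> \<bar>z\<bar>\<^sup>2\<close> has no interior maximum, because there both second
  derivatives would be nonpositive while their sum is \<open>4 \<epsilon>\<close>.
\<close>

lemma disk_harmonic_nonpos:
  fixes v :: "complex \<Rightarrow> real" and f' :: "complex \<Rightarrow> complex \<Rightarrow> real"
  assumes cont: "continuous_on (cball 0 1) v" and bd: "\<And>z. z \<in> sphere 0 1 \<Longrightarrow> v z \<le> 0"
    and d1: "\<And>z. z \<in> ball 0 1 \<Longrightarrow> (v has_derivative f' z) (at z)"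
    and d2: "\<And>z. z \<in> ball 0 1 \<Longrightarrow> zero_divergence_at f' z"
    and z: "z \<in> cball 0 1"
  shows "v z \<le> 0"
proof (rule ccontr)
  assume "\<not> v z \<le> 0"
  \<comment> \<open>The perturbation is at most \<open>\<epsilon> < v z\<close> on the circle, so its maximum lies in the interior.\<close>
  define \<epsilon> where "\<epsilon> = v z / 2"
  have \<epsilon>: "\<epsilon> > 0" using \<open>\<not> v z \<le> 0\<close> by (simp add: \<epsilon>_def)
  define g where "g = (\<lambda>x. v x + \<epsilon> * (x \<bullet> x))"
  have "continuous_on (cball 0 1) g"
    unfolding g_def by (intro continuous_intros cont)
  then obtain m where m: "m \<in> cball 0 1" "\<And>x. x \<in> cball 0 1 \<Longrightarrow> g x \<le> g m"
    using continuous_attains_sup[of "cball (0::complex) 1" g] by auto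
  have "m \<in> ball 0 1"
  proof (rule ccontr)
    assume "m \<notin> ball 0 1"
    then have "cmod m = 1" using m(1) by simp
    then have "g m \<le> \<epsilon>" using bd[of m] by (simp add: g_def dot_square_norm)
    moreover have "g z \<le> g m" using m(2) z by blast
    moreover have "g z \<ge> v z" using \<epsilon> by (simp add: g_def)
    ultimately show False using \<epsilon> by (simp add: \<epsilon>_def)
  qed
  then obtain Dx Dy where D: "((\<lambda>x. f' x 1) has_derivative Dx) (at m)"
      "((\<lambda>x. f' x \<i>) has_derivative Dy) (at m)" "Dx 1 + Dy \<i> = 0"
    using d2 unfolding zero_divergence_at_def by blast
  obtain r where r: "r > 0" "ball m r \<subseteq> ball 0 1"
    using \<open>m \<in> ball 0 1\<close> open_contains_ball[of "ball (0::complex) 1"] by blast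
  have dir: "L d + 2 * \<epsilon> \<le> 0"
    if L: "((\<lambda>x. f' x d) has_derivative L) (at m)" and d: "cmod d = 1" for d L
  proof (rule second_derivative_at_local_max[OF r(1)])
    let ?p = "\<lambda>t::real. m + t *\<^sub>R d"
    have p: "(?p has_derivative (\<lambda>h. h *\<^sub>R d)) (at t)" for t
      by (auto intro!: derivative_eq_intros)
    have pin: "?p t \<in> ball 0 1" if "\<bar>t\<bar> < r" for t
    proof -
      have "?p t \<in> ball m r" using that d by (simp add: dist_norm)
      then show ?thesis using r(2) by blast
    qed
    show "((\<lambda>t. g (?p t)) has_real_derivative f' (?p t) d + 2 * \<epsilon> * (?p t \<bullet> d)) (at t)"
      if "\<bar>t\<bar> < r" for t
    proof -
      have "((\<lambda>t. v (?p t)) has_derivative (\<lambda>h. f' (?p t) (h *\<^sub>R d))) (at t)"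
        using has_derivative_compose[OF p d1[OF pin[OF that]]] .
      moreover have "f' (?p t) (h *\<^sub>R d) = h * f' (?p t) d" for h
        using has_derivative_linear[OF d1[OF pin[OF that]]] by (simp add: linear_scale)
      moreover have "((\<lambda>t. \<epsilon> * (?p t \<bullet> ?p t)) has_derivative (\<lambda>h. \<epsilon> * (?p t \<bullet> h *\<^sub>R d + h *\<^sub>R d \<bullet> ?p t))) (at t)"
        by (intro has_derivative_mult_right has_derivative_inner p)
      ultimately have "((\<lambda>t. g (?p t)) has_derivative
          (\<lambda>h. h * f' (?p t) d + \<epsilon> * (?p t \<bullet> h *\<^sub>R d + h *\<^sub>R d \<bullet> ?p t))) (at t)"
        unfolding g_def by (auto intro: has_derivative_add)
      moreover have "h * f' (?p t) d + \<epsilon> * (?p t \<bullet> h *\<^sub>R d + h *\<^sub>R d \<bullet> ?p t)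
          = (f' (?p t) d + 2 * \<epsilon> * (?p t \<bullet> d)) * h" for h
        by (simp add: algebra_simps inner_commute)
      ultimately show ?thesis by (simp add: has_field_derivative_def)
    qed
    have "((\<lambda>t. f' (?p t) d) has_derivative (\<lambda>h. L (h *\<^sub>R d))) (at 0)"
      using has_derivative_compose[OF p[of 0], of "\<lambda>x. f' x d" L] L by simp
    moreover have "((\<lambda>t. 2 * \<epsilon> * (?p t \<bullet> d)) has_derivative (\<lambda>h. 2 * \<epsilon> * (h *\<^sub>R d \<bullet> d))) (at 0)"
      by (intro has_derivative_mult_right has_derivative_inner_left p)
    ultimately have "((\<lambda>t. f' (?p t) d + 2 * \<epsilon> * (?p t \<bullet> d)) has_derivative
        (\<lambda>h. L (h *\<^sub>R d) + 2 * \<epsilon> * (h *\<^sub>R d \<bullet> d))) (at 0)"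
      by (rule has_derivative_add)
    moreover have "L (h *\<^sub>R d) + 2 * \<epsilon> * (h *\<^sub>R d \<bullet> d) = (L d + 2 * \<epsilon>) * h" for h
      using has_derivative_linear[OF L] d by (simp add: linear_scale dot_square_norm algebra_simps)
    ultimately show "((\<lambda>t. f' (?p t) d + 2 * \<epsilon> * (?p t \<bullet> d)) has_real_derivative L d + 2 * \<epsilon>) (at 0)"
      by (simp add: has_field_derivative_def)
    show "g (?p t) \<le> g (?p 0)" if "\<bar>t\<bar> < r" for t
      using pin[OF that] m(2)[of "?p t"] by simp
  qed
  have "Dx 1 + 2 * \<epsilon> \<le> 0" "Dy \<i> + 2 * \<epsilon> \<le> 0" using dir[OF D(1)] dir[OF D(2)] by auto
  then show False using D(3) \<epsilon> by linarith
qed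

section \<open>Geometry of a parametrized domain\<close>

lemma inner_mult_complex: "(a * z) \<bullet> (a * w) = (cmod a)\<^sup>2 * (z \<bullet> w)" for a z w :: complex
  unfolding cmod_power2 by (simp add: inner_complex_def algebra_simps power2_eq_square)

lemma linear_complex_expand:
  assumes "linear f"
  shows "f h = Re h *\<^sub>R f 1 + Im h *\<^sub>R f \<i>"
proof -
  have "h = Re h *\<^sub>R 1 + Im h *\<^sub>R \<i>" by (simp add: complex_eq_iff)
  then have "f h = f (Re h *\<^sub>R 1 + Im h *\<^sub>R \<i>)" by simp
  also have "\<dots> = Re h *\<^sub>R f 1 + Im h *\<^sub>R f \<i>"
    unfolding linear_add[OF assms] linear_scale[OF assms] by simp
  finally show ?thesis .
qed

text \<open>
  At a boundary point of the half-plane a maximum controls the derivative only in the directions that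
  point into the half-plane; along the boundary both signs of \<open>h\<close> are available.
\<close>

lemma one_sided_derivative_at_max:
  fixes f :: "complex \<Rightarrow> real"
  assumes D: "(f has_derivative L) (at x within S)" and mx: "\<And>y. y \<in> S \<Longrightarrow> f y \<le> f x"
    and \<delta>: "\<delta> > 0" and sub: "\<And>t. 0 \<le> t \<Longrightarrow> t \<le> \<delta> \<Longrightarrow> x + t *\<^sub>R h \<in> S"
  shows "L h \<le> 0"
proof (rule ccontr)
  assume "\<not> L h \<le> 0"
  let ?p = "\<lambda>t::real. x + t *\<^sub>R h"
  have p: "(?p has_derivative (\<lambda>k. k *\<^sub>R h)) (at 0 within {0..\<delta>})"
    by (auto intro!: derivative_eq_intros)
  have "?p ` {0..\<delta>} \<subseteq> S" using sub by auto
  then have "(f has_derivative L) (at (?p 0) within ?p ` {0..\<delta>})"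
    using D has_derivative_subset by auto
  then have "((\<lambda>t. f (?p t)) has_derivative (\<lambda>k. L (k *\<^sub>R h))) (at 0 within {0..\<delta>})"
    using has_derivative_in_compose[OF p, of f L] by simp
  then have "((\<lambda>t. f (?p t)) has_real_derivative L h) (at 0 within {0..\<delta>})"
    using has_derivative_linear[OF D] by (simp add: has_field_derivative_def linear_scale mult.commute[of _ "L h"])
  then obtain d where d: "d > 0" "\<And>k. 0 < k \<Longrightarrow> 0 + k \<in> {0..\<delta>} \<Longrightarrow> k < d \<Longrightarrow> f (?p 0) < f (?p (0 + k))"
    using has_real_derivative_pos_inc_right[of "\<lambda>t. f (?p t)" "L h" 0 "{0..\<delta>}"] \<open>\<not> L h \<le> 0\<close> by auto
  define k where "k = min d \<delta> / 2"
  have k: "0 < k" "k < d" "k \<le> \<delta>" using d \<delta> by (auto simp: k_def min_def)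
  have "f x < f (?p k)" using d(2)[of k] k by simp
  moreover have "f (?p k) \<le> f x" using sub[of k] mx k by simp
  ultimately show False by simp
qed

lemma convex_upper_halfplane: "convex upper_halfplane"
  unfolding upper_halfplane_def using convex_halfspace_Im_ge[of 0] by simp

lemma mem_interior_upper_halfplane: "Im w > 0 \<Longrightarrow> w \<in> interior upper_halfplane"
proof -
  assume "Im w > 0"
  moreover have "open {z. Im z > 0}" by (rule open_halfspace_Im_gt)
  moreover have "{z. Im z > 0} \<subseteq> upper_halfplane" by (auto simp: upper_halfplane_def)
  ultimately show ?thesis by (meson interiorI mem_Collect_eq)
qed

lemma interior_upper_halfplane_nonempty: "interior upper_halfplane \<noteq> {}"
  using mem_interior_upper_halfplane[of \<i>] by auto

lemma unit_circle_cis: "cmod z = 1 \<Longrightarrow> \<exists>t. z = cis t"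
  using cis_Arg[of z] by (metis norm_zero scaleR_one sgn_div_norm inverse_1 zero_neq_one)

text \<open>
  Everything on the surface is computed in the global parameter \<open>\<Phi>\<close>. Its inverse is \<open>\<Psi>\<close>, and
  \<open>\<Psi> \<circ> inv_into U c\<close> is the transition from a chart \<open>(U, c)\<close> to the disk.
\<close>

locale disk_surface =
  fixes M :: "'a::t2_space immersed_surface" and \<Phi> :: "complex \<Rightarrow> 'a" and \<Phi>' :: "complex \<Rightarrow> complex"
  assumes dom: "multisheeted_domain M" and bih: "disk_biholomorphism M \<Phi>"
    and der: "\<And>z. z \<in> cball 0 1 \<Longrightarrow>
           (imm M \<circ> \<Phi> has_field_derivative \<Phi>' z) (at z within cball 0 1)"
begin

definition \<Psi> :: "'a \<Rightarrow> complex" where "\<Psi> = inv_into (cball 0 1) \<Phi>"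

lemma bij: "bij_betw \<Phi> (cball 0 1) (pts M)"
  using bih by (simp add: disk_biholomorphism_def)

lemma \<Psi>_\<Phi> [simp]: "z \<in> cball 0 1 \<Longrightarrow> \<Psi> (\<Phi> z) = z"
  using bij by (auto simp: \<Psi>_def bij_betw_def)

lemma \<Phi>_\<Psi> [simp]: "p \<in> pts M \<Longrightarrow> \<Phi> (\<Psi> p) = p"
  using bij by (simp add: \<Psi>_def bij_betw_inv_into_right)

lemma \<Psi>_in: "p \<in> pts M \<Longrightarrow> \<Psi> p \<in> cball 0 1"
  using bij unfolding \<Psi>_def by (metis bij_betw_def inv_into_into)

lemma \<Phi>_in: "z \<in> cball 0 1 \<Longrightarrow> \<Phi> z \<in> pts M"
  using bij by (auto simp: bij_betw_def)

lemma surface: "smooth_surface M" and immersion: "smooth_immersion M"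
  using dom by (auto simp: multisheeted_domain_def)

lemma chart_is_chart: "(U, c) \<in> charts M \<Longrightarrow> is_chart (pts M) U c"
  using surface by (auto simp: smooth_surface_def)

lemma chart_openin: "(U, c) \<in> charts M \<Longrightarrow> openin (top_of_set (pts M)) U"
  using chart_is_chart by (auto simp: is_chart_def)

lemma chart_subset: "(U, c) \<in> charts M \<Longrightarrow> U \<subseteq> pts M"
  using chart_openin openin_imp_subset by blast

lemma chart_image_openin: "(U, c) \<in> charts M \<Longrightarrow> openin (top_of_set upper_halfplane) (c ` U)"
  using chart_is_chart by (auto simp: is_chart_def)

lemma chart_image_subset: "(U, c) \<in> charts M \<Longrightarrow> c ` U \<subseteq> upper_halfplane"
  using chart_image_openin openin_imp_subset by blast

lemma chart_inv [simp]: "(U, c) \<in> charts M \<Longrightarrow> p \<in> U \<Longrightarrow> inv_into U c (c p) = p"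
  using chart_is_chart unfolding is_chart_def homeomorphism_def by blast

lemma chart_inv_in: "(U, c) \<in> charts M \<Longrightarrow> w \<in> c ` U \<Longrightarrow> inv_into U c w \<in> U"
  by (simp add: inv_into_into)

lemma chart_exists:
  assumes "p \<in> pts M"
  obtains U c where "(U, c) \<in> charts M" and "p \<in> U"
  using assms surface unfolding smooth_surface_def by blast

lemma chart_at_within:
  "(U, c) \<in> charts M \<Longrightarrow> p \<in> U \<Longrightarrow> at (c p) within c ` U = at (c p) within upper_halfplane"
  using at_within_openin[OF chart_image_openin] by blast

lemma chart_derivative_unique:
  fixes f :: "complex \<Rightarrow> complex"
  assumes c: "(U, c) \<in> charts M" "p \<in> U"
    and "(f has_derivative D1) (at (c p) within c ` U)" "(f has_derivative D2) (at (c p) within c ` U)"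
  shows "D1 = D2"
proof (rule has_derivative_unique_convex[OF convex_upper_halfplane interior_upper_halfplane_nonempty])
  show "c p \<in> upper_halfplane" using c chart_image_subset by blast
qed (use assms chart_at_within[OF c] in auto)

abbreviation transition :: "'a set \<Rightarrow> ('a \<Rightarrow> complex) \<Rightarrow> complex \<Rightarrow> complex" where
  "transition U c \<equiv> \<lambda>w. \<Psi> (inv_into U c w)"

lemma smooth_\<Psi>_chart:
  assumes "(U, c) \<in> charts M"
  shows "smooth_on (c ` U) (transition U c)"
  using bih assms unfolding disk_biholomorphism_def smooth_fun_def \<Psi>_def comp_def by auto

lemma \<Psi>_chart_in: "(U, c) \<in> charts M \<Longrightarrow> w \<in> c ` U \<Longrightarrow> \<Psi> (inv_into U c w) \<in> cball 0 1"
  using \<Psi>_in chart_inv_in chart_subset by blast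

lemma imm_chart_derivative:
  assumes c: "(U, c) \<in> charts M" "p \<in> U"
    and B: "(transition U c has_derivative B) (at (c p) within c ` U)"
  shows "(imm M \<circ> inv_into U c has_derivative (\<lambda>h. \<Phi>' (\<Psi> p) * B h)) (at (c p) within c ` U)"
proof -
  have p: "p \<in> pts M" using c chart_subset by blast
  have img: "transition U c ` c ` U \<subseteq> cball 0 1"
    using \<Psi>_chart_in[OF c(1)] by blast
  have "(imm M \<circ> \<Phi> has_derivative (*) (\<Phi>' (\<Psi> p))) (at (\<Psi> (inv_into U c (c p)))
      within transition U c ` c ` U)"
    using der[OF \<Psi>_in[OF p]] c has_derivative_subset[OF _ img]
    by (simp add: has_field_derivative_def)
  from has_derivative_in_compose[OF B this]
  have "((\<lambda>w. (imm M \<circ> \<Phi>) (\<Psi> (inv_into U c w))) has_derivative (\<lambda>h. \<Phi>' (\<Psi> p) * B h))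
      (at (c p) within c ` U)" .
  then show ?thesis
  proof (rule has_derivative_transform[rotated -1])
    show "c p \<in> c ` U" using c by blast
    show "(imm M \<circ> inv_into U c) w = (imm M \<circ> \<Phi>) (\<Psi> (inv_into U c w))" if "w \<in> c ` U" for w
      using chart_inv_in[OF c(1) that] chart_subset[OF c(1)] by auto
  qed
qed

text \<open>
  In a chart the differential of the immersion is \<open>\<Phi>'\<close> times the differential of \<open>\<Psi>\<close>, so injectivity
  of the former shows that neither factor degenerates.
\<close>

lemma chart_differential:
  assumes c: "(U, c) \<in> charts M" "p \<in> U"
  obtains B where "(transition U c has_derivative B) (at (c p) within c ` U)"
    and "(imm M \<circ> inv_into U c has_derivative (\<lambda>h. \<Phi>' (\<Psi> p) * B h)) (at (c p) within c ` U)"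
    and "linear B" and "inj B" and "surj B" and "\<Phi>' (\<Psi> p) \<noteq> 0"
proof -
  have "c p \<in> c ` U" using c by blast
  then obtain B where B: "(transition U c has_derivative B) (at (c p) within c ` U)"
    by (rule smooth_on_has_derivative[OF smooth_\<Psi>_chart[OF c(1)]])
  have A: "(imm M \<circ> inv_into U c has_derivative (\<lambda>h. \<Phi>' (\<Psi> p) * B h)) (at (c p) within c ` U)"
    by (rule imm_chart_derivative[OF c B])
  have inj: "inj (\<lambda>h. \<Phi>' (\<Psi> p) * B h)"
    using immersion c A unfolding smooth_immersion_def by blast
  have lin: "linear B" using B has_derivative_linear by blast
  have "inj B"
  proof (rule injI)
    show "x = y" if "B x = B y" for x y using injD[OF inj, of x y] that by simp
  qed
  moreover have "surj B" by (rule linear_injective_imp_surjective[OF lin \<open>inj B\<close> refl])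
  moreover have "\<Phi>' (\<Psi> p) \<noteq> 0"
  proof
    assume "\<Phi>' (\<Psi> p) = 0"
    then show False using injD[OF inj, of 0 1] by simp
  qed
  ultimately show thesis using that B A lin by blast
qed

lemma \<Phi>'_nonzero:
  assumes "z \<in> cball 0 1"
  shows "\<Phi>' z \<noteq> 0"
  by (rule chart_exists[OF \<Phi>_in[OF assms]], rule chart_differential) (use assms in auto)

lemma surjective_right_cancel: "surj (A :: complex \<Rightarrow> complex) \<Longrightarrow> L \<circ> A = L' \<circ> A \<Longrightarrow> L = L'"
  by (metis comp_assoc comp_id surj_iff)

text \<open>
  In every chart both \<open>u\<close> and the immersion factor through the transition to the disk, with differentials
  \<open>D \<circ> B\<close> and \<open>\<Phi>' B\<close>. As \<open>B\<close> is onto, the factor \<open>L\<close> is \<open>D\<close> composed with division by \<open>\<Phi>'\<close>,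
  whichever chart is used.
\<close>

lemma planar_differential_eq:
  assumes z: "z \<in> cball 0 1" and v: "\<And>x. x \<in> cball 0 1 \<Longrightarrow> u (\<Phi> x) = v x"
    and D: "(v has_derivative D) (at z within cball 0 1)"
  shows "planar_differential M u (\<Phi> z) = (\<lambda>h. D (h / \<Phi>' z))"
proof -
  let ?L = "\<lambda>h. D (h / \<Phi>' z)"
  let ?Q = "\<lambda>L. \<exists>(U, c)\<in>charts M. \<Phi> z \<in> U \<and>
        (\<exists>A. (imm M \<circ> inv_into U c has_derivative A) (at (c (\<Phi> z)) within c ` U) \<and>
             (u \<circ> inv_into U c has_derivative L \<circ> A) (at (c (\<Phi> z)) within c ` U))"
  have key: "(imm M \<circ> inv_into U c has_derivative (\<lambda>h. \<Phi>' z * B h)) (at (c (\<Phi> z)) within c ` U) \<and>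
      (u \<circ> inv_into U c has_derivative ?L \<circ> (\<lambda>h. \<Phi>' z * B h)) (at (c (\<Phi> z)) within c ` U) \<and>
      surj (\<lambda>h. \<Phi>' z * B h)"
    if c: "(U, c) \<in> charts M" "\<Phi> z \<in> U"
      and B: "(transition U c has_derivative B) (at (c (\<Phi> z)) within c ` U)"
        "(imm M \<circ> inv_into U c has_derivative (\<lambda>h. \<Phi>' z * B h)) (at (c (\<Phi> z)) within c ` U)"
        "surj B"
    for U c B
  proof (intro conjI)
    have img: "transition U c ` c ` U \<subseteq> cball 0 1"
      using \<Psi>_chart_in[OF c(1)] by blast
    have "(v has_derivative D) (at (\<Psi> (inv_into U c (c (\<Phi> z))))
        within transition U c ` c ` U)"
      using D c z has_derivative_subset[OF _ img] by simp
    from has_derivative_in_compose[OF B(1) this]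
    have 1: "((\<lambda>w. v (\<Psi> (inv_into U c w))) has_derivative (\<lambda>h. D (B h))) (at (c (\<Phi> z)) within c ` U)" .
    have "(u \<circ> inv_into U c has_derivative (\<lambda>h. D (B h))) (at (c (\<Phi> z)) within c ` U)"
    proof (rule has_derivative_transform[OF _ _ 1])
      show "c (\<Phi> z) \<in> c ` U" using c by blast
      show "(u \<circ> inv_into U c) w = v (\<Psi> (inv_into U c w))" if "w \<in> c ` U" for w
      proof -
        have "inv_into U c w \<in> pts M" using chart_inv_in[OF c(1) that] chart_subset[OF c(1)] by blast
        then show ?thesis using v[OF \<Psi>_in] by fastforce
      qed
    qed
    then show "(u \<circ> inv_into U c has_derivative ?L \<circ> (\<lambda>h. \<Phi>' z * B h)) (at (c (\<Phi> z)) within c ` U)"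
      using \<Phi>'_nonzero[OF z] by (simp add: comp_def)
    show "surj (\<lambda>h. \<Phi>' z * B h)"
    proof (rule surjI)
      show "\<Phi>' z * B (inv B (y / \<Phi>' z)) = y" for y
        using \<Phi>'_nonzero[OF z] B(3) by (simp add: surj_f_inv_f)
    qed
  qed (rule B(2))
  show ?thesis
    unfolding planar_differential_def
  proof (rule the_equality)
    obtain U c where c: "(U, c) \<in> charts M" "\<Phi> z \<in> U" by (rule chart_exists[OF \<Phi>_in[OF z]])
    obtain B where B: "(transition U c has_derivative B) (at (c (\<Phi> z)) within c ` U)"
        "(imm M \<circ> inv_into U c has_derivative (\<lambda>h. \<Phi>' z * B h)) (at (c (\<Phi> z)) within c ` U)"
        "surj B"
      by (rule chart_differential[OF c]) (use z in auto)
    show "?Q ?L"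
      using c key[OF c B] by blast
  next
    fix L
    assume "?Q L"
    then obtain U c A where c: "(U, c) \<in> charts M" "\<Phi> z \<in> U"
      and A: "(imm M \<circ> inv_into U c has_derivative A) (at (c (\<Phi> z)) within c ` U)"
        "(u \<circ> inv_into U c has_derivative L \<circ> A) (at (c (\<Phi> z)) within c ` U)" by blast
    obtain B where B: "(transition U c has_derivative B) (at (c (\<Phi> z)) within c ` U)"
        "(imm M \<circ> inv_into U c has_derivative (\<lambda>h. \<Phi>' z * B h)) (at (c (\<Phi> z)) within c ` U)"
        "surj B"
      by (rule chart_differential[OF c]) (use z in auto)
    note k = key[OF c B]
    have "A = (\<lambda>h. \<Phi>' z * B h)" using chart_derivative_unique[OF c A(1) B(2)] .
    moreover have "L \<circ> A = ?L \<circ> (\<lambda>h. \<Phi>' z * B h)"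
      using chart_derivative_unique[OF c A(2)] k by blast
    ultimately show "L = ?L" using k surjective_right_cancel by metis
  qed
qed

lemma smooth_into_\<Phi>: "smooth_into M (cball 0 1) \<Phi>"
  using bih by (simp add: disk_biholomorphism_def)

lemma continuous_\<Phi>: "continuous_on (cball 0 1) \<Phi>"
  using smooth_into_\<Phi> by (simp add: smooth_into_def)

lemma preimage_openin:
  assumes "(U, c) \<in> charts M"
  shows "openin (top_of_set (cball 0 1)) {x \<in> cball 0 1. \<Phi> x \<in> U}"
proof -
  have "openin (top_of_set (cball 0 1)) (cball 0 1 \<inter> \<Phi> -` U)"
    using chart_openin[OF assms] by (intro continuous_openin_preimage[OF continuous_\<Phi>]) (auto simp: \<Phi>_in)
  moreover have "cball 0 1 \<inter> \<Phi> -` U = {x \<in> cball 0 1. \<Phi> x \<in> U}" by auto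
  ultimately show ?thesis by simp
qed

lemma smooth_chart_\<Phi>:
  assumes "(U, c) \<in> charts M"
  shows "smooth_on {x \<in> cball 0 1. \<Phi> x \<in> U} (\<lambda>x. c (\<Phi> x))"
  using smooth_into_\<Phi> assms by (auto simp: smooth_into_def comp_def)

lemma chart_\<Phi>_derivative:
  assumes c: "(U, c) \<in> charts M" and z: "z \<in> cball 0 1" "\<Phi> z \<in> U"
  obtains C where "((\<lambda>x. c (\<Phi> x)) has_derivative C) (at z within cball 0 1)"
    and "linear C" and "surj C"
proof -
  let ?N = "{x \<in> cball 0 1. \<Phi> x \<in> U}"
  have zN: "z \<in> ?N" using z by simp
  have at: "at z within ?N = at z within cball 0 1"
    by (rule at_within_openin[OF preimage_openin[OF c] zN])
  obtain C where C: "((\<lambda>x. c (\<Phi> x)) has_derivative C) (at z within ?N)"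
    by (rule smooth_on_has_derivative[OF smooth_chart_\<Phi>[OF c] zN])
  have lin: "linear C" using C has_derivative_linear by blast
  obtain B where B: "(transition U c has_derivative B) (at (c (\<Phi> z)) within c ` U)"
      "linear B"
    by (rule chart_differential[OF c z(2)])
  have "(transition U c has_derivative B) (at (c (\<Phi> z)) within (\<lambda>x. c (\<Phi> x)) ` ?N)"
    by (rule has_derivative_subset[OF B(1)]) auto
  from has_derivative_in_compose[OF C this]
  have "((\<lambda>x. \<Psi> (inv_into U c (c (\<Phi> x)))) has_derivative (\<lambda>h. B (C h))) (at z within ?N)" .
  then have "((\<lambda>x. x) has_derivative (\<lambda>h. B (C h))) (at z within ?N)"
    by (rule has_derivative_transform[OF zN, rotated]) (use c in auto)
  moreover have "((\<lambda>x. x) has_derivative (\<lambda>h. h)) (at z within ?N)" by simp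
  ultimately have "(\<lambda>h. B (C h)) = (\<lambda>h. h)"
    unfolding at by (intro has_derivative_unique_convex[of "cball 0 1" z]) (use z in auto)
  then have "inj C" by (metis injI)
  then have "surj C" using linear_injective_imp_surjective[OF lin _ refl] by simp
  then show thesis using that C lin unfolding at by blast
qed

text \<open>
  At an interior chart point that is mapped to the circle, the squared modulus of the transition would
  have a local maximum, although the differential of the transition is onto. A boundary chart point with
  parameter inside the disk is excluded by the minimum of the imaginary part of the chart.
\<close>

lemma interior_chart_point:
  assumes c: "(U, c) \<in> charts M" "p \<in> U" and Im: "Im (c p) > 0"
  shows "cmod (\<Psi> p) < 1"
proof (rule ccontr)
  assume "\<not> cmod (\<Psi> p) < 1"
  have p: "p \<in> pts M" using c chart_subset by blast
  then have n1: "cmod (\<Psi> p) = 1" using \<Psi>_in[OF p] \<open>\<not> cmod (\<Psi> p) < 1\<close> by simp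
  obtain B where B: "(transition U c has_derivative B) (at (c p) within c ` U)" "surj B"
    by (rule chart_differential[OF c])
  obtain T where T: "open T" "c ` U = upper_halfplane \<inter> T"
    using chart_image_openin[OF c(1)] by (auto simp: openin_open)
  let ?S = "interior upper_halfplane \<inter> T"
  have S: "open ?S" "c p \<in> ?S" "?S \<subseteq> c ` U"
  proof -
    have "c p \<in> T" using T(2) c(2) by blast
    then show "open ?S" "c p \<in> ?S" using T(1) Im mem_interior_upper_halfplane by auto
    show "?S \<subseteq> c ` U" unfolding T(2) using interior_subset[of upper_halfplane] by blast
  qed
  let ?f = "\<lambda>w. \<Psi> (inv_into U c w) \<bullet> \<Psi> (inv_into U c w)"
  have "(transition U c has_derivative B) (at (c p))"
    using has_derivative_subset[OF B(1) S(3)] unfolding at_within_open[OF S(2,1)] .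
  then have D: "(?f has_derivative (\<lambda>h. \<Psi> p \<bullet> B h + B h \<bullet> \<Psi> p)) (at (c p))"
    using has_derivative_inner[of "\<lambda>w. \<Psi> (inv_into U c w)" B "c p" UNIV "\<lambda>w. \<Psi> (inv_into U c w)" B] c
    by simp
  have "?f w \<le> ?f (c p)" if "w \<in> ?S" for w
  proof -
    have "cmod (\<Psi> (inv_into U c w)) \<le> 1" using \<Psi>_chart_in[OF c(1)] that S(3) by force
    then show ?thesis using n1 c by (simp add: dot_square_norm power_le_one)
  qed
  then have eq0: "(\<lambda>h. \<Psi> p \<bullet> B h + B h \<bullet> \<Psi> p) = (\<lambda>h. 0)"
    using differential_zero_maxmin[OF S(2,1) D] by blast
  have "\<Psi> p \<bullet> B h = 0" for h using fun_cong[OF eq0, of h] by (simp add: inner_commute)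
  moreover obtain h where "B h = \<Psi> p" using B(2) by (metis surjD)
  ultimately have "\<Psi> p \<bullet> \<Psi> p = 0" by metis
  then show False using n1 by simp
qed

lemma boundary_chart_point:
  assumes c: "(U, c) \<in> charts M" "p \<in> U" and Im: "Im (c p) = 0"
  shows "cmod (\<Psi> p) = 1"
proof (rule ccontr)
  assume "cmod (\<Psi> p) \<noteq> 1"
  have p: "p \<in> pts M" using c chart_subset by blast
  then have z: "\<Psi> p \<in> cball 0 1" "\<Psi> p \<in> ball 0 1" using \<Psi>_in[OF p] \<open>cmod (\<Psi> p) \<noteq> 1\<close> by auto
  obtain C where C: "((\<lambda>x. c (\<Phi> x)) has_derivative C) (at (\<Psi> p) within cball 0 1)" "surj C"
    by (rule chart_\<Phi>_derivative[OF c(1) z(1)]) (use c p in auto)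
  obtain T where T: "open T" "{x \<in> cball 0 1. \<Phi> x \<in> U} = cball 0 1 \<inter> T"
    using preimage_openin[OF c(1)] by (auto simp: openin_open)
  let ?S = "ball 0 1 \<inter> T"
  have sub: "ball 0 1 \<inter> T \<subseteq> {x \<in> cball 0 1. \<Phi> x \<in> U}" unfolding T(2) by auto
  have "\<Psi> p \<in> {x \<in> cball 0 1. \<Phi> x \<in> U}" using z c(2) p by simp
  then have "\<Psi> p \<in> T" unfolding T(2) by blast
  then have S: "open ?S" "\<Psi> p \<in> ?S" using T(1) z(2) by auto
  have "((\<lambda>x. c (\<Phi> x)) has_derivative C) (at (\<Psi> p))"
    using has_derivative_subset[OF C(1) ball_subset_cball] unfolding at_within_open[OF z(2) open_ball] .
  then have D: "((\<lambda>x. Im (c (\<Phi> x))) has_derivative (\<lambda>h. Im (C h))) (at (\<Psi> p))"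
    by (rule has_derivative_Im)
  have "Im (c (\<Phi> (\<Psi> p))) \<le> Im (c (\<Phi> x))" if "x \<in> ?S" for x
  proof -
    have "\<Phi> x \<in> U" using that sub by blast
    then show ?thesis using Im p chart_image_subset[OF c(1)] by (auto simp: upper_halfplane_def)
  qed
  then have eq0: "(\<lambda>h. Im (C h)) = (\<lambda>h. 0)"
    using differential_zero_maxmin[OF S(2,1) D] by blast
  obtain h where "C h = \<i>" using C(2) by (metis surjD)
  then show False using fun_cong[OF eq0, of h] by simp
qed

lemma chart_Im_nonneg: "(U, c) \<in> charts M \<Longrightarrow> p \<in> U \<Longrightarrow> 0 \<le> Im (c p)"
  using chart_image_subset by (fastforce simp: upper_halfplane_def)

lemma bdry_iff: "p \<in> bdry M \<longleftrightarrow> p \<in> pts M \<and> cmod (\<Psi> p) = 1"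
proof
  assume "p \<in> bdry M"
  then show "p \<in> pts M \<and> cmod (\<Psi> p) = 1"
    unfolding bdry_def using boundary_chart_point chart_subset by blast
next
  assume p: "p \<in> pts M \<and> cmod (\<Psi> p) = 1"
  then obtain U c where c: "(U, c) \<in> charts M" "p \<in> U" using chart_exists by blast
  then have "Im (c p) = 0"
    using interior_chart_point[OF c] chart_Im_nonneg[OF c] p by fastforce
  then show "p \<in> bdry M" using c by (auto simp: bdry_def)
qed

lemma bdry_chart_Im: "(U, c) \<in> charts M \<Longrightarrow> p \<in> U \<Longrightarrow> p \<in> bdry M \<Longrightarrow> Im (c p) = 0"
  using interior_chart_point chart_Im_nonneg unfolding bdry_iff by fastforce

lemma bdry_subset: "bdry M \<subseteq> pts M" using bdry_iff by blast

lemma \<Phi>_bdry: "cmod z = 1 \<Longrightarrow> \<Phi> z \<in> bdry M"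
  by (simp add: bdry_iff \<Phi>_in)

lemma bdry_chart_inv:
  assumes "(U, c) \<in> charts M" and "complex_of_real t \<in> c ` U"
  shows "inv_into U c (of_real t) \<in> bdry M"
proof -
  obtain p where "p \<in> U" "c p = of_real t" using assms(2) by force
  moreover have "inv_into U c (of_real t) = p" using chart_inv[OF assms(1)] calculation by metis
  ultimately show ?thesis using assms(1) by (auto simp: bdry_def intro!: bexI[of _ "(U, c)"])
qed

lemma chart_real_open:
  assumes "(U, c) \<in> charts M"
  shows "open {t::real. of_real t \<in> c ` U}"
proof -
  obtain T where T: "open T" "c ` U = upper_halfplane \<inter> T"
    using chart_image_openin[OF assms] by (auto simp: openin_open)
  have "{t::real. of_real t \<in> c ` U} = of_real -` T"
    unfolding T(2) by (auto simp: upper_halfplane_def)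
  then show ?thesis using T(1) by (simp add: continuous_open_vimage)
qed

text \<open>
  The modulus of the transition is maximal at boundary points, so its derivative vanishes along the boundary
  and is nonpositive in the inward direction. It cannot vanish there too, since \<open>B\<close> is onto.
\<close>

lemma bdry_chart_directions:
  assumes c: "(U, c) \<in> charts M" "p \<in> U" and p: "p \<in> bdry M"
    and B: "(transition U c has_derivative B) (at (c p) within c ` U)" "surj B"
  shows "\<Psi> p \<bullet> B 1 = 0" and "\<Psi> p \<bullet> B \<i> < 0"
proof -
  have n1: "cmod (\<Psi> p) = 1" using p bdry_iff by blast
  let ?f = "\<lambda>w. \<Psi> (inv_into U c w) \<bullet> \<Psi> (inv_into U c w)"
  let ?L = "\<lambda>h. \<Psi> p \<bullet> B h + B h \<bullet> \<Psi> p"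
  have lin: "linear B" using B has_derivative_linear by blast
  have D: "(?f has_derivative ?L) (at (c p) within c ` U)"
    using has_derivative_inner[OF B(1) B(1)] c by simp
  have mx: "?f w \<le> ?f (c p)" if "w \<in> c ` U" for w
  proof -
    have "cmod (\<Psi> (inv_into U c w)) \<le> 1" using \<Psi>_chart_in[OF c(1)] that by force
    then show ?thesis using n1 c by (simp add: dot_square_norm power_le_one)
  qed
  obtain T where T: "open T" "c ` U = upper_halfplane \<inter> T"
    using chart_image_openin[OF c(1)] by (auto simp: openin_open)
  have "c p \<in> T" using T(2) c by blast
  then obtain r where r: "r > 0" "cball (c p) r \<subseteq> T" using T(1) open_contains_cball by blast
  have dir: "\<Psi> p \<bullet> B h \<le> 0" if "cmod h = 1" "Im h \<ge> 0" for h
  proof -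
    have "c p + t *\<^sub>R h \<in> c ` U" if "0 \<le> t" "t \<le> r" for t
    proof -
      have "c p + t *\<^sub>R h \<in> cball (c p) r" using that \<open>cmod h = 1\<close> by (simp add: dist_norm)
      then show ?thesis using r(2) that \<open>Im h \<ge> 0\<close> bdry_chart_Im[OF c p] unfolding T(2)
        by (auto simp: upper_halfplane_def)
    qed
    from one_sided_derivative_at_max[OF D mx r(1) this]
    show ?thesis by (simp add: inner_commute)
  qed
  have "\<Psi> p \<bullet> B (- 1) = - (\<Psi> p \<bullet> B 1)" using lin by (simp add: linear_neg)
  then show 0: "\<Psi> p \<bullet> B 1 = 0" using dir[of 1] dir[of "- 1"] by simp
  have "\<Psi> p \<bullet> B \<i> \<noteq> 0"
  proof
    assume "\<Psi> p \<bullet> B \<i> = 0"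
    then have "\<Psi> p \<bullet> B h = 0" for h
      using 0 linear_complex_expand[OF lin, of h] by (simp add: inner_add_right)
    moreover obtain h where "B h = \<Psi> p" using B(2) by (metis surjD)
    ultimately have "\<Psi> p \<bullet> \<Psi> p = 0" by metis
  then show False using n1 by simp
  qed
  then show "\<Psi> p \<bullet> B \<i> < 0" using dir[of \<i>] by simp
qed

text \<open>
  Multiplication by \<open>\<Phi>'\<close> is a similarity, so the outer normal \<open>z\<close> of the circle is mapped to a multiple
  of the outer normal. For uniqueness, two vectors that are orthogonal to \<open>B 1\<close> and on the same side are
  positive multiples of each other.
\<close>

lemma outer_normal_eq:
  assumes z: "cmod z = 1"
  shows "outer_normal M (\<Phi> z) = z * \<Phi>' z / of_real (cmod (\<Phi>' z))"
proof -
  have zc: "z \<in> cball 0 1" using z by simp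
  have nz: "\<Phi>' z \<noteq> 0" using \<Phi>'_nonzero[OF zc] .
  let ?e = "\<Phi>' z / of_real (cmod (\<Phi>' z))"
  let ?Q = "\<lambda>n. cmod n = 1 \<and> (\<exists>(U, c) \<in> charts M. \<Phi> z \<in> U \<and>
           (\<exists>A. (imm M \<circ> inv_into U c has_derivative A) (at (c (\<Phi> z)) within c ` U) \<and>
                n \<bullet> A 1 = 0 \<and> n \<bullet> A \<i> < 0))"
  have e: "cmod ?e = 1" using nz by (simp add: norm_divide)
  have inner: "(?e * m) \<bullet> (\<Phi>' z * w) = cmod (\<Phi>' z) * (m \<bullet> w)" for m w
  proof -
    have "\<Phi>' z * w = of_real (cmod (\<Phi>' z)) * (?e * w)" using nz by simp
    then have "(?e * m) \<bullet> (\<Phi>' z * w) = (?e * m) \<bullet> (cmod (\<Phi>' z) *\<^sub>R (?e * w))"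
      by (simp only: scaleR_conv_of_real)
    also have "\<dots> = cmod (\<Phi>' z) * ((?e * m) \<bullet> (?e * w))" by (rule inner_scaleR_right)
    also have "\<dots> = cmod (\<Phi>' z) * (m \<bullet> w)" by (simp only: inner_mult_complex e) simp
    finally show ?thesis .
  qed
  show ?thesis
    unfolding outer_normal_def
  proof (rule the_equality)
    obtain U c where c: "(U, c) \<in> charts M" "\<Phi> z \<in> U" by (rule chart_exists[OF \<Phi>_in[OF zc]])
    obtain B where B: "(transition U c has_derivative B) (at (c (\<Phi> z)) within c ` U)"
        "(imm M \<circ> inv_into U c has_derivative (\<lambda>h. \<Phi>' z * B h)) (at (c (\<Phi> z)) within c ` U)"
        "surj B"
      by (rule chart_differential[OF c]) (use zc in auto)
    have dirs: "z \<bullet> B 1 = 0" "z \<bullet> B \<i> < 0"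
      using bdry_chart_directions[OF c \<Phi>_bdry[OF z] B(1,3)] zc by auto
    have "(z * ?e) \<bullet> (\<Phi>' z * B 1) = 0" "(z * ?e) \<bullet> (\<Phi>' z * B \<i>) < 0"
      using inner[of z "B 1"] inner[of z "B \<i>"] dirs nz
      by (simp_all add: mult.commute mult_less_0_iff)
    moreover have "cmod (z * ?e) = 1" using e z unfolding norm_mult by simp
    ultimately show "?Q (z * \<Phi>' z / of_real (cmod (\<Phi>' z)))"
      using c B(2) by (intro conjI bexI[of _ "(U, c)"]) auto
  next
    fix n
    assume n: "?Q n"
    then obtain U c A where c: "(U, c) \<in> charts M" "\<Phi> z \<in> U"
      and A: "(imm M \<circ> inv_into U c has_derivative A) (at (c (\<Phi> z)) within c ` U)"
        "n \<bullet> A 1 = 0" "n \<bullet> A \<i> < 0" by blast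
    obtain B where B: "(transition U c has_derivative B) (at (c (\<Phi> z)) within c ` U)"
        "(imm M \<circ> inv_into U c has_derivative (\<lambda>h. \<Phi>' z * B h)) (at (c (\<Phi> z)) within c ` U)"
        "linear B" "surj B"
      by (rule chart_differential[OF c]) (use zc in auto)
    have A_eq: "A = (\<lambda>h. \<Phi>' z * B h)" using chart_derivative_unique[OF c A(1) B(2)] .
    define m where "m = n / ?e"
    have nm: "n = ?e * m" using nz by (simp add: m_def)
    have m1: "cmod m = 1" using n e unfolding m_def norm_divide[of n] by simp
    have dirs: "z \<bullet> B 1 = 0" "z \<bullet> B \<i> < 0"
      using bdry_chart_directions[OF c \<Phi>_bdry[OF z] B(1,4)] zc by auto
    have mdirs: "m \<bullet> B 1 = 0" "m \<bullet> B \<i> < 0"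
      using A(2,3) nz inner[of m "B 1"] inner[of m "B \<i>"] unfolding A_eq nm
      by (simp_all add: mult_less_0_iff)
    define \<kappa> where "\<kappa> = (m \<bullet> B \<i>) / (z \<bullet> B \<i>)"
    have \<kappa>: "\<kappa> > 0" using dirs mdirs by (simp add: \<kappa>_def divide_neg_neg)
    have "(m - \<kappa> *\<^sub>R z) \<bullet> B h = 0" for h
      using dirs mdirs linear_complex_expand[OF B(3), of h]
      by (simp add: inner_diff_left inner_add_right \<kappa>_def)
    moreover obtain h where "B h = m - \<kappa> *\<^sub>R z" using B(4) by (metis surjD)
    ultimately have "m = \<kappa> *\<^sub>R z" by (metis eq_iff_diff_eq_0 inner_eq_zero_iff)
    then have "m = z" using m1 z \<kappa> by simp
    then show "n = z * \<Phi>' z / of_real (cmod (\<Phi>' z))" using nm by (simp add: mult.commute)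
  qed
qed

lemma bdry_tangent_eq:
  "cmod z = 1 \<Longrightarrow> bdry_tangent M (\<Phi> z) = \<i> * z * \<Phi>' z / of_real (cmod (\<Phi>' z))"
  by (simp add: bdry_tangent_def outer_normal_eq)

lemma bdry_tangent_nonzero: "cmod z = 1 \<Longrightarrow> bdry_tangent M (\<Phi> z) \<noteq> 0"
  using \<Phi>'_nonzero[of z] by (auto simp: bdry_tangent_eq)

section \<open>Differentiation along the boundary\<close>

text \<open>
  Differentiability in charts is all that the chain rule needs; it holds for arc-length parametrizations
  and for \<open>\<Phi> (cis (\<Theta> s))\<close> alike.
\<close>

definition unit_speed_curve :: "(real \<Rightarrow> 'a) \<Rightarrow> bool" where
  "unit_speed_curve x \<longleftrightarrow> continuous_on UNIV x \<and> range x \<subseteq> bdry M \<and>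
     (\<forall>(U, c) \<in> charts M. \<forall>t. x t \<in> U \<longrightarrow> (\<lambda>t. c (x t)) differentiable (at t)) \<and>
     (\<forall>t. (imm M \<circ> x has_vector_derivative bdry_tangent M (x t)) (at t))"

lemma preimage_open:
  assumes "(U, c) \<in> charts M" and "continuous_on UNIV x" and "range x \<subseteq> pts M"
  shows "open {t::real. x t \<in> U}"
proof -
  have "openin (top_of_set UNIV) (UNIV \<inter> x -` U)"
    using assms chart_openin[OF assms(1)] by (intro continuous_openin_preimage[of UNIV x "pts M" U]) auto
  then show ?thesis by (simp add: vimage_def)
qed

text \<open>
  In a boundary chart a unit speed curve is a real function \<open>\<rho>\<close>, and comparing its velocity with that of
  the chart gives \<open>\<rho>' k = 1\<close>. Hence every value \<open>v\<close> admitted in the definition of \<open>arc_deriv\<close> is the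
  derivative of \<open>g\<close> along the curve, which makes \<open>arc_deriv\<close> independent of the chart.
\<close>

lemma arc_deriv_along:
  assumes x: "unit_speed_curve x" and g: "smooth_bdry_fun M g"
  shows "((\<lambda>t. g (x t)) has_vector_derivative arc_deriv M g (x t0)) (at t0)"
proof -
  let ?p = "x t0" and ?T = "bdry_tangent M (x t0)"
  have xb: "x t \<in> bdry M" for t using x by (auto simp: unit_speed_curve_def)
  have pb: "?p \<in> bdry M" by (rule xb)
  obtain z where z: "cmod z = 1" "?p = \<Phi> z"
    using pb unfolding bdry_iff by (metis \<Phi>_\<Psi>)
  then have zc: "z \<in> cball 0 1" "\<Psi> ?p = z" by auto
  have T0: "?T \<noteq> 0" using bdry_tangent_nonzero z by simp
  have ximm: "(imm M \<circ> x has_vector_derivative ?T) (at t0)"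
    using x by (auto simp: unit_speed_curve_def)
  have chain: "((\<lambda>t. g (x t)) has_vector_derivative v) (at t0)"
    if c: "(U, c) \<in> charts M" "?p \<in> U"
      and k: "((\<lambda>t. imm M (inv_into U c (of_real t))) has_vector_derivative k *\<^sub>R ?T) (at (Re (c ?p)))"
      and v: "((\<lambda>t. g (inv_into U c (of_real t))) has_vector_derivative k *\<^sub>R v) (at (Re (c ?p)))"
    for U c k v
  proof -
    let ?V = "{t. x t \<in> U}"
    have V: "open ?V" "t0 \<in> ?V"
      using preimage_open[OF c(1)] x bdry_subset c(2) by (auto simp: unit_speed_curve_def)
    define \<rho> where "\<rho> = (\<lambda>t. Re (c (x t)))"
    have \<rho>: "inv_into U c (of_real (\<rho> t)) = x t" if "t \<in> ?V" for t
    proof -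
      have "c (x t) = of_real (\<rho> t)"
        using bdry_chart_Im[OF c(1) _ xb] that by (simp add: \<rho>_def complex_eq_iff)
      then show ?thesis using chart_inv[OF c(1)] that by (metis mem_Collect_eq)
    qed
    have "(\<lambda>t. c (x t)) differentiable (at t0)" using x c by (auto simp: unit_speed_curve_def)
    then obtain d where "((\<lambda>t. c (x t)) has_vector_derivative d) (at t0)"
      using vector_derivative_works by blast
    then have \<rho>': "(\<rho> has_vector_derivative Re d) (at t0)"
      unfolding \<rho>_def by (rule bounded_linear.has_vector_derivative[OF bounded_linear_Re])
    have comp: "((\<lambda>t. F (x t)) has_vector_derivative Re d *\<^sub>R e) (at t0)"
      if e: "((\<lambda>t. F (inv_into U c (of_real t))) has_vector_derivative e) (at (Re (c ?p)))"
      for F :: "'a \<Rightarrow> complex" and e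
    proof -
      have "((\<lambda>t. F (inv_into U c (of_real t))) has_vector_derivative e) (at (\<rho> t0))"
        using e by (simp add: \<rho>_def)
      from vector_diff_chain_at[OF \<rho>' this]
      have "((\<lambda>t. F (inv_into U c (of_real (\<rho> t)))) has_vector_derivative Re d *\<^sub>R e) (at t0)"
        by (simp add: comp_def)
      then show ?thesis
        by (rule has_vector_derivative_transform_within_open[OF _ V]) (simp add: \<rho>)
    qed
    have "(imm M \<circ> x has_vector_derivative Re d *\<^sub>R k *\<^sub>R ?T) (at t0)"
      using comp[OF k] by (simp add: comp_def)
    then have "Re d *\<^sub>R k *\<^sub>R ?T = ?T" using ximm vector_derivative_unique_at by blast
    then have "(Re d * k - 1) *\<^sub>R ?T = 0" by (simp add: algebra_simps)
    then have "Re d * k = 1" using T0 by simp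
    then show ?thesis using comp[OF v] by simp
  qed
  let ?Q = "\<lambda>v. \<exists>(U, c) \<in> charts M. ?p \<in> U \<and>
        (\<exists>k::real. ((\<lambda>t. imm M (inv_into U c (of_real t))) has_vector_derivative k *\<^sub>R ?T) (at (Re (c ?p))) \<and>
           ((\<lambda>t. g (inv_into U c (of_real t))) has_vector_derivative k *\<^sub>R v) (at (Re (c ?p))))"
  obtain v where v: "?Q v"
  proof -
    obtain U c where c: "(U, c) \<in> charts M" "?p \<in> U" using chart_exists bdry_subset pb by blast
    obtain B where B: "(transition U c has_derivative B) (at (c ?p) within c ` U)"
        "(imm M \<circ> inv_into U c has_derivative (\<lambda>h. \<Phi>' (\<Psi> ?p) * B h)) (at (c ?p) within c ` U)"
        "linear B" "inj B" "surj B"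
      by (rule chart_differential[OF c])
    have cp: "c ?p = of_real (Re (c ?p))" using bdry_chart_Im[OF c pb] by (simp add: complex_eq_iff)
    let ?R = "{t::real. of_real t \<in> c ` U}"
    have R: "open ?R" "Re (c ?p) \<in> ?R" using chart_real_open[OF c(1)] c(2) cp by auto
    \<comment> \<open>\<open>B 1\<close> is a real multiple of the tangent \<open>\<i> z\<close> of the circle\<close>
    have "z \<bullet> B 1 = 0" using bdry_chart_directions(1)[OF c pb B(1,5)] zc by simp
    then have Rz: "Re (cnj z * B 1) = 0" by (simp add: inner_complex_def)
    have "z * cnj z = 1" using z(1) by (simp add: complex_norm_square[symmetric])
    then have "B 1 = z * (cnj z * B 1)" by (simp add: mult.assoc[symmetric])
    also have "cnj z * B 1 = \<i> * of_real (Im (cnj z * B 1))" using Rz by (simp add: complex_eq_iff)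
    finally have B1: "B 1 = of_real (Im (cnj z * B 1)) * (\<i> * z)" by (simp add: mult_ac)
    define k where "k = Im (cnj z * B 1) * cmod (\<Phi>' z)"
    have \<Phi>'0: "\<Phi>' z \<noteq> 0" using \<Phi>'_nonzero[OF zc(1)] .
    have kT: "\<Phi>' (\<Psi> ?p) * B 1 = k *\<^sub>R ?T"
    proof -
      have "\<Phi>' (\<Psi> ?p) * B 1 = \<Phi>' z * (of_real (Im (cnj z * B 1)) * (\<i> * z))" using zc B1 by simp
      also have "\<dots> = k *\<^sub>R ?T"
        unfolding z(2) bdry_tangent_eq[OF z(1)] k_def scaleR_conv_of_real using \<Phi>'0 by simp
      finally show ?thesis .
    qed
    have "B 1 \<noteq> 0" using B(3,4) by (metis inj_eq linear_0 zero_neq_one)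
    then have k0: "k \<noteq> 0" using kT \<Phi>'0 zc(2) by (metis mult_eq_0_iff scaleR_zero_left)
    have ofr: "((of_real :: real \<Rightarrow> complex) has_derivative of_real) (at (Re (c ?p)) within ?R)"
      using bounded_linear_imp_has_derivative[OF bounded_linear_of_real] by blast
    have "(imm M \<circ> inv_into U c has_derivative (\<lambda>h. \<Phi>' (\<Psi> ?p) * B h))
        (at (complex_of_real (Re (c ?p))) within of_real ` ?R)"
      unfolding cp[symmetric] by (rule has_derivative_subset[OF B(2)]) auto
    from has_derivative_in_compose[OF ofr this]
    have "((\<lambda>t. (imm M \<circ> inv_into U c) (of_real t)) has_derivative (\<lambda>h. \<Phi>' (\<Psi> ?p) * B (of_real h)))
        (at (Re (c ?p)))"
      unfolding at_within_open[OF R(2,1)] .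
    moreover have "\<Phi>' (\<Psi> ?p) * B (of_real h) = h *\<^sub>R k *\<^sub>R ?T" for h
    proof -
      have "B (of_real h) = h *\<^sub>R B 1" using linear_scale[OF B(3), of h 1] by (simp add: scaleR_conv_of_real)
      then show ?thesis using kT by simp
    qed
    ultimately have 1: "((\<lambda>t. imm M (inv_into U c (of_real t))) has_vector_derivative k *\<^sub>R ?T) (at (Re (c ?p)))"
      by (simp add: has_vector_derivative_def comp_def)
    have sg: "smooth_on ?R (\<lambda>t. g (inv_into U c (of_real t)))"
      using g c(1) by (auto simp: smooth_bdry_fun_def)
    obtain D where "((\<lambda>t. g (inv_into U c (of_real t))) has_derivative D) (at (Re (c ?p)) within ?R)"
      by (rule smooth_on_has_derivative[OF sg R(2)])
    then have "(\<lambda>t. g (inv_into U c (of_real t))) differentiable (at (Re (c ?p)))"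
      unfolding at_within_open[OF R(2,1)] by (rule differentiableI)
    then obtain e where "((\<lambda>t. g (inv_into U c (of_real t))) has_vector_derivative e) (at (Re (c ?p)))"
      using vector_derivative_works by blast
    then have "((\<lambda>t. g (inv_into U c (of_real t))) has_vector_derivative k *\<^sub>R ((1 / k) *\<^sub>R e)) (at (Re (c ?p)))"
      using k0 by simp
    then show thesis using 1 c that by blast
  qed
  have uniq: "v' = v" if "?Q v'" for v'
  proof -
    have "((\<lambda>t. g (x t)) has_vector_derivative v') (at t0)" using that chain by blast
    moreover have "((\<lambda>t. g (x t)) has_vector_derivative v) (at t0)" using v chain by blast
    ultimately show ?thesis by (rule vector_derivative_unique_at)
  qed
  have "arc_deriv M g ?p = v"
    unfolding arc_deriv_def by (rule the_equality[where P = ?Q, OF v uniq])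
  then show ?thesis using v chain by blast
qed

lemma unit_speed_curve_smooth:
  assumes x: "smooth_into M UNIV x" and r: "range x \<subseteq> bdry M"
    and d: "\<And>t. (imm M \<circ> x has_vector_derivative bdry_tangent M (x t)) (at t)"
  shows "unit_speed_curve x"
proof -
  have cont: "continuous_on UNIV x" using x by (simp add: smooth_into_def)
  have "(\<lambda>t. c (x t)) differentiable (at t)" if c: "(U, c) \<in> charts M" "x t \<in> U" for U c t
  proof -
    let ?V = "{t. x t \<in> U}"
    have V: "open ?V" "t \<in> ?V" using preimage_open[OF c(1) cont] r bdry_subset c(2) by auto
    have "smooth_on ?V (\<lambda>t. c (x t))" using x c(1) by (auto simp: smooth_into_def comp_def)
    then obtain D where "((\<lambda>t. c (x t)) has_derivative D) (at t within ?V)"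
      by (rule smooth_on_has_derivative[OF _ V(2)])
    then show ?thesis unfolding at_within_open[OF V(2,1)] by (rule differentiableI)
  qed
  then show ?thesis using cont r d by (auto simp: unit_speed_curve_def)
qed

lemma unit_speed_curve_arclength_diffeo:
  assumes "arclength_diffeo M \<gamma>"
  shows "unit_speed_curve (\<lambda>t. \<gamma> (cis t))"
proof (rule unit_speed_curve_smooth)
  show "range (\<lambda>t. \<gamma> (cis t)) \<subseteq> bdry M"
    using assms by (force simp: arclength_diffeo_def bij_betw_def)
qed (use assms in \<open>auto simp: arclength_diffeo_def comp_def\<close>)

lemma unit_speed_curve_arclength_param:
  assumes "arclength_param M g L"
  shows "unit_speed_curve g"
  by (rule unit_speed_curve_smooth) (use assms in \<open>auto simp: arclength_param_def\<close>)

lemma unit_speed_curve_reparametrized: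
  assumes \<Theta>: "\<And>s. (\<Theta> has_real_derivative 1 / cmod (\<Phi>' (cis (\<Theta> s)))) (at s)"
  shows "unit_speed_curve (\<lambda>s. \<Phi> (cis (\<Theta> s)))"
proof -
  let ?x = "\<lambda>s. \<Phi> (cis (\<Theta> s))"
  have cisd: "((\<lambda>s. cis (\<Theta> s)) has_vector_derivative
      (1 / cmod (\<Phi>' (cis (\<Theta> s)))) *\<^sub>R (\<i> * cis (\<Theta> s))) (at s)" for s
    by (rule cis_compose_vector_derivative[OF \<Theta>])
  have comp: "((\<lambda>s. F (cis (\<Theta> s))) has_derivative (\<lambda>h. D (h *\<^sub>R (1 / cmod (\<Phi>' (cis (\<Theta> s)))) *\<^sub>R (\<i> * cis (\<Theta> s))))) (at s)"
    if D: "(F has_derivative D) (at (cis (\<Theta> s)) within cball 0 1)" for F :: "complex \<Rightarrow> complex" and D s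
  proof -
    have "(F has_derivative D) (at (cis (\<Theta> s)) within (\<lambda>s. cis (\<Theta> s)) ` UNIV)"
      by (rule has_derivative_subset[OF D]) auto
    from has_derivative_in_compose[OF cisd[unfolded has_vector_derivative_def] this]
    show ?thesis .
  qed
  have "continuous_on UNIV \<Theta>"
    using \<Theta> by (meson DERIV_isCont continuous_at_imp_continuous_on)
  then have "continuous_on UNIV ?x"
    by (intro continuous_on_compose2[OF continuous_\<Phi>] continuous_intros) auto
  moreover have "range ?x \<subseteq> bdry M" using \<Phi>_bdry by auto
  moreover have "(\<lambda>s. c (?x s)) differentiable (at s)" if c: "(U, c) \<in> charts M" "?x s \<in> U" for U c s
  proof -
    obtain C where "((\<lambda>x. c (\<Phi> x)) has_derivative C) (at (cis (\<Theta> s)) within cball 0 1)"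
      by (rule chart_\<Phi>_derivative[OF c(1) _ c(2)]) simp
    from comp[OF this] show ?thesis by (rule differentiableI)
  qed
  moreover have "(imm M \<circ> ?x has_vector_derivative bdry_tangent M (?x s)) (at s)" for s
  proof -
    have "(imm M \<circ> \<Phi> has_derivative (*) (\<Phi>' (cis (\<Theta> s)))) (at (cis (\<Theta> s)) within cball 0 1)"
      using der[of "cis (\<Theta> s)"] by (simp add: has_field_derivative_def)
    from comp[OF this] show ?thesis
      by (simp add: has_vector_derivative_def comp_def bdry_tangent_eq scaleR_conv_of_real mult_ac)
  qed
  ultimately show ?thesis by (auto simp: unit_speed_curve_def)
qed

text \<open>
  Along \<open>\<gamma>\<close> itself the parameter \<open>\<gamma>\<^sup>-\<^sup>1\<close> has arc derivative \<open>\<i> \<gamma>\<^sup>-\<^sup>1\<close>. Hence \<open>b = \<gamma>\<^sup>-\<^sup>1 \<circ> x\<close>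
  satisfies \<open>b' = \<i> b\<close>, that is, \<open>b t = b 0 cis t\<close>.
\<close>

lemma unit_speed_curve_rotation:
  assumes \<gamma>: "arclength_diffeo M \<gamma>" and x: "unit_speed_curve x"
  obtains a where "\<And>t. x t = \<gamma> (cis (t + a))"
proof -
  let ?\<beta> = "inv_into (sphere 0 1) \<gamma>"
  have bij: "bij_betw \<gamma> (sphere 0 1) (bdry M)" and \<beta>: "smooth_bdry_fun M ?\<beta>"
    using \<gamma> by (auto simp: arclength_diffeo_def)
  have \<beta>\<gamma>: "?\<beta> (\<gamma> (cis t)) = cis t" for t
    using bij by (simp add: bij_betw_inv_into_left)
  have \<gamma>\<beta>: "\<gamma> (?\<beta> p) = p" "?\<beta> p \<in> sphere 0 1" if "p \<in> bdry M" for p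
    using bij that bij_betw_inv_into_right[OF bij that] inv_into_into[of p \<gamma> "sphere 0 1"]
    by (auto simp: bij_betw_def)
  have ad: "arc_deriv M ?\<beta> p = \<i> * ?\<beta> p" if p: "p \<in> bdry M" for p
  proof -
    obtain t where t: "?\<beta> p = cis t" using unit_circle_cis \<gamma>\<beta>(2)[OF p] by (metis mem_sphere_0)
    then have pt: "p = \<gamma> (cis t)" using \<gamma>\<beta>(1)[OF p] by simp
    have "(cis has_vector_derivative arc_deriv M ?\<beta> p) (at t)"
      using arc_deriv_along[OF unit_speed_curve_arclength_diffeo[OF \<gamma>] \<beta>, of t] \<beta>\<gamma> pt by simp
    then show ?thesis using vector_derivative_unique_at[OF _ cis_vector_derivative] t by metis
  qed
  define b where "b = (\<lambda>t. ?\<beta> (x t))"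
  have xb: "x t \<in> bdry M" for t using x by (auto simp: unit_speed_curve_def)
  have b': "(b has_vector_derivative \<i> * b t) (at t)" for t
    using arc_deriv_along[OF x \<beta>, of t] ad[OF xb] by (simp add: b_def)
  have c': "((\<lambda>t. cis (- t)) has_vector_derivative - \<i> * cis (- t)) (at t)" for t
    using cis_has_vector_derivative[of "- 1" 0 t UNIV] by simp
  have "((\<lambda>t. b t * cis (- t)) has_vector_derivative 0) (at t within UNIV)" for t
    using has_vector_derivative_mult[OF b' c'] by (simp add: algebra_simps)
  then obtain k where k: "\<And>t. b t * cis (- t) = k"
    using has_vector_derivative_zero_constant[of UNIV "\<lambda>t. b t * cis (- t)"] by auto
  have "cmod k = 1" using k[of 0] \<gamma>\<beta>(2)[OF xb[of 0]] by (simp add: b_def)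
  then obtain a where a: "k = cis a" using unit_circle_cis by blast
  have "b t = cis (t + a)" for t
  proof -
    have "b t = (b t * cis (- t)) * cis t" by (simp add: mult.assoc cis_mult)
    then show ?thesis using k[of t] a by (simp add: cis_mult add.commute)
  qed
  then have "x t = \<gamma> (cis (t + a))" for t
    using \<gamma>\<beta>(1)[OF xb[of t]] by (simp add: b_def)
  then show thesis using that by blast
qed

text \<open>
  Any arc-length parametrization is \<open>\<gamma> (cis (t + a))\<close>, and injectivity on \<open>{0..<L}\<close> forces the period
  \<open>L = 2 \<pi>\<close>; a shift of a periodic integrand does not change its integral.
\<close>

lemma bdry_integral_eq:
  assumes \<gamma>: "arclength_diffeo M \<gamma>" and f: "continuous_on UNIV (\<lambda>t. f (\<gamma> (cis t)))"
  shows "bdry_integral M f = integral {0..2 * pi} (\<lambda>t. f (\<gamma> (cis t)))"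
proof -
  have bij: "bij_betw \<gamma> (sphere 0 1) (bdry M)" using \<gamma> by (auto simp: arclength_diffeo_def)
  then have inj: "\<gamma> (cis s) = \<gamma> (cis t) \<longleftrightarrow> cis s = cis t" for s t
    by (auto simp: bij_betw_def inj_on_eq_iff)
  have inj2: "inj_on (\<lambda>t. \<gamma> (cis t)) {0..<2 * pi}"
  proof (rule inj_onI)
    fix s t assume st: "s \<in> {0..<2 * pi}" "t \<in> {0..<2 * pi}" "\<gamma> (cis s) = \<gamma> (cis t)"
    then have "cis (s - t) = 1" unfolding inj by (simp flip: cis_divide)
    then obtain k :: int where k: "s - t = 2 * pi * of_int k" using cis_eq_1_iff by blast
    have "\<bar>2 * pi * of_int k\<bar> < 2 * pi * 1" using st k[symmetric] by auto
    then have "\<bar>of_int k\<bar> < (1::real)" by (simp add: abs_mult)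
    then have "k = 0" by linarith
    then show "s = t" using k by simp
  qed
  have rng: "range (\<lambda>t. \<gamma> (cis t)) = bdry M"
  proof -
    have "range cis = sphere 0 1" using unit_circle_cis by (auto simp: image_iff)
    then show ?thesis using bij by (metis bij_betw_imp_surj_on image_image)
  qed
  have par: "arclength_param M (\<lambda>t. \<gamma> (cis t)) (2 * pi)"
    using \<gamma> rng inj2 by (auto simp: arclength_param_def arclength_diffeo_def comp_def simp flip: cis_mult)
  show ?thesis
    unfolding bdry_integral_def
  proof (rule the_equality)
    show "\<exists>g L. arclength_param M g L \<and> integral {0..2 * pi} (\<lambda>t. f (\<gamma> (cis t))) = integral {0..L} (f \<circ> g)"
      using par by (intro exI[of _ "\<lambda>t. \<gamma> (cis t)"] exI[of _ "2 * pi"]) (simp add: comp_def)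
  next
    fix I assume "\<exists>g L. arclength_param M g L \<and> I = integral {0..L} (f \<circ> g)"
    then obtain g L where g: "arclength_param M g L" and I: "I = integral {0..L} (f \<circ> g)" by blast
    obtain a where a: "\<And>t. g t = \<gamma> (cis (t + a))"
      by (rule unit_speed_curve_rotation[OF \<gamma> unit_speed_curve_arclength_param[OF g]]) (rule that, blast)
    have L: "L > 0" "g (0 + L) = g 0" "inj_on g {0..<L}" using g unfolding arclength_param_def by blast+
    have "cis (L + a) = cis (0 + a)" using L(2) unfolding a inj by simp
    then have "cis L = 1" by (simp flip: cis_mult)
    then obtain k :: int where k: "L = 2 * pi * of_int k" using cis_eq_1_iff by blast
    have kpos: "k \<ge> 1" using L(1) unfolding k by (simp add: zero_less_mult_iff)
    have "k = 1"
    proof (rule ccontr)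
      assume "k \<noteq> 1"
      then have "of_int k > (1::real)" using kpos by simp
      then have "2 * pi < L" unfolding k by simp
      moreover have "g (2 * pi) = g 0" unfolding a by (simp flip: cis_mult)
      ultimately have "2 * pi = (0::real)" using L(1,3) by (intro inj_onD[OF L(3)]) auto
      then show False by simp
    qed
    then have L2: "L = 2 * pi" using k by simp
    let ?F = "\<lambda>t. f (\<gamma> (cis t))"
    have "(?F has_integral integral {0..2 * pi} ?F) {0..0 + 2 * pi}"
      using f by (auto intro!: integrable_integral integrable_continuous_interval intro: continuous_on_subset)
    from integral_periodic_shift[OF _ _ this, of a]
    have "(?F has_integral integral {0..2 * pi} ?F) {a..a + 2 * pi}"
      by (simp flip: cis_mult)
    from has_integral_shift_real_ivl[OF this, of a]
    have "((\<lambda>t. ?F (t + a)) has_integral integral {0..2 * pi} ?F) {0..2 * pi}" by simp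
    then show "I = integral {0..2 * pi} ?F"
      unfolding I L2 using a by (simp add: comp_def integral_unique)
  qed
qed

lemma smooth_bdry_fun_cong:
  assumes "smooth_bdry_fun M f" and "\<And>p. p \<in> bdry M \<Longrightarrow> f p = g p"
  shows "smooth_bdry_fun M g"
  unfolding smooth_bdry_fun_def
proof clarify
  fix U c assume c: "(U, c) \<in> charts M"
  have "smooth_on {t::real. of_real t \<in> c ` U} (\<lambda>t. f (inv_into U c (of_real t)))"
    using assms(1) c by (auto simp: smooth_bdry_fun_def)
  then show "smooth_on {t::real. of_real t \<in> c ` U} (\<lambda>t. g (inv_into U c (of_real t)))"
    by (rule smooth_on_cong) (use assms(2) bdry_chart_inv[OF c] in auto)
qed

text \<open>
  A primitive is unique up to a constant because the boundary is a single unit speed curve, and the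
  condition of mean zero fixes the constant. Restriction to the boundary makes the function extensional.
\<close>

lemma bdry_D_inv_eq:
  assumes \<gamma>: "arclength_diffeo M \<gamma>" and g: "smooth_bdry_fun M g"
    and D: "\<And>p. p \<in> bdry M \<Longrightarrow> bdry_D M g p = f p"
  obtains C where "\<And>p. p \<in> bdry M \<Longrightarrow> bdry_D_inv M f p = g p + C"
proof -
  have bij: "bij_betw \<gamma> (sphere 0 1) (bdry M)" using \<gamma> by (auto simp: arclength_diffeo_def)
  note usc = unit_speed_curve_arclength_diffeo[OF \<gamma>]
  have \<gamma>b: "\<gamma> (cis t) \<in> bdry M" for t using bij by (auto simp: bij_betw_def)
  have ex: "\<exists>t. p = \<gamma> (cis t)" if "p \<in> bdry M" for p
    using bij that unit_circle_cis by (force simp: bij_betw_def)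
  have cont: "continuous_on UNIV (\<lambda>t. h (\<gamma> (cis t)))" if "smooth_bdry_fun M h" for h
    using arc_deriv_along[OF usc that]
    by (meson continuous_at_imp_continuous_on has_vector_derivative_continuous)
  \<comment> \<open>minus the mean of \<open>g\<close>\<close>
  define C where "C = - (integral {0..2 * pi} (\<lambda>t. g (\<gamma> (cis t))) / (2 * of_real pi))"
  define G where "G = restrict (\<lambda>p. g p + C) (bdry M)"
  have Geq: "G p = g p + C" if "p \<in> bdry M" for p using that by (simp add: G_def)
  have "smooth_bdry_fun M (\<lambda>p. g p + C)"
    using g unfolding smooth_bdry_fun_def by (auto intro!: smooth_on_add smooth_on_const)
  then have Gs: "smooth_bdry_fun M G" by (rule smooth_bdry_fun_cong) (simp add: Geq)
  have int_G: "integral {0..2 * pi} (\<lambda>t. G (\<gamma> (cis t))) = 0"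
  proof -
    have "integral {0..2 * pi} (\<lambda>t. G (\<gamma> (cis t))) = integral {0..2 * pi} (\<lambda>t. g (\<gamma> (cis t)) + C)"
      using Geq \<gamma>b by simp
    also have "\<dots> = integral {0..2 * pi} (\<lambda>t. g (\<gamma> (cis t))) + integral {0..2 * pi} (\<lambda>t. C)"
      by (intro integral_add integrable_continuous_interval continuous_intros continuous_on_subset[OF cont[OF g]]) auto
    also have "\<dots> = 0" by (simp add: C_def scaleR_conv_of_real)
    finally show ?thesis .
  qed
  have Gm: "mean_zero_bdry_fun M G"
    using Gs bdry_integral_eq[OF \<gamma> cont[OF Gs]] int_G by (simp add: mean_zero_bdry_fun_def)
  have GD: "bdry_D M G p = f p" if p: "p \<in> bdry M" for p
  proof -
    obtain t where t: "p = \<gamma> (cis t)" using ex[OF p] by blast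
    have "((\<lambda>t. G (\<gamma> (cis t))) has_vector_derivative arc_deriv M G p) (at t)"
      using arc_deriv_along[OF usc Gs, of t] t by simp
    moreover have "((\<lambda>t. G (\<gamma> (cis t))) has_vector_derivative arc_deriv M g p) (at t)"
      using arc_deriv_along[OF usc g, of t] t \<gamma>b by (simp add: Geq has_vector_derivative_add_const)
    ultimately have "arc_deriv M G p = arc_deriv M g p" by (rule vector_derivative_unique_at)
    then show ?thesis using D[OF p] by (simp add: bdry_D_def)
  qed
  have "bdry_D_inv M f = G"
    unfolding bdry_D_inv_def
  proof (rule the_equality)
    show "G \<in> extensional (bdry M) \<and> mean_zero_bdry_fun M G \<and> (\<forall>p\<in>bdry M. bdry_D M G p = f p)"
      using Gm GD by (auto simp: G_def)
  next
    fix h assume h: "h \<in> extensional (bdry M) \<and> mean_zero_bdry_fun M h \<and> (\<forall>p\<in>bdry M. bdry_D M h p = f p)"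
    then have hs: "smooth_bdry_fun M h" by (simp add: mean_zero_bdry_fun_def)
    have "((\<lambda>t. h (\<gamma> (cis t)) - G (\<gamma> (cis t))) has_vector_derivative 0) (at t within UNIV)" for t
    proof -
      have "bdry_D M h (\<gamma> (cis t)) = bdry_D M G (\<gamma> (cis t))" using h GD[OF \<gamma>b] \<gamma>b by simp
      then have "arc_deriv M h (\<gamma> (cis t)) = arc_deriv M G (\<gamma> (cis t))" by (simp add: bdry_D_def)
      then show ?thesis
        using has_vector_derivative_diff[OF arc_deriv_along[OF usc hs, of t] arc_deriv_along[OF usc Gs, of t]]
        by simp
    qed
    then obtain k where k: "\<And>t. h (\<gamma> (cis t)) - G (\<gamma> (cis t)) = k"
      using has_vector_derivative_zero_constant[of UNIV "\<lambda>t. h (\<gamma> (cis t)) - G (\<gamma> (cis t))"] by auto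
    have "0 = integral {0..2 * pi} (\<lambda>t. h (\<gamma> (cis t)))"
      using h bdry_integral_eq[OF \<gamma> cont[OF hs]] by (simp add: mean_zero_bdry_fun_def)
    also have "\<dots> = integral {0..2 * pi} (\<lambda>t. G (\<gamma> (cis t)) + k)"
      by (rule integral_cong) (metis k add.commute diff_add_cancel)
    also have "\<dots> = integral {0..2 * pi} (\<lambda>t. G (\<gamma> (cis t))) + integral {0..2 * pi} (\<lambda>t. k)"
      by (intro integral_add integrable_continuous_interval continuous_intros continuous_on_subset[OF cont[OF Gs]]) auto
    also have "\<dots> = 2 * of_real pi * k" using int_G by (simp add: scaleR_conv_of_real)
    finally have "k = 0" by simp
    then have eq: "h p = G p" if "p \<in> bdry M" for p using k ex[OF that] by force
    show "h = G"
      by (rule extensionalityI[of _ "bdry M"]) (use h eq in \<open>auto simp: G_def\<close>)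
  qed
  then show thesis using that Geq by simp
qed

end

section \<open>The Dirichlet problem\<close>

context disk_surface
begin

lemma \<Phi>'_field_differentiable:
  assumes "z \<in> ball 0 1"
  obtains d where "(\<Phi>' has_field_derivative d) (at z)"
proof -
  let ?F = "imm M \<circ> \<Phi>"
  have hol: "?F holomorphic_on ball 0 1" using bih by (simp add: disk_biholomorphism_def)
  have eq: "deriv ?F x = \<Phi>' x" if x: "x \<in> ball 0 1" for x
  proof -
    have "(?F has_field_derivative \<Phi>' x) (at x within ball 0 1)"
      using der[of x] x ball_subset_cball has_field_derivative_subset by (meson subsetD)
    then show ?thesis unfolding at_within_open[OF x open_ball] by (rule DERIV_imp_deriv)
  qed
  have "deriv ?F holomorphic_on ball 0 1" by (rule holomorphic_deriv[OF hol open_ball])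
  then have "\<Phi>' holomorphic_on ball 0 1" by (rule holomorphic_transform) (rule eq)
  then show thesis using assms that by (metis holomorphic_derivI open_ball)
qed

lemma analytic_sum_has_derivative:
  assumes "(\<alpha> has_field_derivative a) (at z within S)" and "(\<beta> has_field_derivative b) (at z within S)"
  shows "((\<lambda>x. \<alpha> x + cnj (\<beta> x)) has_derivative (\<lambda>h. a * h + cnj (b * h))) (at z within S)"
  using assms unfolding has_field_derivative_def by (intro has_derivative_add has_derivative_cnj)

lemma planar_differential_analytic_sum:
  assumes z: "z \<in> cball 0 1" and u: "\<And>x. x \<in> cball 0 1 \<Longrightarrow> u (\<Phi> x) = \<alpha> x + cnj (\<beta> x)"
    and "(\<alpha> has_field_derivative a) (at z within cball 0 1)"
    and "(\<beta> has_field_derivative b) (at z within cball 0 1)"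
  shows "planar_differential M u (\<Phi> z) h = a * (h / \<Phi>' z) + cnj (b * (h / \<Phi>' z))"
  using planar_differential_eq[OF z u analytic_sum_has_derivative[OF assms(3,4)]] by simp

lemma interior_point_in_ball:
  assumes "p \<in> pts M - bdry M"
  obtains z where "z \<in> ball 0 1" and "p = \<Phi> z"
proof -
  have "cmod (\<Psi> p) \<noteq> 1" "p \<in> pts M" using assms bdry_iff by blast+
  then have "\<Psi> p \<in> ball 0 1" using \<Psi>_in[of p] by auto
  then show thesis using that[of "\<Psi> p"] \<open>p \<in> pts M\<close> by simp
qed

lemma interior_image:
  assumes "z \<in> ball 0 1"
  shows "\<Phi> z \<in> pts M - bdry M"
proof -
  have "z \<in> cball 0 1" "cmod z \<noteq> 1" using assms by auto
  then show ?thesis using \<Phi>_in[of z] bdry_iff[of "\<Phi> z"] by simp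
qed

text \<open>
  Since \<open>imm \<circ> \<Phi>\<close> is holomorphic, sums of analytic and antianalytic functions of the disk parameter are
  harmonic on the surface: the derivative along \<open>\<i>\<close> applied twice is minus the derivative along \<open>1\<close>
  applied twice.
\<close>

lemma laplacian_analytic_sum:
  assumes z: "z \<in> ball 0 1" and u: "\<And>x. x \<in> cball 0 1 \<Longrightarrow> u (\<Phi> x) = \<alpha> x + cnj (\<beta> x)"
    and \<alpha>: "\<And>x. x \<in> cball 0 1 \<Longrightarrow> (\<alpha> has_field_derivative \<alpha>' x) (at x within cball 0 1)"
    and \<beta>: "\<And>x. x \<in> cball 0 1 \<Longrightarrow> (\<beta> has_field_derivative \<beta>' x) (at x within cball 0 1)"
    and \<alpha>': "(\<alpha>' has_field_derivative \<alpha>'') (at z within cball 0 1)"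
    and \<beta>': "(\<beta>' has_field_derivative \<beta>'') (at z within cball 0 1)"
  shows "laplacian M u (\<Phi> z) = 0"
proof -
  have zc: "z \<in> cball 0 1" using z by simp
  obtain d where "(\<Phi>' has_field_derivative d) (at z)" by (rule \<Phi>'_field_differentiable[OF z])
  then have d: "(\<Phi>' has_field_derivative d) (at z within cball 0 1)"
    by (rule has_field_derivative_at_within)
  have pd: "planar_differential M u (\<Phi> x) h = h * (\<alpha>' x / \<Phi>' x) + cnj (h * (\<beta>' x / \<Phi>' x))"
    if "x \<in> cball 0 1" for x h
    using planar_differential_analytic_sum[OF that u \<alpha>[OF that] \<beta>[OF that], of h]
    by (simp add: mult_ac)
  obtain a b where
    a: "((\<lambda>x. \<alpha>' x / \<Phi>' x) has_field_derivative a) (at z within cball 0 1)" and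
    b: "((\<lambda>x. \<beta>' x / \<Phi>' x) has_field_derivative b) (at z within cball 0 1)"
    using DERIV_divide[OF \<alpha>' d \<Phi>'_nonzero[OF zc]] DERIV_divide[OF \<beta>' d \<Phi>'_nonzero[OF zc]] by blast
  have "planar_differential M (\<lambda>q. planar_differential M u q k) (\<Phi> z) h =
      (k * a) * (h / \<Phi>' z) + cnj ((k * b) * (h / \<Phi>' z))" for k h
    by (rule planar_differential_analytic_sum[OF zc pd DERIV_cmult[OF a] DERIV_cmult[OF b]])
  then show ?thesis by (simp add: laplacian_def field_simps)
qed

lemma pullback_regularity:
  assumes u: "smooth_fun M u"
  shows "continuous_on (cball 0 1) (\<lambda>x. u (\<Phi> x))"
    and "(U, c) \<in> charts M \<Longrightarrow> smooth_on {x \<in> cball 0 1. \<Phi> x \<in> U} (\<lambda>x. u (\<Phi> x))"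
proof -
  show sm: "smooth_on {x \<in> cball 0 1. \<Phi> x \<in> U} (\<lambda>x. u (\<Phi> x))" if c: "(U, c) \<in> charts M" for U c
  proof -
    have "smooth_on (c ` U) (u \<circ> inv_into U c)" using u c by (auto simp: smooth_fun_def)
    then have "smooth_on {x \<in> cball 0 1. \<Phi> x \<in> U} (\<lambda>x. (u \<circ> inv_into U c) (c (\<Phi> x)))"
      by (rule smooth_on_compose[OF _ smooth_chart_\<Phi>[OF c]]) auto
    then show ?thesis by (rule smooth_on_cong) (use c in auto)
  qed
  show "continuous_on (cball 0 1) (\<lambda>x. u (\<Phi> x))"
    unfolding continuous_on_eq_continuous_within
  proof
    fix z :: complex assume z: "z \<in> cball 0 1"
    obtain U c where c: "(U, c) \<in> charts M" "\<Phi> z \<in> U" by (rule chart_exists[OF \<Phi>_in[OF z]])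
    have zN: "z \<in> {x \<in> cball 0 1. \<Phi> x \<in> U}" using z c by simp
    have "continuous (at z within {x \<in> cball 0 1. \<Phi> x \<in> U}) (\<lambda>x. u (\<Phi> x))"
      using smooth_on_continuous[OF sm[OF c(1)]] zN continuous_on_eq_continuous_within by blast
    then show "continuous (at z within cball 0 1) (\<lambda>x. u (\<Phi> x))"
      unfolding at_within_openin[OF preimage_openin[OF c(1)] zN] .
  qed
qed

text \<open>
  Conversely the Laplacian of the surface is \<open>1 / \<bar>\<Phi>'\<bar>\<^sup>2\<close> times the Laplacian in the disk parameter. With
  \<open>r = 1 / \<Phi>'\<close>, the first order terms cancel by the Cauchy-Riemann equations of \<open>r\<close>, and each of the two
  mixed second derivatives occurs twice with opposite signs.
\<close>

lemma harmonic_pullback: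
  assumes u: "smooth_fun M u" and lap: "\<And>p. p \<in> pts M - bdry M \<Longrightarrow> laplacian M u p = 0"
  obtains f' where "\<And>z. z \<in> ball 0 1 \<Longrightarrow> ((\<lambda>x. u (\<Phi> x)) has_derivative f' z) (at z)"
    and "\<And>z. z \<in> ball 0 1 \<Longrightarrow> zero_divergence_at f' z"
proof
  let ?v = "\<lambda>x. u (\<Phi> x)"
  define f' where "f' = (\<lambda>z. frechet_derivative ?v (at z))"
  have loc: "\<exists>N g. open N \<and> z \<in> N \<and> N \<subseteq> ball 0 1 \<and> (\<forall>x\<in>N. (?v has_derivative g x) (at x)) \<and>
      (\<forall>h. Ck_on 1 N (\<lambda>x. g x h))" if z: "z \<in> ball 0 1" for z
  proof -
    have zc: "z \<in> cball 0 1" using z by simp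
    obtain U c where c: "(U, c) \<in> charts M" "\<Phi> z \<in> U" by (rule chart_exists[OF \<Phi>_in[OF zc]])
    obtain T where T: "open T" "{x \<in> cball 0 1. \<Phi> x \<in> U} = cball 0 1 \<inter> T"
      using preimage_openin[OF c(1)] by (auto simp: openin_open)
    let ?N = "ball 0 1 \<inter> T"
    have zT: "z \<in> T" using T(2) zc c(2) by blast
    have N: "open ?N" "z \<in> ?N" using T(1) z zT by auto
    have sub: "?N \<subseteq> {x \<in> cball 0 1. \<Phi> x \<in> U}" unfolding T(2) by auto
    have "Ck_on (Suc 1) ?N ?v"
      using smooth_on_subset[OF pullback_regularity(2)[OF u c(1)] sub] unfolding smooth_on_def by blast
    then obtain g where g: "\<forall>x\<in>?N. (?v has_derivative g x) (at x within ?N)" "\<forall>h. Ck_on 1 ?N (\<lambda>x. g x h)"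
      unfolding Ck_on.simps(2)[of 1] by blast
    have "(?v has_derivative g x) (at x)" if "x \<in> ?N" for x
      using g(1) that at_within_open[OF that N(1)] by metis
    then show ?thesis using N g(2) by (intro exI[of _ ?N] exI[of _ g]) auto
  qed
  show d1: "(?v has_derivative f' z) (at z)" if "z \<in> ball 0 1" for z
    using loc[OF that] frechet_derivative_works unfolding f'_def differentiable_def by blast
  fix z :: complex assume z: "z \<in> ball 0 1"
  then have zc: "z \<in> cball 0 1" by simp
  obtain N g where N: "open N" "z \<in> N" "N \<subseteq> ball 0 1"
    and g: "\<And>x. x \<in> N \<Longrightarrow> (?v has_derivative g x) (at x)" "\<And>h. Ck_on 1 N (\<lambda>x. g x h)"
    using loc[OF z] by blast
  have fg: "f' x = g x" if "x \<in> N" for x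
    using has_derivative_unique[OF d1 g(1)[OF that]] that N(3) by blast
  have d2: "\<exists>D. ((\<lambda>x. f' x h) has_derivative D) (at z)" for h
  proof -
    have "Ck_on (Suc 0) N (\<lambda>x. g x h)" using g(2)[of h] by simp
    then obtain D where "((\<lambda>x. g x h) has_derivative D) (at z within N)"
      unfolding Ck_on.simps(2)[of 0] using N(2) by blast
    then have "((\<lambda>x. g x h) has_derivative D) (at z)" unfolding at_within_open[OF N(2,1)] .
    then have "((\<lambda>x. f' x h) has_derivative D) (at z)"
      by (rule has_derivative_transform_within_open[OF _ N(1,2)]) (simp add: fg)
    then show ?thesis by blast
  qed
  obtain Dx where Dx: "((\<lambda>x. f' x 1) has_derivative Dx) (at z)" using d2 by blast
  obtain Dy where Dy: "((\<lambda>x. f' x \<i>) has_derivative Dy) (at z)" using d2 by blast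
  obtain d where d: "(\<Phi>' has_field_derivative d) (at z)" by (rule \<Phi>'_field_differentiable[OF z])
  define r where "r = (\<lambda>x. 1 / \<Phi>' x)"
  obtain r' where r': "(r has_field_derivative r') (at z)"
    unfolding r_def using DERIV_divide[OF DERIV_const d \<Phi>'_nonzero[OF zc]] by blast
  have r0: "r z \<noteq> 0" using \<Phi>'_nonzero[OF zc] by (simp add: r_def)
  have lin: "f' x h = Re h *\<^sub>R f' x 1 + Im h *\<^sub>R f' x \<i>" if "x \<in> ball 0 1" for x h
    by (rule linear_complex_expand[OF has_derivative_linear[OF d1[OF that]]])
  have pd: "planar_differential M u (\<Phi> x) h = f' x (h * r x)" if x: "x \<in> ball 0 1" for x h
  proof -
    have "(?v has_derivative f' x) (at x within cball 0 1)"
      by (rule has_derivative_at_withinI[OF d1[OF x]])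
    then show ?thesis using planar_differential_eq[of x u ?v "f' x"] x by (simp add: r_def)
  qed
  have rd: "((\<lambda>x. k * r x) has_derivative (\<lambda>h. k * (r' * h))) (at z)" for k
    using has_derivative_mult_right[OF r'[unfolded has_field_derivative_def], of k] .
  have second: "planar_differential M (\<lambda>q. planar_differential M u q k) (\<Phi> z) h =
      (let e = h * r z in
        Re (k * r z) *\<^sub>R Dx e + Re (k * (r' * e)) *\<^sub>R f' z 1
        + (Im (k * r z) *\<^sub>R Dy e + Im (k * (r' * e)) *\<^sub>R f' z \<i>))" for k h
  proof -
    have "((\<lambda>x. Re (k * r x) *\<^sub>R f' x 1 + Im (k * r x) *\<^sub>R f' x \<i>) has_derivative
        (\<lambda>e. Re (k * r z) *\<^sub>R Dx e + Re (k * (r' * e)) *\<^sub>R f' z 1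
          + (Im (k * r z) *\<^sub>R Dy e + Im (k * (r' * e)) *\<^sub>R f' z \<i>))) (at z)"
      by (intro has_derivative_add has_derivative_scaleR has_derivative_Re has_derivative_Im rd Dx Dy)
    then have "((\<lambda>x. planar_differential M u (\<Phi> x) k) has_derivative
        (\<lambda>e. Re (k * r z) *\<^sub>R Dx e + Re (k * (r' * e)) *\<^sub>R f' z 1
          + (Im (k * r z) *\<^sub>R Dy e + Im (k * (r' * e)) *\<^sub>R f' z \<i>))) (at z)"
    proof (rule has_derivative_transform_within_open[OF _ open_ball z])
      fix x :: complex assume x: "x \<in> ball 0 1"
      show "Re (k * r x) *\<^sub>R f' x 1 + Im (k * r x) *\<^sub>R f' x \<i> = planar_differential M u (\<Phi> x) k"
        unfolding pd[OF x] using lin[OF x, of "k * r x"] by simp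
    qed
    from planar_differential_eq[OF zc refl has_derivative_at_withinI[OF this]]
    have eq: "planar_differential M (\<lambda>q. planar_differential M u q k) (\<Phi> z) =
        (\<lambda>h. Re (k * r z) *\<^sub>R Dx (h / \<Phi>' z) + Re (k * (r' * (h / \<Phi>' z))) *\<^sub>R f' z 1
          + (Im (k * r z) *\<^sub>R Dy (h / \<Phi>' z) + Im (k * (r' * (h / \<Phi>' z))) *\<^sub>R f' z \<i>))" .
    have hr: "h * r z = h / \<Phi>' z" by (simp add: r_def)
    show ?thesis unfolding Let_def hr by (rule fun_cong[OF eq])
  qed
  have linx: "Dx e = Re e *\<^sub>R Dx 1 + Im e *\<^sub>R Dx \<i>" and liny: "Dy e = Re e *\<^sub>R Dy 1 + Im e *\<^sub>R Dy \<i>" for e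
    using linear_complex_expand has_derivative_linear Dx Dy by blast+
  have "laplacian M u (\<Phi> z) = (cmod (r z))\<^sup>2 *\<^sub>R (Dx 1 + Dy \<i>)"
    unfolding laplacian_def second Let_def linx[of "_ * r z"] liny[of "_ * r z"] cmod_power2
    by (simp add: scaleR_conv_of_real complex_eq_iff algebra_simps power2_eq_square)
  then have "Dx 1 + Dy \<i> = 0" using lap[OF interior_image[OF z]] r0 by simp
  then show "zero_divergence_at f' z"
    using Dx Dy unfolding zero_divergence_at_def by blast
qed

text \<open>
  The maximum principle is applied to the real function \<open>\<xi> \<bullet> (u - w)\<close> with \<open>\<xi>\<close> the value of \<open>u - w\<close> at
  the point in question.
\<close>

lemma dirichlet_unique:
  assumes u: "smooth_fun M u" "\<And>p. p \<in> pts M - bdry M \<Longrightarrow> laplacian M u p = 0"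
    and w: "smooth_fun M w" "\<And>p. p \<in> pts M - bdry M \<Longrightarrow> laplacian M w p = 0"
    and bd: "\<And>p. p \<in> bdry M \<Longrightarrow> u p = w p" and p: "p \<in> pts M"
  shows "u p = w p"
proof -
  obtain f' where f': "\<And>z. z \<in> ball 0 1 \<Longrightarrow> ((\<lambda>x. u (\<Phi> x)) has_derivative f' z) (at z)"
      "\<And>z. z \<in> ball 0 1 \<Longrightarrow> zero_divergence_at f' z"
    using harmonic_pullback[OF u] by metis
  obtain g' where g': "\<And>z. z \<in> ball 0 1 \<Longrightarrow> ((\<lambda>x. w (\<Phi> x)) has_derivative g' z) (at z)"
      "\<And>z. z \<in> ball 0 1 \<Longrightarrow> zero_divergence_at g' z"
    using harmonic_pullback[OF w] by metis
  define \<xi> where "\<xi> = u p - w p"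
  have "\<xi> \<bullet> (u (\<Phi> (\<Psi> p)) - w (\<Phi> (\<Psi> p))) \<le> 0"
  proof (rule disk_harmonic_nonpos[where v = "\<lambda>x. \<xi> \<bullet> (u (\<Phi> x) - w (\<Phi> x))" and f' = "\<lambda>z h. \<xi> \<bullet> (f' z h - g' z h)"])
    show "continuous_on (cball 0 1) (\<lambda>x. \<xi> \<bullet> (u (\<Phi> x) - w (\<Phi> x)))"
      by (intro continuous_intros pullback_regularity u w)
    show "\<xi> \<bullet> (u (\<Phi> z) - w (\<Phi> z)) \<le> 0" if "z \<in> sphere 0 1" for z
      using bd[OF \<Phi>_bdry] that by simp
    fix z :: complex assume z: "z \<in> ball 0 1"
    show "((\<lambda>x. \<xi> \<bullet> (u (\<Phi> x) - w (\<Phi> x))) has_derivative (\<lambda>h. \<xi> \<bullet> (f' z h - g' z h))) (at z)"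
      by (intro has_derivative_inner_right has_derivative_diff f' g' z)
    obtain Dx Dy where D: "((\<lambda>x. f' x 1) has_derivative Dx) (at z)"
        "((\<lambda>x. f' x \<i>) has_derivative Dy) (at z)" "Dx 1 + Dy \<i> = 0"
      using f'(2)[OF z] unfolding zero_divergence_at_def by blast
    obtain Ex Ey where E: "((\<lambda>x. g' x 1) has_derivative Ex) (at z)"
        "((\<lambda>x. g' x \<i>) has_derivative Ey) (at z)" "Ex 1 + Ey \<i> = 0"
      using g'(2)[OF z] unfolding zero_divergence_at_def by blast
    have "\<xi> \<bullet> (Dx 1 - Ex 1) + \<xi> \<bullet> (Dy \<i> - Ey \<i>) = \<xi> \<bullet> ((Dx 1 + Dy \<i>) - (Ex 1 + Ey \<i>))"
      by (simp add: inner_diff_right inner_add_right)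
    also have "\<dots> = 0" using D E by simp
    finally show "zero_divergence_at (\<lambda>z h. \<xi> \<bullet> (f' z h - g' z h)) z"
      unfolding zero_divergence_at_def
      by (intro exI[of _ "\<lambda>h. \<xi> \<bullet> (Dx h - Ex h)"] exI[of _ "\<lambda>h. \<xi> \<bullet> (Dy h - Ey h)"] conjI
          has_derivative_inner_right has_derivative_diff D(1,2) E(1,2))
  qed (rule \<Psi>_in[OF p])
  then have "\<xi> \<bullet> \<xi> \<le> 0" using p by (simp add: \<xi>_def)
  then have "\<xi> \<bullet> \<xi> = 0" using inner_ge_zero[of \<xi>] by linarith
  then have "\<xi> = 0" by (simp only: inner_eq_zero_iff)
  then show ?thesis by (simp add: \<xi>_def)
qed

lemma smooth_fun_parametrized:
  assumes v: "smooth_on (cball 0 1) v"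
  shows "smooth_fun M (\<lambda>p. v (\<Psi> p))"
  unfolding smooth_fun_def
proof clarify
  fix U c assume c: "(U, c) \<in> charts M"
  show "smooth_on (c ` U) ((\<lambda>p. v (\<Psi> p)) \<circ> inv_into U c)"
    unfolding comp_def using \<Psi>_chart_in[OF c]
    by (intro smooth_on_compose[OF v smooth_\<Psi>_chart[OF c]]) blast
qed

lemma smooth_bdry_fun_restrict:
  assumes u: "smooth_fun M u"
  shows "smooth_bdry_fun M u"
  unfolding smooth_bdry_fun_def
proof clarify
  fix U c assume c: "(U, c) \<in> charts M"
  have "smooth_on (c ` U) (\<lambda>w. u (inv_into U c w))" using u c by (auto simp: smooth_fun_def comp_def)
  then show "smooth_on {t::real. of_real t \<in> c ` U} (\<lambda>t. u (inv_into U c (of_real t)))"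
    by (rule smooth_on_compose) (auto intro: smooth_on_bounded_linear bounded_linear_of_real)
qed

lemma smooth_fun_cong:
  assumes "smooth_fun M u" and "\<And>p. p \<in> pts M \<Longrightarrow> u p = w p"
  shows "smooth_fun M w"
  unfolding smooth_fun_def
proof clarify
  fix U c assume c: "(U, c) \<in> charts M"
  have "smooth_on (c ` U) (u \<circ> inv_into U c)" using assms(1) c by (auto simp: smooth_fun_def)
  then show "smooth_on (c ` U) (w \<circ> inv_into U c)"
    by (rule smooth_on_cong) (use assms(2) chart_inv_in[OF c] chart_subset[OF c] in auto)
qed

lemma dirichlet_solution_eq:
  assumes a: "rapidly_decreasing a" and b: "rapidly_decreasing b"
    and f: "\<And>z. cmod z = 1 \<Longrightarrow> f (\<Phi> z) = pseries a z + cnj (pseries b z)"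
    and z: "z \<in> cball 0 1"
  shows "dirichlet_solution M f (\<Phi> z) = pseries a z + cnj (pseries b z)"
proof -
  define v where "v = (\<lambda>z. pseries a z + cnj (pseries b z))"
  define u where "u = restrict (\<lambda>p. v (\<Psi> p)) (pts M)"
  have u\<Phi>: "u (\<Phi> x) = pseries a x + cnj (pseries b x)" if "x \<in> cball 0 1" for x
    using that \<Phi>_in[OF that] by (simp add: u_def v_def)
  have "smooth_on (cball 0 1) (\<lambda>z. cnj (pseries b z))"
    using smooth_on_compose[OF smooth_on_bounded_linear[OF bounded_linear_cnj] smooth_on_pseries[OF b], of UNIV]
    by simp
  then have "smooth_on (cball 0 1) v" unfolding v_def by (intro smooth_on_add smooth_on_pseries a)
  then have us: "smooth_fun M u"
    by (rule smooth_fun_cong[OF smooth_fun_parametrized]) (simp add: u_def)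
  have ul: "laplacian M u p = 0" if p: "p \<in> pts M - bdry M" for p
  proof -
    obtain x where x: "x \<in> ball 0 1" "p = \<Phi> x" by (rule interior_point_in_ball[OF p])
    then have xc: "x \<in> cball 0 1" by simp
    show ?thesis unfolding x(2)
      by (rule laplacian_analytic_sum[OF x(1) u\<Phi> pseries_has_field_derivative[OF a]
            pseries_has_field_derivative[OF b]
            pseries_has_field_derivative[OF rapidly_decreasing_derived_coeffs[OF a] xc]
            pseries_has_field_derivative[OF rapidly_decreasing_derived_coeffs[OF b] xc]])
  qed
  have ub: "u p = f p" if "p \<in> bdry M" for p
    using that f[of "\<Psi> p"] u\<Phi>[of "\<Psi> p"] unfolding bdry_iff by simp
  have "dirichlet_solution M f = u"
    unfolding dirichlet_solution_def
  proof (rule the_equality)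
    show "u \<in> extensional (pts M) \<and> smooth_fun M u \<and>
        (\<forall>p \<in> pts M - bdry M. laplacian M u p = 0) \<and> (\<forall>p \<in> bdry M. u p = f p)"
      using us ul ub by (simp add: u_def)
  next
    fix w assume w: "w \<in> extensional (pts M) \<and> smooth_fun M w \<and>
        (\<forall>p \<in> pts M - bdry M. laplacian M w p = 0) \<and> (\<forall>p \<in> bdry M. w p = f p)"
    show "w = u"
    proof (rule extensionalityI[of _ "pts M"])
      show "w p = u p" if "p \<in> pts M" for p
        by (rule dirichlet_unique[OF _ _ us ul _ that]) (use w ub in auto)
    qed (use w in \<open>auto simp: u_def\<close>)
  qed
  then show ?thesis using u\<Phi>[OF z] by simp
qed

text \<open>
  Dividing the outer normal by \<open>\<Phi>'\<close> leaves the radial vector \<open>z\<close>, scaled by \<open>1 / \<bar>\<Phi>'\<bar>\<close>.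
\<close>

lemma DN_map_eq:
  assumes a: "rapidly_decreasing a" and b: "rapidly_decreasing b"
    and f: "\<And>z. cmod z = 1 \<Longrightarrow> f (\<Phi> z) = pseries a z + cnj (pseries b z)"
    and z: "cmod z = 1"
  shows "DN_map M f (\<Phi> z) =
    (z * pseries (derived_coeffs a) z + cnj (z * pseries (derived_coeffs b) z)) / of_real (cmod (\<Phi>' z))"
proof -
  have zc: "z \<in> cball 0 1" using z by simp
  have "outer_normal M (\<Phi> z) / \<Phi>' z = z / of_real (cmod (\<Phi>' z))"
    using \<Phi>'_nonzero[OF zc] by (simp add: outer_normal_eq[OF z])
  moreover have "DN_map M f (\<Phi> z) =
      pseries (derived_coeffs a) z * (outer_normal M (\<Phi> z) / \<Phi>' z)
      + cnj (pseries (derived_coeffs b) z * (outer_normal M (\<Phi> z) / \<Phi>' z))"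
    unfolding DN_map_def
    by (rule planar_differential_analytic_sum[OF zc _ pseries_has_field_derivative[OF a zc]
          pseries_has_field_derivative[OF b zc]]) (rule dirichlet_solution_eq[OF a b f])
  ultimately show ?thesis by (simp add: add_divide_distrib mult_ac)
qed

text \<open>
  The derivatives of \<open>\<alpha>\<close> and \<open>cnj \<beta>\<close> in the angle are \<open>\<i> z \<alpha>'\<close> and \<open>- \<i> cnj (z \<beta>')\<close>. Therefore \<open>D\<close>
  applied to \<open>\<alpha> - cnj \<beta>\<close> is the normal derivative of \<open>\<alpha> + cnj \<beta>\<close>, and the Hilbert transform
  changes the sign of the antianalytic part.
\<close>

lemma hilbert_bdry_eq:
  assumes \<gamma>: "arclength_diffeo M \<gamma>"
    and \<Theta>: "\<And>s. (\<Theta> has_real_derivative 1 / cmod (\<Phi>' (cis (\<Theta> s)))) (at s)"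
    and \<gamma>\<Theta>: "\<And>s. \<gamma> (cis s) = \<Phi> (cis (\<Theta> s))"
    and a: "rapidly_decreasing a" and b: "rapidly_decreasing b"
    and f: "\<And>z. cmod z = 1 \<Longrightarrow> f (\<Phi> z) = pseries a z + cnj (pseries b z)"
  obtains C where "\<And>s. hilbert_bdry M f (\<gamma> (cis s)) =
      pseries a (cis (\<Theta> s)) - cnj (pseries b (cis (\<Theta> s))) + C"
proof -
  define v where "v = (\<lambda>z. pseries a z + cnj (- pseries b z))"
  have v': "(v has_derivative (\<lambda>h. pseries (derived_coeffs a) z * h + cnj (- pseries (derived_coeffs b) z * h)))
      (at z within cball 0 1)" if "z \<in> cball 0 1" for z
    unfolding v_def
    by (intro analytic_sum_has_derivative pseries_has_field_derivative[OF a] DERIV_minus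
        pseries_has_field_derivative[OF b] that)
  define g where "g = (\<lambda>p. v (\<Psi> p))"
  have "bounded_linear (\<lambda>z. cnj (- z))"
    using bounded_linear_compose[OF bounded_linear_cnj bounded_linear_minus[OF bounded_linear_ident]] by simp
  then have "smooth_on (cball 0 1) (\<lambda>z. cnj (- pseries b z))"
    using smooth_on_compose[OF smooth_on_bounded_linear[of "\<lambda>z. cnj (- z)" UNIV] smooth_on_pseries[OF b]]
    by simp
  then have "smooth_on (cball 0 1) v" unfolding v_def by (intro smooth_on_add smooth_on_pseries a)
  then have gs: "smooth_bdry_fun M g"
    unfolding g_def by (intro smooth_bdry_fun_restrict smooth_fun_parametrized)
  note usc = unit_speed_curve_reparametrized[OF \<Theta>]
  have D: "bdry_D M g p = DN_map M f p" if p: "p \<in> bdry M" for p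
  proof -
    obtain s where s: "p = \<Phi> (cis (\<Theta> s))"
    proof -
      have "p \<in> \<gamma> ` sphere 0 1" using p \<gamma> by (auto simp: arclength_diffeo_def bij_betw_def)
      then obtain \<zeta> where "p = \<gamma> \<zeta>" "cmod \<zeta> = 1" by auto
      then obtain s where "p = \<gamma> (cis s)" using unit_circle_cis by blast
      then show thesis using that \<gamma>\<Theta> by simp
    qed
    let ?z = "cis (\<Theta> s)"
    let ?m = "cmod (\<Phi>' ?z)"
    have cisd: "((\<lambda>s. cis (\<Theta> s)) has_vector_derivative (1 / ?m) *\<^sub>R (\<i> * ?z)) (at s)"
      by (rule cis_compose_vector_derivative[OF \<Theta>])
    have "(v has_derivative (\<lambda>h. pseries (derived_coeffs a) ?z * h + cnj (- pseries (derived_coeffs b) ?z * h)))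
        (at ?z within range (\<lambda>s. cis (\<Theta> s)))"
      by (rule has_derivative_subset[OF v']) auto
    from has_derivative_in_compose[OF cisd[unfolded has_vector_derivative_def] this]
    have "((\<lambda>s. v (cis (\<Theta> s))) has_vector_derivative
        (pseries (derived_coeffs a) ?z * ((1 / ?m) *\<^sub>R (\<i> * ?z))
          + cnj (- pseries (derived_coeffs b) ?z * ((1 / ?m) *\<^sub>R (\<i> * ?z))))) (at s)"
      unfolding has_vector_derivative_def by (simp add: algebra_simps scaleR_conv_of_real)
    moreover have "((\<lambda>s. v (cis (\<Theta> s))) has_vector_derivative arc_deriv M g p) (at s)"
      using arc_deriv_along[OF usc gs, of s] s by (simp add: g_def)
    ultimately have "arc_deriv M g p = pseries (derived_coeffs a) ?z * ((1 / ?m) *\<^sub>R (\<i> * ?z))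
          + cnj (- pseries (derived_coeffs b) ?z * ((1 / ?m) *\<^sub>R (\<i> * ?z)))"
      using vector_derivative_unique_at by blast
    then have "bdry_D M g p = (?z * pseries (derived_coeffs a) ?z + cnj (?z * pseries (derived_coeffs b) ?z)) / of_real ?m"
      by (simp add: bdry_D_def scaleR_conv_of_real algebra_simps add_divide_distrib)
    then show ?thesis unfolding s using DN_map_eq[OF a b f, of ?z] by simp
  qed
  obtain C where C: "\<And>p. p \<in> bdry M \<Longrightarrow> bdry_D_inv M (DN_map M f) p = g p + C"
    by (rule bdry_D_inv_eq[OF \<gamma> gs]) (erule D, rule that, blast)
  have "hilbert_bdry M f (\<gamma> (cis s)) = pseries a (cis (\<Theta> s)) - cnj (pseries b (cis (\<Theta> s))) + C" for s
    using C[of "\<gamma> (cis s)"] \<Phi>_bdry[of "cis (\<Theta> s)"] unfolding \<gamma>\<Theta> hilbert_bdry_def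
    by (simp add: g_def v_def)
  then show thesis using that by blast
qed

end

section \<open>The principal value\<close>

lemma cot_half_eq:
  assumes "cis x \<noteq> 1"
  shows "\<i> * (cis x + 1) / (cis x - 1) = of_real (cot (x / 2))"
proof -
  define y where "y = x / 2"
  have c2: "cis x = cis y * cis y" by (simp add: y_def cis_mult)
  have inv: "cis y * cis (- y) = 1" by (simp add: cis_mult)
  have p: "cis x + 1 = cis y * (2 * of_real (cos y))"
  proof -
    have "cis x + 1 = cis y * (cis y + cis (- y))" by (simp add: c2 inv algebra_simps)
    also have "cis y + cis (- y) = 2 * of_real (cos y)" by (simp add: complex_eq_iff)
    finally show ?thesis .
  qed
  have m: "cis x - 1 = cis y * (2 * \<i> * of_real (sin y))"
  proof -
    have "cis x - 1 = cis y * (cis y - cis (- y))" by (simp add: c2 inv algebra_simps)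
    also have "cis y - cis (- y) = 2 * \<i> * of_real (sin y)" by (simp add: complex_eq_iff)
    finally show ?thesis .
  qed
  have "sin y \<noteq> 0" using assms m by auto
  then show ?thesis unfolding p m by (simp add: cot_def y_def[symmetric] field_simps)
qed

lemma circle_arc_iff:
  assumes "\<epsilon> > 0" and "\<sigma> \<in> {s..s + 2 * pi}"
  shows "(\<forall>k::int. \<epsilon> \<le> \<bar>\<sigma> - s - 2 * pi * of_int k\<bar>) \<longleftrightarrow> \<sigma> \<in> {s + \<epsilon>..s + 2 * pi - \<epsilon>}"
proof
  assume k: "\<forall>k::int. \<epsilon> \<le> \<bar>\<sigma> - s - 2 * pi * of_int k\<bar>"
  show "\<sigma> \<in> {s + \<epsilon>..s + 2 * pi - \<epsilon>}"
    using k[rule_format, of 0] k[rule_format, of 1] assms by auto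
next
  assume \<sigma>: "\<sigma> \<in> {s + \<epsilon>..s + 2 * pi - \<epsilon>}"
  show "\<forall>k::int. \<epsilon> \<le> \<bar>\<sigma> - s - 2 * pi * of_int k\<bar>"
  proof
    fix k :: int
    show "\<epsilon> \<le> \<bar>\<sigma> - s - 2 * pi * of_int k\<bar>"
    proof (cases "k \<le> 0")
      case True
      then have "2 * pi * of_int k \<le> 0" by (simp add: mult_nonneg_nonpos)
      then show ?thesis using \<sigma> by auto
    next
      case False
      then have "2 * pi * 1 \<le> 2 * pi * of_int k" by (intro mult_left_mono) auto
      then show ?thesis using \<sigma> unfolding atLeastAtMost_iff by linarith
    qed
  qed
qed

text \<open>
  Extended by zero to the removed arcs, the integrand is still \<open>2\<pi>\<close>-periodic. So \<open>[0, 2\<pi>]\<close> may be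
  replaced by \<open>[s, s + 2\<pi>]\<close>, where exactly the two ends are removed.
\<close>

lemma has_integral_removed_arc:
  fixes k :: "real \<Rightarrow> complex"
  assumes per: "\<And>t. k (t + 2 * pi) = k t" and \<epsilon>: "\<epsilon> > 0"
    and I: "(k has_integral I) {s + \<epsilon>..s + 2 * pi - \<epsilon>}"
  shows "(k has_integral I) {\<sigma> \<in> {0..2 * pi}. \<forall>j::int. \<epsilon> \<le> \<bar>\<sigma> - s - 2 * pi * of_int j\<bar>}"
proof -
  define P where "P = (\<lambda>\<sigma>. \<forall>j::int. \<epsilon> \<le> \<bar>\<sigma> - s - 2 * pi * of_int j\<bar>)"
  define K where "K = (\<lambda>\<sigma>. if P \<sigma> then k \<sigma> else 0)"
  have Pper: "P (\<sigma> + 2 * pi) = P \<sigma>" for \<sigma>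
  proof -
    have e1: "\<bar>\<sigma> + 2 * pi - s - 2 * pi * of_int j\<bar> = \<bar>\<sigma> - s - 2 * pi * of_int (j - 1)\<bar>" for j :: int
      by (simp add: algebra_simps)
    have e2: "\<bar>\<sigma> - s - 2 * pi * of_int j\<bar> = \<bar>\<sigma> + 2 * pi - s - 2 * pi * of_int (j + 1)\<bar>" for j :: int
      by (simp add: algebra_simps)
    show ?thesis unfolding P_def using e1 e2 by metis
  qed
  have "((\<lambda>x. if x \<in> {s + \<epsilon>..s + 2 * pi - \<epsilon>} then k x else 0) has_integral I) {s..s + 2 * pi}"
    using I \<epsilon> by (subst has_integral_restrict) auto
  then have "(K has_integral I) {s..s + 2 * pi}"
    by (rule has_integral_eq[rotated]) (use circle_arc_iff[OF \<epsilon>] in \<open>auto simp: K_def P_def\<close>)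
  then have "(K has_integral I) {0..0 + 2 * pi}"
    by (rule integral_periodic_shift[rotated 2]) (auto simp: K_def per Pper)
  then have "(K has_integral I) {0..2 * pi}" by simp
  then have "((\<lambda>x. if x \<in> {\<sigma> \<in> {0..2 * pi}. P \<sigma>} then k x else 0) has_integral I) {0..2 * pi}"
    by (rule has_integral_eq[rotated]) (auto simp: K_def)
  then have "(k has_integral I) {\<sigma> \<in> {0..2 * pi}. P \<sigma>}" by (subst (asm) has_integral_restrict) auto
  then show ?thesis by (simp only: P_def)
qed

text \<open>
  Let \<open>\<theta> = \<Theta> s\<close>. Splitting \<open>w = w \<theta> + (w - w \<theta>)\<close> leaves a continuous integrand and the pure
  cotangent \<open>cot (x / 2)\<close>, whose primitive is \<open>2 ln (sin (x / 2))\<close>. The boundary terms at both ends of the removed arc cancel in the limit, because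
  \<open>\<Theta>\<close> is differentiable at \<open>s\<close> with positive derivative, so that the image of the arc is
  asymptotically symmetric.
\<close>

lemma has_circle_pv_cot:
  fixes w w' :: "real \<Rightarrow> complex" and \<Theta> \<Theta>' :: "real \<Rightarrow> real"
  assumes \<Theta>: "\<And>s. (\<Theta> has_real_derivative \<Theta>' s) (at s)" and pos: "\<And>s. \<Theta>' s > 0"
    and \<Theta>per: "\<And>s. \<Theta> (s + 2 * pi) = \<Theta> s + 2 * pi"
    and w: "\<And>t. (w has_vector_derivative w' t) (at t)" and wper: "\<And>t. w (t + 2 * pi) = w t"
  shows "has_circle_pv (\<lambda>\<sigma>. of_real (\<Theta>' \<sigma> * cot ((\<Theta> \<sigma> - \<Theta> s) / 2)) * w (\<Theta> \<sigma>)) s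
    (integral {0..2 * pi} (\<lambda>t. \<i> * (cis (t - \<Theta> s) + 1) * chord_quotient w w' (\<Theta> s) t))"
proof -
  define \<theta> where "\<theta> = \<Theta> s"
  define f where "f = (\<lambda>t. \<i> * (cis (t - \<theta>) + 1) * chord_quotient w w' \<theta> t)"
  define k where "k = (\<lambda>\<sigma>. of_real (\<Theta>' \<sigma> * cot ((\<Theta> \<sigma> - \<theta>) / 2)) * w (\<Theta> \<sigma>))"
  define J where "J = (\<lambda>t. integral {\<theta>..t} f)"
  define P where "P = (\<lambda>t. J t + of_real (2 * ln (sin ((t - \<theta>) / 2))) * w \<theta>)"
  have cont\<Theta>: "continuous_on A \<Theta>" for A
    using \<Theta> by (meson DERIV_isCont continuous_at_imp_continuous_on)
  have mono: "\<Theta> x < \<Theta> y" if "x < y" for x y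
    using DERIV_pos_imp_increasing[OF that] \<Theta> pos by blast
  have \<Theta>'per: "\<Theta>' (t + 2 * pi) = \<Theta>' t" for t
  proof -
    have "((\<lambda>t. \<Theta> (t + 2 * pi)) has_real_derivative \<Theta>' (t + 2 * pi)) (at t)"
      using \<Theta>[of "t + 2 * pi"] by (simp only: DERIV_shift)
    then have "((\<lambda>t. \<Theta> t + 2 * pi) has_real_derivative \<Theta>' (t + 2 * pi)) (at t)" by (simp only: \<Theta>per)
    moreover have "((\<lambda>t. \<Theta> t + 2 * pi) has_real_derivative \<Theta>' t) (at t)"
      using DERIV_add[OF \<Theta>[of t] DERIV_const] by simp
    ultimately show ?thesis by (rule DERIV_unique)
  qed
  have kper: "k (t + 2 * pi) = k t" for t
  proof -
    have "cot ((\<Theta> t + 2 * pi - \<theta>) / 2) = cot ((\<Theta> t - \<theta>) / 2)"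
    proof -
      have "(\<Theta> t + 2 * pi - \<theta>) / 2 = (\<Theta> t - \<theta>) / 2 + pi" by (simp add: field_simps)
      then show ?thesis by (simp only: cot_def sin_periodic_pi cos_periodic_pi)
    qed
    then show ?thesis by (simp add: k_def \<Theta>per \<Theta>'per wper)
  qed
  have f: "continuous_on A f" for A
    unfolding f_def
    by (intro continuous_intros continuous_on_subset[OF continuous_chord_quotient[OF w wper]]) auto
  have w'per: "w' (t + 2 * pi) = w' t" for t
    by (rule has_vector_derivative_periodic[OF w wper])
  have fper: "f (t + 2 * pi) = f t" for t
  proof -
    have "cis (t + 2 * pi - \<theta>) = cis (t - \<theta>)"
      by (metis add_diff_eq diff_add_eq cis_mult cis_2pi mult.right_neutral)
    then show ?thesis by (simp add: f_def chord_quotient_def wper w'per)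
  qed
  have J': "(J has_vector_derivative f t) (at t)" if t: "\<theta> < t" "t < \<theta> + 2 * pi" for t
  proof -
    have "(J has_vector_derivative f t) (at t within {\<theta>..\<theta> + 2 * pi})"
      unfolding J_def by (rule integral_has_vector_derivative[OF f]) (use t in auto)
    then show ?thesis using t by (simp add: at_within_Icc_at)
  qed
  have P': "(P has_vector_derivative of_real (cot ((t - \<theta>) / 2)) * w t) (at t)"
    if t: "\<theta> < t" "t < \<theta> + 2 * pi" for t
  proof -
    have s0: "sin ((t - \<theta>) / 2) > 0" using t by (intro sin_gt_zero) auto
    have "((\<lambda>t. 2 * ln (sin ((t - \<theta>) / 2))) has_real_derivative cot ((t - \<theta>) / 2)) (at t)"
      using s0 by (auto intro!: derivative_eq_intros simp: cot_def)
    then have "((\<lambda>t. of_real (2 * ln (sin ((t - \<theta>) / 2)))) has_vector_derivative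
        complex_of_real (cot ((t - \<theta>) / 2))) (at t)"
      by (rule has_vector_derivative_of_real)
    then have "(P has_vector_derivative f t + of_real (cot ((t - \<theta>) / 2)) * w \<theta>) (at t)"
      unfolding P_def by (intro has_vector_derivative_add J'[OF t] has_vector_derivative_mult_left)
    moreover have "f t = of_real (cot ((t - \<theta>) / 2)) * (w t - w \<theta>)"
    proof -
      have c1: "cis (t - \<theta>) \<noteq> 1"
      proof
        assume "cis (t - \<theta>) = 1"
        then obtain n :: int where n: "t - \<theta> = 2 * pi * of_int n" using cis_eq_1_iff by blast
        then have "0 < 2 * pi * of_int n" "2 * pi * of_int n < 2 * pi * 1" using t by linarith+
        then have "0 < n" "of_int n < (1::real)" by (auto simp: zero_less_mult_iff)
        then show False by simp
      qed
      show ?thesis unfolding cot_half_eq[OF c1, symmetric] using c1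
        by (simp add: f_def chord_quotient_def)
    qed
    ultimately show ?thesis by (simp add: algebra_simps)
  qed
  have k_int: "(k has_integral P (\<Theta> (s - \<epsilon>) + 2 * pi) - P (\<Theta> (s + \<epsilon>))) {s + \<epsilon>..s + 2 * pi - \<epsilon>}"
    if \<epsilon>: "0 < \<epsilon>" "\<epsilon> \<le> pi" for \<epsilon>
  proof -
    have "(k has_integral P (\<Theta> (s + 2 * pi - \<epsilon>)) - P (\<Theta> (s + \<epsilon>))) {s + \<epsilon>..s + 2 * pi - \<epsilon>}"
    proof (rule fundamental_theorem_of_calculus)
      show "s + \<epsilon> \<le> s + 2 * pi - \<epsilon>" using \<epsilon> by simp
      fix x assume x: "x \<in> {s + \<epsilon>..s + 2 * pi - \<epsilon>}"
      have "\<theta> < \<Theta> x" using mono[of s x] x \<epsilon> by (simp add: \<theta>_def)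
      moreover have "\<Theta> x < \<theta> + 2 * pi" using mono[of x "s + 2 * pi"] x \<epsilon> by (simp add: \<theta>_def \<Theta>per)
      ultimately have "(P has_vector_derivative of_real (cot ((\<Theta> x - \<theta>) / 2)) * w (\<Theta> x)) (at (\<Theta> x))"
        by (rule P')
      from vector_diff_chain_at[OF \<Theta>[unfolded has_real_derivative_iff_has_vector_derivative] this]
      have "((\<lambda>x. P (\<Theta> x)) has_vector_derivative k x) (at x)"
        by (simp add: comp_def k_def scaleR_conv_of_real mult.assoc)
      then show "((\<lambda>x. P (\<Theta> x)) has_vector_derivative k x) (at x within {s + \<epsilon>..s + 2 * pi - \<epsilon>})"
        by (rule has_vector_derivative_at_within)
    qed
    then show ?thesis using \<Theta>per[of "s - \<epsilon>"] by (simp add: algebra_simps)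
  qed
  let ?A = "\<lambda>\<epsilon>. {\<sigma> \<in> {0..2 * pi}. \<forall>j::int. \<epsilon> \<le> \<bar>\<sigma> - s - 2 * pi * of_int j\<bar>}"
  have A_int: "(k has_integral P (\<Theta> (s - \<epsilon>) + 2 * pi) - P (\<Theta> (s + \<epsilon>))) (?A \<epsilon>)"
    if "0 < \<epsilon>" "\<epsilon> \<le> pi" for \<epsilon>
    by (rule has_integral_removed_arc[OF kper that(1) k_int[OF that]])
  have integrable: "k integrable_on ?A \<epsilon>" if \<epsilon>: "0 < \<epsilon>" for \<epsilon>
  proof (cases "\<epsilon> \<le> pi")
    case True
    then show ?thesis using A_int[OF \<epsilon>] by blast
  next
    case False
    have "(k has_integral 0) {s + \<epsilon>..s + 2 * pi - \<epsilon>}" using False by (simp add: has_integral_empty_eq)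
    from has_integral_removed_arc[OF kper \<epsilon> this] show ?thesis by blast
  qed

  let ?j = "\<lambda>\<epsilon>. J (\<Theta> (s - \<epsilon>) + 2 * pi) - J (\<Theta> (s + \<epsilon>))"
  let ?l = "\<lambda>\<epsilon>. 2 * ln (sin ((\<Theta> (s - \<epsilon>) + 2 * pi - \<theta>) / 2)) - 2 * ln (sin ((\<Theta> (s + \<epsilon>) - \<theta>) / 2))"
  have limJ: "(?j \<longlongrightarrow> integral {0..2 * pi} f) (at_right 0)"
  proof -
    have cJ: "continuous_on {\<theta>..\<theta> + 2 * pi} J"
      unfolding J_def by (intro indefinite_integral_continuous_1 integrable_continuous_interval f)
    have m: "\<Theta> x \<le> \<Theta> y" if "x \<le> y" for x y using mono[of x y] that by (cases "x = y") auto
    have i1: "\<Theta> (s - \<epsilon>) + 2 * pi \<in> {\<theta>..\<theta> + 2 * pi}" if "\<epsilon> \<in> {0..pi}" for \<epsilon>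
      using m[of s "s - \<epsilon> + 2 * pi"] m[of "s - \<epsilon>" s] that by (auto simp: \<theta>_def \<Theta>per)
    have i2: "\<Theta> (s + \<epsilon>) \<in> {\<theta>..\<theta> + 2 * pi}" if "\<epsilon> \<in> {0..pi}" for \<epsilon>
      using m[of s "s + \<epsilon>"] m[of "s + \<epsilon>" "s + 2 * pi"] that by (auto simp: \<theta>_def \<Theta>per)
    have "continuous_on {0..pi} ?j"
      using i1 i2
      by (intro continuous_intros continuous_on_compose2[OF cJ] continuous_on_compose2[OF cont\<Theta>]) auto
    then have "(?j \<longlongrightarrow> J (\<theta> + 2 * pi) - J \<theta>) (at 0 within {0..pi})"
      by (force simp: continuous_on_def \<theta>_def)
    moreover have "J \<theta> = 0" by (simp add: J_def)
    moreover have "J (\<theta> + 2 * pi) = integral {0..2 * pi} f"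
    proof -
      have "(f has_integral integral {0..2 * pi} f) {0..0 + 2 * pi}"
        by (auto intro!: integrable_integral integrable_continuous_interval f)
      from integral_periodic_shift[OF _ fper this, of \<theta>] show ?thesis by (simp add: J_def integral_unique)
    qed
    ultimately show ?thesis by (simp add: at_within_Icc_at_right)
  qed
  have limlog: "(?l \<longlongrightarrow> 0) (at_right 0)"
  proof -
    define N where "N = (\<lambda>\<epsilon>. sin ((\<theta> - \<Theta> (s - \<epsilon>)) / 2))"
    define D where "D = (\<lambda>\<epsilon>. sin ((\<Theta> (s + \<epsilon>) - \<theta>) / 2))"
    have d1: "((\<lambda>\<epsilon>. \<Theta> (s - \<epsilon>)) has_real_derivative - \<Theta>' s) (at 0)"
    proof -
      have "((\<lambda>\<epsilon>. s - \<epsilon>) has_real_derivative - 1) (at 0)" by (auto intro!: derivative_eq_intros)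
      from DERIV_chain2[OF _ this, of \<Theta> "\<Theta>' s"] \<Theta>[of s] show ?thesis by simp
    qed
    have d2: "((\<lambda>\<epsilon>. \<Theta> (s + \<epsilon>)) has_real_derivative \<Theta>' s) (at 0)"
    proof -
      have "((\<lambda>\<epsilon>. s + \<epsilon>) has_real_derivative 1) (at 0)" by (auto intro!: derivative_eq_intros)
      from DERIV_chain2[OF _ this, of \<Theta> "\<Theta>' s"] \<Theta>[of s] show ?thesis by simp
    qed
    have "(N has_real_derivative \<Theta>' s / 2) (at 0)"
      unfolding N_def by (auto intro!: derivative_eq_intros d1 simp: \<theta>_def)
    then have lN: "((\<lambda>\<epsilon>. N \<epsilon> / \<epsilon>) \<longlongrightarrow> \<Theta>' s / 2) (at_right 0)"
      unfolding has_field_derivative_iff by (auto simp: N_def \<theta>_def intro: tendsto_within_subset)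
    have "(D has_real_derivative \<Theta>' s / 2) (at 0)"
      unfolding D_def by (auto intro!: derivative_eq_intros d2 simp: \<theta>_def)
    then have lD: "((\<lambda>\<epsilon>. D \<epsilon> / \<epsilon>) \<longlongrightarrow> \<Theta>' s / 2) (at_right 0)"
      unfolding has_field_derivative_iff by (auto simp: D_def \<theta>_def intro: tendsto_within_subset)
    have "((\<lambda>\<epsilon>. 2 * ln (N \<epsilon> / \<epsilon>) - 2 * ln (D \<epsilon> / \<epsilon>)) \<longlongrightarrow> 2 * ln (\<Theta>' s / 2) - 2 * ln (\<Theta>' s / 2)) (at_right 0)"
      by (intro tendsto_intros lN lD) (use pos[of s] in auto)
    moreover have "\<forall>\<^sub>F \<epsilon> in at_right 0. 2 * ln (N \<epsilon> / \<epsilon>) - 2 * ln (D \<epsilon> / \<epsilon>) =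
        ?l \<epsilon>"
    proof -
      have "\<forall>\<^sub>F \<epsilon> in at_right 0. N \<epsilon> / \<epsilon> > 0" "\<forall>\<^sub>F \<epsilon> in at_right 0. D \<epsilon> / \<epsilon> > 0"
        using order_tendstoD(1)[OF lN, of 0] order_tendstoD(1)[OF lD, of 0] pos[of s] by auto
      moreover have "\<forall>\<^sub>F \<epsilon> in at_right 0. \<epsilon> > (0::real)" by (simp add: eventually_at_right_less)
      ultimately show ?thesis
      proof eventually_elim
        case (elim \<epsilon>)
        have "sin ((\<Theta> (s - \<epsilon>) + 2 * pi - \<theta>) / 2) = N \<epsilon>"
        proof -
          have "(\<Theta> (s - \<epsilon>) + 2 * pi - \<theta>) / 2 = pi - (\<theta> - \<Theta> (s - \<epsilon>)) / 2" by (simp add: field_simps)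
          then show ?thesis by (simp only: sin_pi_minus N_def)
        qed
        then show ?case using elim by (simp add: ln_div zero_less_divide_iff) (simp add: D_def)
      qed
    qed
    ultimately show ?thesis using tendsto_cong by force
  qed
  have "((\<lambda>\<epsilon>. integral (?A \<epsilon>) k) \<longlongrightarrow> integral {0..2 * pi} f) (at_right 0)"
  proof -
    have "((\<lambda>\<epsilon>. ?j \<epsilon> +
        of_real (?l \<epsilon>) * w \<theta>)
        \<longlongrightarrow> integral {0..2 * pi} f + of_real 0 * w \<theta>) (at_right 0)"
      by (intro tendsto_intros limJ limlog)
    moreover have "\<forall>\<^sub>F \<epsilon> in at_right 0. ?j \<epsilon> +
        of_real (?l \<epsilon>) * w \<theta>
        = integral (?A \<epsilon>) k"
    proof -
      have "\<forall>\<^sub>F \<epsilon> in at_right 0. \<epsilon> \<in> {0<..<pi}" by (rule eventually_at_right_real) simp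
      then show ?thesis
      proof eventually_elim
        case (elim \<epsilon>)
        then have "integral (?A \<epsilon>) k = P (\<Theta> (s - \<epsilon>) + 2 * pi) - P (\<Theta> (s + \<epsilon>))"
          using A_int[of \<epsilon>] integral_unique by auto
        then show ?case by (simp add: P_def algebra_simps)
      qed
    qed
    ultimately show ?thesis using tendsto_cong by force
  qed
  then show ?thesis
    unfolding has_circle_pv_def Let_def using integrable by (simp add: k_def f_def \<theta>_def)
qed

section \<open>The Hilbert transform in the natural parametrization\<close>

lemma smooth_on_cis: "smooth_on UNIV cis"
proof -
  have "Ck_on k UNIV cis" for k
  proof (induction k)
    case 0
    show ?case using continuous_on_cis[of UNIV "\<lambda>t. t"] by simp
  next
    case (Suc k)
    show ?case
      by (rule Ck_on_SucI[where f' = "\<lambda>t h. h *\<^sub>R (\<i> * cis t)"])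
        (use cis_vector_derivative Suc in \<open>auto simp: has_vector_derivative_def intro!: Ck_on_scaleR Ck_on_mult Ck_on_const\<close>)
  qed
  then show ?thesis by (simp add: smooth_on_def)
qed

text \<open>
  The speed is the modulus of the derivative of \<open>imm M (\<Phi> (cis t))\<close>. This curve is smooth because locally
  it factors through a chart, and its derivative vanishes nowhere, so that the modulus is smooth as well.
\<close>

lemma (in disk_surface) boundary_speed_smooth: "smooth_on UNIV (\<lambda>t. cmod (\<Phi>' (cis t)))"
proof -
  define G where "G = (\<lambda>t. imm M (\<Phi> (cis t)))"
  have Gd: "(G has_vector_derivative \<i> * cis t * \<Phi>' (cis t)) (at t)" for t
  proof -
    have "(imm M \<circ> \<Phi> has_derivative (*) (\<Phi>' (cis t))) (at (cis t) within range cis)"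
      by (rule has_derivative_subset[OF der[of "cis t", unfolded has_field_derivative_def]]) auto
    from has_derivative_in_compose[OF cis_vector_derivative[unfolded has_vector_derivative_def] this]
    show ?thesis by (simp add: G_def has_vector_derivative_def comp_def mult_ac)
  qed
  have "smooth_on UNIV G"
  proof (rule smooth_on_open_local)
    fix t :: real
    obtain U c where c: "(U, c) \<in> charts M" "\<Phi> (cis t) \<in> U" using chart_exists[OF \<Phi>_in[of "cis t"]] by auto
    let ?V = "{t. \<Phi> (cis t) \<in> U}"
    have "continuous_on UNIV (\<lambda>t. \<Phi> (cis t))"
      by (intro continuous_on_compose2[OF continuous_\<Phi>] continuous_intros) auto
    then have "open ?V" by (rule preimage_open[OF c(1)]) (auto simp: \<Phi>_in)
    moreover have "smooth_on ?V G"
    proof -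
      have 1: "smooth_on (c ` U) (imm M \<circ> inv_into U c)"
        using immersion c(1) by (auto simp: smooth_immersion_def smooth_fun_def)
      have 2: "smooth_on ?V (\<lambda>t. c (\<Phi> (cis t)))"
        by (rule smooth_on_compose[OF smooth_chart_\<Phi>[OF c(1)] smooth_on_subset[OF smooth_on_cis]]) auto
      have "smooth_on ?V (\<lambda>t. (imm M \<circ> inv_into U c) (c (\<Phi> (cis t))))"
        by (rule smooth_on_compose[OF 1 2]) auto
      then show ?thesis by (rule smooth_on_cong) (use c in \<open>auto simp: G_def\<close>)
    qed
    ultimately show "\<exists>N. open N \<and> t \<in> N \<and> smooth_on N G" using c(2) by blast
  qed
  then obtain G' where G': "\<And>t. (G has_vector_derivative G' t) (at t)" "smooth_on UNIV G'"
    using smooth_on_real_deriv by blast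
  have eq: "G' t = \<i> * cis t * \<Phi>' (cis t)" for t
    using vector_derivative_unique_at[OF G'(1) Gd] .
  have "smooth_on UNIV (\<lambda>t. cmod (G' t))"
    unfolding smooth_on_def
  proof (intro allI Ck_on_norm_nonzero)
    show "Ck_on k UNIV G'" for k using G'(2) by (simp add: smooth_on_def)
    show "G' t \<noteq> 0" for t using \<Phi>'_nonzero[of "cis t"] by (simp add: eq)
  qed
  then show ?thesis by (rule smooth_on_cong) (simp add: eq norm_mult)
qed

theorem theorem3p4:
  fixes M :: "'a::t2_space immersed_surface"
    and \<gamma> \<Phi> :: "complex \<Rightarrow> 'a"
    and \<Phi>' u :: "complex \<Rightarrow> complex"
    and S \<Theta> :: "real \<Rightarrow> real"
    and s\<^sub>0 :: real
  assumes "multisheeted_domain M"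
    and "bdry_length M = 2 * pi"
    and "arclength_diffeo M \<gamma>"
    and "0 < s\<^sub>0" and "s\<^sub>0 < pi"
    and "disk_biholomorphism M \<Phi>"
    and "\<Phi> 1 = \<gamma> 1"
    and "\<Phi> (cis s\<^sub>0) = \<gamma> (cis s\<^sub>0)"
    and "\<Phi> (cis (- s\<^sub>0)) = \<gamma> (cis (- s\<^sub>0))"
    and "\<And>z. z \<in> cball 0 1 \<Longrightarrow>
           (imm M \<circ> \<Phi> has_field_derivative \<Phi>' z) (at z within cball 0 1)"
    and "\<And>\<theta>. S \<theta> = (LBINT t=0..\<theta>. cmod (\<Phi>' (cis t)))"
    and "\<And>s. S (\<Theta> s) = s" and "\<And>\<theta>. \<Theta> (S \<theta>) = \<theta>"
    and "smooth_circle_fun u"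
  shows "\<exists>C. \<forall>s. \<exists>I.
           has_circle_pv
             (\<lambda>\<sigma>. of_real (deriv \<Theta> \<sigma> * cot ((\<Theta> \<sigma> - \<Theta> s) / 2)) * u (cis \<sigma>)) s I \<and>
           hilbert_natural M \<gamma> u (cis s) = 1 / (2 * of_real pi * \<i>) * I + C"
proof -
  note \<gamma> = assms(3) and \<Phi>1 = assms(7) and S_def = assms(11) and S\<Theta> = assms(12) and \<Theta>S = assms(13)
  interpret disk_surface M \<Phi> \<Phi>'
    by (rule disk_surface.intro[OF assms(1,6,10)])
  let ?m = "\<lambda>t. cmod (\<Phi>' (cis t))"
  have m_smooth: "smooth_on UNIV ?m" by (rule boundary_speed_smooth)
  have m_cont: "continuous_on A ?m" for A
    using smooth_on_continuous[OF m_smooth] continuous_on_subset by blast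
  have m_pos: "?m t > 0" for t using \<Phi>'_nonzero[of "cis t"] by simp
  have S': "(S has_real_derivative ?m t) (at t)" for t
  proof -
    \<comment> \<open>an interval around \<open>t\<close> that contains the base point \<open>0\<close> of the integral\<close>
    let ?a = "min 0 t - 1" and ?b = "max 0 t + 1"
    have "((\<lambda>v. LBINT y=ereal 0..ereal v. ?m y) has_vector_derivative ?m t) (at t within {?a..?b})"
      by (rule interval_integral_FTC2[OF _ _ m_cont]) auto
    then have "(S has_vector_derivative ?m t) (at t within {?a..?b})"
      unfolding S_def[abs_def] by (simp add: zero_ereal_def)
    moreover have "at t within {?a..?b} = at t" by (rule at_within_Icc_at) auto
    ultimately show ?thesis by (simp add: has_real_derivative_iff_has_vector_derivative)
  qed
  have S_smooth: "smooth_on UNIV S"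
    by (rule smooth_on_real_antideriv[OF _ m_smooth])
      (use S' in \<open>simp add: has_real_derivative_iff_has_vector_derivative\<close>)
  have \<Theta>': "(\<Theta> has_real_derivative 1 / ?m (\<Theta> s)) (at s)" for s
  proof -
    have "isCont \<Theta> (S (\<Theta> s))"
      by (rule isCont_inverse_function[where d = 1 and f = S and g = \<Theta>]) (simp_all add: \<Theta>S DERIV_isCont[OF S'])
    then have "isCont \<Theta> s" by (simp add: S\<Theta>)
    then have "(\<Theta> has_real_derivative inverse (?m (\<Theta> s))) (at s)"
      using DERIV_inverse_function[where f = S and g = \<Theta> and x = s and a = "s - 1" and b = "s + 1", OF S']
        m_pos[of "\<Theta> s"] S\<Theta> by simp
    then show ?thesis by (simp add: inverse_eq_divide)
  qed
  have S0: "S 0 = 0" unfolding S_def by (simp add: zero_ereal_def)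
  have \<Theta>0: "\<Theta> 0 = 0" using \<Theta>S[of 0] S0 by simp

  \<comment> \<open>Both sides are unit speed parametrizations, which agree at \<open>s = 0\<close>.\<close>
  have \<gamma>\<Theta>: "\<gamma> (cis s) = \<Phi> (cis (\<Theta> s))" for s
  proof -
    obtain a where a: "\<And>t. \<Phi> (cis (\<Theta> t)) = \<gamma> (cis (t + a))"
      by (rule unit_speed_curve_rotation[OF \<gamma> unit_speed_curve_reparametrized[OF \<Theta>']]) (rule that, blast)
    have "\<gamma> (cis a) = \<gamma> 1" using a[of 0] \<Phi>1 \<Theta>0 by simp
    moreover have "inj_on \<gamma> (sphere 0 1)" using \<gamma> by (auto simp: arclength_diffeo_def bij_betw_def)
    ultimately have "cis a = 1" by (metis inj_onD mem_sphere_0 norm_cis norm_one)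
    then show ?thesis using a[of s] by (simp flip: cis_mult)
  qed
  have \<Phi>inj: "cis x = cis y" if "\<Phi> (cis x) = \<Phi> (cis y)" for x y
    using bij that by (metis \<Psi>_\<Phi> mem_cball_0 norm_cis order_refl)
  have \<gamma>inj: "cis x = cis y" if "\<gamma> (cis x) = \<gamma> (cis y)" for x y
    using \<gamma> that by (metis arclength_diffeo_def bij_betw_def inj_onD mem_sphere_0 norm_cis)

  \<comment> \<open>\<open>S (2 \<pi>)\<close> and \<open>\<Theta> (2 \<pi>)\<close> are both positive multiples of \<open>2 \<pi>\<close> since \<open>\<gamma>\<close> and \<open>\<Phi>\<close> are injective;
    as \<open>S\<close> and \<open>\<Theta>\<close> are increasing and inverse to each other, both are equal to \<open>2 \<pi>\<close>.\<close>
  have S_add: "S (t + 2 * pi) = S t + S (2 * pi)" for t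
  proof -
    have "((\<lambda>t. S (t + 2 * pi) - S t) has_real_derivative 0) (at t)" for t
    proof -
      have "((\<lambda>t. S (t + 2 * pi)) has_real_derivative ?m (t + 2 * pi)) (at t)"
        using S'[of "t + 2 * pi"] by (simp only: DERIV_shift)
      moreover have "?m (t + 2 * pi) = ?m t" by (simp flip: cis_mult)
      ultimately show ?thesis using DERIV_diff[OF _ S'[of t]] by fastforce
    qed
    then have "S (t + 2 * pi) - S t = S (0 + 2 * pi) - S 0"
      using DERIV_isconst_all[of "\<lambda>t. S (t + 2 * pi) - S t" t 0] by blast
    then show ?thesis using S0 by simp
  qed
  have S_mono: "S x < S y" if "x < y" for x y
    using DERIV_pos_imp_increasing[OF that] S' m_pos by blast
  have S2pi: "S (2 * pi) = 2 * pi"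
  proof -
    have pos: "S (2 * pi) > 0" using S_mono[of 0 "2 * pi"] S0 by simp
    have "\<gamma> (cis (S (2 * pi))) = \<gamma> (cis 0)" using \<gamma>\<Theta>[of "S (2 * pi)"] \<gamma>\<Theta>[of 0] by (simp add: \<Theta>S \<Theta>0)
    then have "cis (S (2 * pi)) = 1" using \<gamma>inj by fastforce
    then obtain k :: int where k: "S (2 * pi) = 2 * pi * of_int k" using cis_eq_1_iff by blast
    have k1: "k \<ge> 1" using pos unfolding k by (simp add: zero_less_mult_iff)
    have "\<Phi> (cis (\<Theta> (2 * pi))) = \<Phi> (cis 0)" using \<gamma>\<Theta>[of "2 * pi"] \<gamma>\<Theta>[of 0] by (simp add: \<Theta>0)
    then have "cis (\<Theta> (2 * pi)) = 1" using \<Phi>inj by fastforce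
    then obtain j :: int where j: "\<Theta> (2 * pi) = 2 * pi * of_int j" using cis_eq_1_iff by blast
    have "\<Theta> (2 * pi) > 0"
      using S_mono[of "\<Theta> (2 * pi)" 0] S0 S\<Theta>[of "2 * pi"] pi_gt_zero by (smt (verit))
    then have j1: "j \<ge> 1" unfolding j by (simp add: zero_less_mult_iff)
    have "S (2 * pi) \<le> S (\<Theta> (2 * pi))"
    proof -
      have "2 * pi * 1 \<le> 2 * pi * of_int j" using j1 by (intro mult_left_mono) auto
      then show ?thesis using S_mono[of "2 * pi" "\<Theta> (2 * pi)"] j by (cases "2 * pi = \<Theta> (2 * pi)") auto
    qed
    then have "2 * pi * of_int k \<le> 2 * pi * 1" using S\<Theta>[of "2 * pi"] k by simp
    then have "of_int k \<le> (1::real)" by simp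
    then show ?thesis using k1 k by simp
  qed
  have \<Theta>per: "\<Theta> (s + 2 * pi) = \<Theta> s + 2 * pi" for s
    using S_add[of "\<Theta> s"] \<Theta>S[of "\<Theta> s + 2 * pi"] by (simp add: S\<Theta> S2pi)

  define w where "w = (\<lambda>t. u (cis (S t)))"
  have w_smooth: "smooth_on UNIV w"
    unfolding w_def using assms(14) S_smooth unfolding smooth_circle_fun_def
    by (rule smooth_on_compose) simp
  have w_per: "w (t + 2 * pi) = w t" for t
    by (simp add: w_def S_add S2pi flip: cis_mult)
  obtain w' where w': "\<And>t. (w has_vector_derivative w' t) (at t)"
    using smooth_on_real_deriv[OF w_smooth] by blast
  let ?a = "analytic_coeffs w" and ?b = "antianalytic_coeffs w"
  note rd = rapidly_decreasing_analytic_coeffs[OF w_smooth w_per]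
  let ?f = "u \<circ> inv_into (sphere 0 1) \<gamma>"
  have f: "?f (\<Phi> z) = pseries ?a z + cnj (pseries ?b z)" if "cmod z = 1" for z
  proof -
    obtain t where t: "z = cis t" using unit_circle_cis \<open>cmod z = 1\<close> by blast
    have "\<Phi> z = \<gamma> (cis (S t))" by (simp add: t \<gamma>\<Theta> \<Theta>S)
    moreover have "inv_into (sphere 0 1) \<gamma> (\<gamma> (cis (S t))) = cis (S t)"
      by (rule bij_betw_inv_into_left[of _ _ "bdry M"]) (use \<gamma> in \<open>auto simp: arclength_diffeo_def\<close>)
    ultimately have "?f (\<Phi> z) = w t" by (simp add: w_def)
    then show ?thesis using fourier_halves(1)[OF w' w_smooth w_per, of t] t by simp
  qed
  obtain C where C: "\<And>s. hilbert_bdry M ?f (\<gamma> (cis s)) =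
      pseries ?a (cis (\<Theta> s)) - cnj (pseries ?b (cis (\<Theta> s))) + C"
    by (rule hilbert_bdry_eq[OF \<gamma> \<Theta>' \<gamma>\<Theta> rd]) (erule f, rule that, blast)
  show ?thesis
  proof (rule exI[of _ "fourier_coeff w 0 + C"], rule allI)
    fix s
    let ?I = "integral {0..2 * pi} (\<lambda>t. \<i> * (cis (t - \<Theta> s) + 1) * chord_quotient w w' (\<Theta> s) t)"
    have "has_circle_pv (\<lambda>\<sigma>. of_real (1 / ?m (\<Theta> \<sigma>) * cot ((\<Theta> \<sigma> - \<Theta> s) / 2)) * w (\<Theta> \<sigma>)) s ?I"
      by (rule has_circle_pv_cot[OF \<Theta>' divide_pos_pos[OF zero_less_one m_pos] \<Theta>per w' w_per])
    moreover have "deriv \<Theta> \<sigma> = 1 / ?m (\<Theta> \<sigma>)" for \<sigma> by (rule DERIV_imp_deriv[OF \<Theta>'])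
    ultimately have pv: "has_circle_pv (\<lambda>\<sigma>. of_real (deriv \<Theta> \<sigma> * cot ((\<Theta> \<sigma> - \<Theta> s) / 2)) * u (cis \<sigma>)) s ?I"
      by (simp add: w_def S\<Theta>)
    have "?I = \<i> * integral {0..2 * pi} (\<lambda>t. (cis (t - \<Theta> s) + 1) * chord_quotient w w' (\<Theta> s) t)"
      by (simp add: mult.assoc)
    then have "hilbert_natural M \<gamma> u (cis s) = 1 / (2 * of_real pi * \<i>) * ?I + (fourier_coeff w 0 + C)"
      using C[of s] fourier_halves(2)[OF w' w_smooth w_per, of "\<Theta> s"]
      by (simp add: hilbert_natural_def)
    then show "\<exists>I. has_circle_pv (\<lambda>\<sigma>. of_real (deriv \<Theta> \<sigma> * cot ((\<Theta> \<sigma> - \<Theta> s) / 2)) * u (cis \<sigma>)) s I \<and>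
        hilbert_natural M \<gamma> u (cis s) = 1 / (2 * of_real pi * \<i>) * I + (fourier_coeff w 0 + C)"
      using pv by blast
  qed
qed

end
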